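(* Let $\Bbbk$ be a field of characteristic $p>0$, let $m,n\ge 0$ be integers, let $\mathbf{s}=(s_1,\dots,s_m)$ be a sequence of non-negative integers, and let $D(\mathbf{s},n)$ be the deformed Webster algebra of type $A_1$ (defined in the context). Let $\partial_D: D(\mathbf{s},n)\to D(\mathbf{s},n)$ be the $\Bbbk$-linear derivation of degree $2$ given on generators by $\partial_D(e(\mathbf{i}))=0$, $$\partial_D(x_j)=x_j^2,$$ $$\partial_D(E(d)_j e(\mathbf{i}))=\begin{cases}(E(d)_jE(1)_j-(d+1)E(d+1)_j)e(\mathbf{i}) & \text{if } \mathbf{i}_j\in I_{\mathbf{s}},\ d<\mathbf{i}_j,\\ E(d)_jE(1)_j e(\mathbf{i}) & \text{if } \mathbf{i}_j\in I_{\mathbf{s}},\ d=\mathbf{i}_j,\end{cases}\qquad (d\ge 1)$$ $$\partial_D(\psi_j e(\mathbf{i}))=\begin{cases}-x_j\psi_j e(\mathbf{i})-\psi_j x_{j+1}e(\mathbf{i}) & \text{if } \mathbf{i}_j=\mathbf{i}_{j+1}=\mathfrak{b},\\ s\,\psi_j x_{j+1}e(\mathbf{i}) & \text{if } \mathbf{i}_j=s\in I_{\mathbf{s}},\ \mathbf{i}_{j+1}=\mathfrak{b},\\ \psi_j E(1)_{j+1}e(\mathbf{i}) & \text{if } \mathbf{i}_j=\mathfrak{b},\ \mathbf{i}_{j+1}=s\in I_{\mathbf{s}},\end{cases}$$ and extended to all of $D(\mathbf{s},n)$ by the Leibniz rule. Then $\partial_D$ is well defined (compatible with the defining relations) and $(D(\mathbf{s},n),\partial_D)$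 is a $p$-DG algebra.
   Context: **$p$-DG algebra.** A $\mathbb{Z}$-graded $\Bbbk$-algebra $A$ with a $\Bbbk$-linear map $\partial_A:A\to A$ of degree $2$ such that $\partial_A^p=0$ and $\partial_A(ab)=\partial_A(a)b+a\partial_A(b)$ for all $a,b\in A$. **Sequences.** For $\mathbf{s}=(s_1,\dots,s_m)$, $\mathrm{Seq}(\mathbf{s},n)$ is the set of sequences $\mathbf{i}=(\mathbf{i}_1,\dots,\mathbf{i}_{m+n})$ in which $n$ of the entries equal the symbol $\mathfrak{b}$ and the remaining $m$ entries are $s_1,\dots,s_m$, each appearing exactly once, in this order. $I_{\mathbf{s}}=\{s_i\mid 1\le i\le m\}$, so "$\mathbf{i}_j\in I_{\mathbf{s}}$" means $\mathbf{i}_j\neq\mathfrak{b}$. The simple transposition $\sigma_j$ swaps the $j$-th and $(j+1)$-st entries of a sequence (the result need not lie in $\mathrm{Seq}(\mathbf{s},n)$; then $e(\sigma_j(\mathbf{i}))$ is read as $0$). **Deformed Webster algebra.** $D(\mathbf{s},n)$ is the $\mathbb{Z}$-graded unital $\Bbbk$-algebra generated by $e(\mathbf{i})$ ($\mathbf{i}\in\mathrm{Seq}(\mathbf{s},n)$), $x_j$ and $E(d)_j$ ($1\le j\le m+n$, $d\ge 1$), and $\psi_\ell$ ($1\le \ell\le m+n-1$), with $1=\sum_{\mathbf{i}}e(\mathbf{i})$ and the convention $E(0)_j=1$, subject to the relations (for all admissible indices, with $d,d'\ge1$ in the relations of the first list): - $e(\mathbf{i})e(\mathbf{j})=\delta_{\mathbf{i},\mathbf{j}}e(\mathbf{i})$;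 $E(d)_je(\mathbf{i})=e(\mathbf{i})E(d)_j$; $x_je(\mathbf{i})=e(\mathbf{i})x_j$; $\psi_je(\mathbf{i})=e(\sigma_j(\mathbf{i}))\psi_j$; - $E(d)_je(\mathbf{i})=0$ if $\mathbf{i}_j=\mathfrak{b}$; $E(d)_je(\mathbf{i})=0$ if $\mathbf{i}_j\in I_{\mathbf{s}}$ and $d>\mathbf{i}_j$; $x_je(\mathbf{i})=0$ if $\mathbf{i}_j\in I_{\mathbf{s}}$; $\psi_je(\mathbf{i})=0$ if $\mathbf{i}_j,\mathbf{i}_{j+1}\in I_{\mathbf{s}}$; - $x_jx_\ell=x_\ell x_j$; $E(d)_jx_\ell=x_\ell E(d)_j$; $E(d)_jE(d')_\ell=E(d')_\ell E(d)_j$; - $\psi_jx_\ell=x_\ell\psi_j$ and $\psi_jE(d)_\ell=E(d)_\ell\psi_j$ if $\ell\ne j,j+1$; $\psi_jE(d)_j=E(d)_{j+1}\psi_j$; $E(d)_j\psi_j=\psi_jE(d)_{j+1}$; $\psi_j\psi_\ell=\psi_\ell\psi_j$ if $|j-\ell|>1$; and - $x_j\psi_je(\mathbf{i})-\psi_jx_{j+1}e(\mathbf{i})=e(\mathbf{i})$ if $\mathbf{i}_j=\mathbf{i}_{j+1}=\mathfrak{b}$, and $=0$ if $\mathbf{i}_j\in I_{\mathbf{s}},\mathbf{i}_{j+1}=\mathfrak{b}$; - $\psi_jx_je(\mathbf{i})-x_{j+1}\psi_je(\mathbf{i})=e(\mathbf{i})$ if $\mathbf{i}_j=\mathbf{i}_{j+1}=\mathfrak{b}$,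 and $=0$ if $\mathbf{i}_j=\mathfrak{b},\mathbf{i}_{j+1}\in I_{\mathbf{s}}$; - $\psi_j^2e(\mathbf{i})=0$ if $\mathbf{i}_j=\mathbf{i}_{j+1}=\mathfrak{b}$; $\psi_j^2e(\mathbf{i})=\sum_{d=0}^{\mathbf{i}_j}(-1)^dE(d)_jx_{j+1}^{\mathbf{i}_j-d}e(\mathbf{i})$ if $\mathbf{i}_j\in I_{\mathbf{s}},\mathbf{i}_{j+1}=\mathfrak{b}$; $\psi_j^2e(\mathbf{i})=\sum_{d=0}^{\mathbf{i}_{j+1}}(-1)^dx_j^{\mathbf{i}_{j+1}-d}E(d)_{j+1}e(\mathbf{i})$ if $\mathbf{i}_j=\mathfrak{b},\mathbf{i}_{j+1}\in I_{\mathbf{s}}$; - $(\psi_j\psi_{j+1}\psi_j-\psi_{j+1}\psi_j\psi_{j+1})e(\mathbf{i})=\sum_{d_1+d_2+d_3=\mathbf{i}_{j+1}-1}(-1)^{d_3}x_j^{d_1}E(d_3)_{j+1}x_{j+2}^{d_2}e(\mathbf{i})$ (sum over non-negative integers) if $\mathbf{i}_{j+1}\in I_{\mathbf{s}}$ and $\mathbf{i}_j=\mathbf{i}_{j+2}=\mathfrak{b}$, and $=0$ otherwise. **Grading.** $\deg e(\mathbf{i})=0$, $\deg x_j=2$, $\deg E(d)_j=2d$, $\deg\psi_je(\mathbf{i})=-2$ if $\mathbf{i}_j=\mathbf{i}_{j+1}=\mathfrak{b}$, and $\deg\psi_je(\mathbf{i})=s$ if one of $\mathbf{i}_j,\mathbf{i}_{j+1}$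 is $\mathfrak{b}$ and the other is $s\in I_{\mathbf{s}}$. *)

theory Defs
  imports
    "HOL-Algebra.Algebraic_Closure_Type"
    "HOL-Algebra.QuotRing"
    "HOL-Algebra.Module"
    "HOL-Library.Poly_Mapping"
    "HOL-Library.FuncSet"
begin

section \<open>Algebras over a field, gradings and p-DG algebras\<close>

text \<open>The locale \<open>algebra\<close> of HOL-Algebra only covers commutative algebras.
  Here \<open>A\<close> is an associative unital, not necessarily commutative, algebra over \<open>K\<close>.\<close>

definition assoc_algebra :: "('k, 'x) ring_scheme \<Rightarrow> ('k, 'a, 'y) module_scheme \<Rightarrow> bool" where
  "assoc_algebra K A \<longleftrightarrow> module K A \<and> ring A \<and>
    (\<forall>c\<in>carrier K. \<forall>a\<in>carrier A. \<forall>b\<in>carrier A.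
       (c \<odot>\<^bsub>A\<^esub> a) \<otimes>\<^bsub>A\<^esub> b = c \<odot>\<^bsub>A\<^esub> (a \<otimes>\<^bsub>A\<^esub> b) \<and>
       a \<otimes>\<^bsub>A\<^esub> (c \<odot>\<^bsub>A\<^esub> b) = c \<odot>\<^bsub>A\<^esub> (a \<otimes>\<^bsub>A\<^esub> b))"

text \<open>\<open>G k\<close> is the homogeneous component of degree \<open>k\<close>; the last conjunct says that
  \<open>A\<close> is the internal direct sum of the components.\<close>

definition graded_algebra ::
  "('k, 'x) ring_scheme \<Rightarrow> ('k, 'a, 'y) module_scheme \<Rightarrow> (int \<Rightarrow> 'a set) \<Rightarrow> bool" where
  "graded_algebra K A G \<longleftrightarrow> assoc_algebra K A \<and>
    (\<forall>k. submodule (G k) K A) \<and>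
    \<one>\<^bsub>A\<^esub> \<in> G 0 \<and>
    (\<forall>k l. \<forall>a\<in>G k. \<forall>b\<in>G l. a \<otimes>\<^bsub>A\<^esub> b \<in> G (k + l)) \<and>
    (\<forall>a\<in>carrier A. \<exists>!c. (\<forall>k. c k \<in> G k) \<and> finite {k. c k \<noteq> \<zero>\<^bsub>A\<^esub>} \<and>
       a = finsum A c {k. c k \<noteq> \<zero>\<^bsub>A\<^esub>})"

definition derivation ::
  "('k, 'x) ring_scheme \<Rightarrow> ('k, 'a, 'y) module_scheme \<Rightarrow> ('a \<Rightarrow> 'a) \<Rightarrow> bool" where
  "derivation K A \<delta> \<longleftrightarrow> \<delta> \<in> carrier A \<rightarrow> carrier A \<and>
    (\<forall>a\<in>carrier A. \<forall>b\<in>carrier A. \<delta> (a \<oplus>\<^bsub>A\<^esub> b) = \<delta> a \<oplus>\<^bsub>A\<^esub> \<delta> b) \<and>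
    (\<forall>c\<in>carrier K. \<forall>a\<in>carrier A. \<delta> (c \<odot>\<^bsub>A\<^esub> a) = c \<odot>\<^bsub>A\<^esub> \<delta> a) \<and>
    (\<forall>a\<in>carrier A. \<forall>b\<in>carrier A.
       \<delta> (a \<otimes>\<^bsub>A\<^esub> b) = \<delta> a \<otimes>\<^bsub>A\<^esub> b \<oplus>\<^bsub>A\<^esub> a \<otimes>\<^bsub>A\<^esub> \<delta> b)"

definition p_dg_algebra ::
  "nat \<Rightarrow> ('k, 'x) ring_scheme \<Rightarrow> ('k, 'a, 'y) module_scheme \<Rightarrow> (int \<Rightarrow> 'a set) \<Rightarrow> ('a \<Rightarrow> 'a) \<Rightarrow> bool"
  where
  "p_dg_algebra p K A G \<delta> \<longleftrightarrow> graded_algebra K A G \<and> derivation K A \<delta> \<and>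
    (\<forall>k. \<forall>a\<in>G k. \<delta> a \<in> G (k + 2)) \<and>
    (\<forall>a\<in>carrier A. (\<delta> ^^ p) a = \<zero>\<^bsub>A\<^esub>)"

section \<open>Algebras presented by generators and relations\<close>

text \<open>Words form the free monoid, written additively so that the finitely supported
  functions \<open>'g word \<Rightarrow>\<^sub>0 'k\<close>, with the convolution product of \<open>Poly_Mapping\<close>,
  are the free associative \<open>'k\<close>-algebra on \<open>'g\<close>.\<close>

datatype 'g word = Word (letters: "'g list")

instantiation word :: (type) monoid_add
begin

definition zero_word :: "'a word" where "zero_word = Word []"

definition plus_word :: "'a word \<Rightarrow> 'a word \<Rightarrow> 'a word" where
  "plus_word u v = Word (letters u @ letters v)"

instance
  by standard (simp_all add: zero_word_def plus_word_def)

end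

definition gen :: "'g \<Rightarrow> ('g word \<Rightarrow>\<^sub>0 'k::field)" where
  "gen g = Poly_Mapping.single (Word [g]) 1"

definition scalar :: "'k \<Rightarrow> ('g word \<Rightarrow>\<^sub>0 'k::field)" where
  "scalar c = Poly_Mapping.single 0 c"

definition free_algebra :: "'g set \<Rightarrow> ('g word \<Rightarrow>\<^sub>0 'k::field) ring" where
  "free_algebra Z =
    ring_of_type_algebra \<lparr>carrier := {f. \<forall>w\<in>Poly_Mapping.keys f. set (letters w) \<subseteq> Z}\<rparr>"

lemma free_algebra_simps:
  "carrier (free_algebra Z) = {f. \<forall>w\<in>Poly_Mapping.keys f. set (letters w) \<subseteq> Z}"
  "f \<otimes>\<^bsub>free_algebra Z\<^esub> g = f * g" "\<one>\<^bsub>free_algebra Z\<^esub> = 1"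
  "\<zero>\<^bsub>free_algebra Z\<^esub> = 0" "f \<oplus>\<^bsub>free_algebra Z\<^esub> g = f + g"
  by (simp_all add: free_algebra_def ring_of_type_algebra_def)

lemma free_carrier_closed:
  "0 \<in> carrier (free_algebra Z)" "1 \<in> carrier (free_algebra Z)"
  "g \<in> Z \<Longrightarrow> gen g \<in> carrier (free_algebra Z)"
  "f \<in> carrier (free_algebra Z) \<Longrightarrow> - f \<in> carrier (free_algebra Z)"
  "\<lbrakk>f \<in> carrier (free_algebra Z); h \<in> carrier (free_algebra Z)\<rbrakk> \<Longrightarrow> f + h \<in> carrier (free_algebra Z)"
  "\<lbrakk>f \<in> carrier (free_algebra Z); h \<in> carrier (free_algebra Z)\<rbrakk> \<Longrightarrow> f * h \<in> carrier (free_algebra Z)"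
proof -
  show "f + h \<in> carrier (free_algebra Z)"
    if "f \<in> carrier (free_algebra Z)" "h \<in> carrier (free_algebra Z)"
    using that Poly_Mapping.keys_add[of f h] by (fastforce simp: free_algebra_simps)
  show "f * h \<in> carrier (free_algebra Z)"
    if "f \<in> carrier (free_algebra Z)" "h \<in> carrier (free_algebra Z)"
    using that keys_mult[of f h] by (fastforce simp: plus_word_def free_algebra_simps)
qed (auto simp: gen_def zero_word_def free_algebra_simps)

lemma free_carrier_closed':
  "\<lbrakk>f \<in> carrier (free_algebra Z); h \<in> carrier (free_algebra Z)\<rbrakk> \<Longrightarrow> f - h \<in> carrier (free_algebra Z)"
  "f \<in> carrier (free_algebra Z) \<Longrightarrow> f ^ k \<in> carrier (free_algebra Z)"
  "(\<And>a. a \<in> A \<Longrightarrow> F a \<in> carrier (free_algebra Z)) \<Longrightarrow> sum F A \<in> carrier (free_algebra Z)"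
proof -
  show "f - h \<in> carrier (free_algebra Z)"
    if "f \<in> carrier (free_algebra Z)" "h \<in> carrier (free_algebra Z)"
    using free_carrier_closed(5)[OF that(1) free_carrier_closed(4)[OF that(2)]] by simp
  show "f ^ k \<in> carrier (free_algebra Z)" if "f \<in> carrier (free_algebra Z)"
    using that
    by (induction k)
      (simp_all only: power_0 power_Suc free_carrier_closed(2) free_carrier_closed(6))
  show "sum F A \<in> carrier (free_algebra Z)" if "\<And>a. a \<in> A \<Longrightarrow> F a \<in> carrier (free_algebra Z)"
    using that
  proof (induction A rule: infinite_finite_induct)
    case (insert a A)
    then show ?case
      by (simp add: free_carrier_closed(5))
  qed (simp_all add: free_carrier_closed(1))
qed

lemma ring_free_algebra: "ring (free_algebra Z)"
proof (rule ringI)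
  show "abelian_group (free_algebra Z)"
  proof (rule abelian_groupI)
    fix f assume f: "f \<in> carrier (free_algebra Z)"
    show "\<exists>h\<in>carrier (free_algebra Z). h \<oplus>\<^bsub>free_algebra Z\<^esub> f = \<zero>\<^bsub>free_algebra Z\<^esub>"
      by (rule bexI[OF _ free_carrier_closed(4)[OF f]]) (simp add: free_algebra_simps(2-))
  qed (simp_all only: free_algebra_simps(2-) free_carrier_closed add.assoc add.commute
        add.left_commute add_0_left add_0_right)
  show "monoid (free_algebra Z)"
    by (rule monoidI)
      (simp_all only: free_algebra_simps(2-) free_carrier_closed mult.assoc mult_1_left mult_1_right)
qed (simp_all only: free_algebra_simps(2-) distrib_left distrib_right)

text \<open>The class of \<open>f\<close> in the quotient of the free algebra on \<open>Z\<close> by the two-sided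
  ideal generated by \<open>R\<close>.\<close>

definition cls ::
  "'g set \<Rightarrow> ('g word \<Rightarrow>\<^sub>0 'k) set \<Rightarrow> ('g word \<Rightarrow>\<^sub>0 'k::field) \<Rightarrow> ('g word \<Rightarrow>\<^sub>0 'k) set" where
  "cls Z R f = Idl\<^bsub>free_algebra Z\<^esub> R +>\<^bsub>free_algebra Z\<^esub> f"

text \<open>A scalar acts on the quotient as multiplication by the class of the corresponding constant.\<close>

definition presented_algebra ::
  "'g set \<Rightarrow> ('g word \<Rightarrow>\<^sub>0 'k) set \<Rightarrow> ('k::field, ('g word \<Rightarrow>\<^sub>0 'k) set) module" where
  "presented_algebra Z R =
    (let Q = free_algebra Z Quot (Idl\<^bsub>free_algebra Z\<^esub> R) in
     \<lparr>carrier = carrier Q, monoid.mult = monoid.mult Q, one = monoid.one Q, ring.zero = ring.zero Q, add = add Q,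
      module.smult = (\<lambda>c a. cls Z R (scalar c) \<otimes>\<^bsub>Q\<^esub> a)\<rparr>)"

section \<open>The deformed Webster algebra of type A1\<close>

datatype letter = Black | Red nat

definition Seq :: "nat list \<Rightarrow> nat \<Rightarrow> letter list set" where
  "Seq s n = {i. count_list i Black = n \<and> filter (\<lambda>c. c \<noteq> Black) i = map Red s}"

lemma finite_Seq: "finite (Seq s n)"
proof (rule finite_subset)
  show "Seq s n \<subseteq> {i. set i \<subseteq> insert Black (Red ` set s) \<and> length i = n + length s}"
  proof
    fix i assume i: "i \<in> Seq s n"
    then have "set (filter (\<lambda>c. c \<noteq> Black) i) = Red ` set s"
      by (simp only: Seq_def mem_Collect_eq set_map)
    then have "set i \<subseteq> insert Black (Red ` set s)"
      unfolding set_filter by blast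
    moreover have "count_list i Black = length (filter (\<lambda>c. c = Black) i)"
      by (induction i) auto
    then have "length i = n + length s"
      using i sum_length_filter_compl[of "\<lambda>c. c = Black" i] by (simp add: Seq_def)
    ultimately show "i \<in> {i. set i \<subseteq> insert Black (Red ` set s) \<and> length i = n + length s}"
      by blast
  qed
  show "finite {i. set i \<subseteq> insert Black (Red ` set s) \<and> length i = n + length s}"
    by (rule finite_lists_length_eq) simp
qed

text \<open>Positions are numbered from 1.\<close>

definition entry :: "letter list \<Rightarrow> nat \<Rightarrow> letter" where
  "entry i j = i ! (j - 1)"

definition swap :: "nat \<Rightarrow> letter list \<Rightarrow> letter list" where
  "swap j i = i[j - 1 := entry i (j + 1), j := entry i j]"

datatype webster_gen =
  Idempotent "letter list"
| Dot nat
| Elem nat nat  \<comment> \<open>\<open>Elem d j\<close> is the generator E(d) at position j\<close>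
| Cross nat

type_synonym 'k free = "webster_gen word \<Rightarrow>\<^sub>0 'k"

definition webster_gens :: "nat list \<Rightarrow> nat \<Rightarrow> webster_gen set" where
  "webster_gens s n =
     Idempotent ` Seq s n \<union>
     Dot ` {1..length s + n} \<union>
     {Elem d j | d j. 1 \<le> d \<and> j \<in> {1..length s + n}} \<union>
     Cross ` {1..<length s + n}"

abbreviation ee :: "letter list \<Rightarrow> 'k::field free" where "ee i \<equiv> gen (Idempotent i)"
abbreviation xx :: "nat \<Rightarrow> 'k::field free" where "xx j \<equiv> gen (Dot j)"
abbreviation psi :: "nat \<Rightarrow> 'k::field free" where "psi j \<equiv> gen (Cross j)"

definition EE :: "nat \<Rightarrow> nat \<Rightarrow> 'k::field free" where
  "EE d j = (if d = 0 then 1 else gen (Elem d j))"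

text \<open>The idempotent of a sequence, read as zero outside \<open>Seq s n\<close>.\<close>

definition ee0 :: "nat list \<Rightarrow> nat \<Rightarrow> letter list \<Rightarrow> 'k::field free" where
  "ee0 s n i = (if i \<in> Seq s n then ee i else 0)"

text \<open>A relation \<open>a = b\<close> is represented by the element \<open>a - b\<close>. In the braid relation, the sum
  over \<open>d1 + d2 + d3 = r - 1\<close> is written with \<open>d1 + d2 + d3 + 1 = r\<close>, so that it is empty
  for \<open>r = 0\<close>.\<close>

inductive_set webster_rels :: "nat list \<Rightarrow> nat \<Rightarrow> 'k::field free set"
  for s :: "nat list" and n :: nat where
  unit: "1 - (\<Sum>i\<in>Seq s n. ee i) \<in> webster_rels s n"
| e_e: "\<lbrakk>i \<in> Seq s n; i' \<in> Seq s n\<rbrakk> \<Longrightarrow>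
    ee i * ee i' - (if i = i' then ee i else 0) \<in> webster_rels s n"
| E_e: "\<lbrakk>i \<in> Seq s n; j \<in> {1..length s + n}; d \<ge> 1\<rbrakk> \<Longrightarrow>
    EE d j * ee i - ee i * EE d j \<in> webster_rels s n"
| x_e: "\<lbrakk>i \<in> Seq s n; j \<in> {1..length s + n}\<rbrakk> \<Longrightarrow>
    xx j * ee i - ee i * xx j \<in> webster_rels s n"
| psi_e: "\<lbrakk>i \<in> Seq s n; j \<in> {1..<length s + n}\<rbrakk> \<Longrightarrow>
    psi j * ee i - ee0 s n (swap j i) * psi j \<in> webster_rels s n"
| E_black: "\<lbrakk>i \<in> Seq s n; j \<in> {1..length s + n}; d \<ge> 1; entry i j = Black\<rbrakk> \<Longrightarrow>
    EE d j * ee i \<in> webster_rels s n"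
| E_large: "\<lbrakk>i \<in> Seq s n; j \<in> {1..length s + n}; d \<ge> 1; entry i j = Red r; d > r\<rbrakk> \<Longrightarrow>
    EE d j * ee i \<in> webster_rels s n"
| x_red: "\<lbrakk>i \<in> Seq s n; j \<in> {1..length s + n}; entry i j = Red r\<rbrakk> \<Longrightarrow>
    xx j * ee i \<in> webster_rels s n"
| psi_red_red: "\<lbrakk>i \<in> Seq s n; j \<in> {1..<length s + n}; entry i j = Red r; entry i (j + 1) = Red r'\<rbrakk> \<Longrightarrow>
    psi j * ee i \<in> webster_rels s n"
| x_x: "\<lbrakk>j \<in> {1..length s + n}; l \<in> {1..length s + n}\<rbrakk> \<Longrightarrow>
    xx j * xx l - xx l * xx j \<in> webster_rels s n"
| E_x: "\<lbrakk>j \<in> {1..length s + n}; l \<in> {1..length s + n}; d \<ge> 1\<rbrakk> \<Longrightarrow>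
    EE d j * xx l - xx l * EE d j \<in> webster_rels s n"
| E_E: "\<lbrakk>j \<in> {1..length s + n}; l \<in> {1..length s + n}; d \<ge> 1; d' \<ge> 1\<rbrakk> \<Longrightarrow>
    EE d j * EE d' l - EE d' l * EE d j \<in> webster_rels s n"
| psi_x: "\<lbrakk>j \<in> {1..<length s + n}; l \<in> {1..length s + n}; l \<noteq> j; l \<noteq> j + 1\<rbrakk> \<Longrightarrow>
    psi j * xx l - xx l * psi j \<in> webster_rels s n"
| psi_E: "\<lbrakk>j \<in> {1..<length s + n}; l \<in> {1..length s + n}; d \<ge> 1; l \<noteq> j; l \<noteq> j + 1\<rbrakk> \<Longrightarrow>
    psi j * EE d l - EE d l * psi j \<in> webster_rels s n"
| psi_E_left: "\<lbrakk>j \<in> {1..<length s + n}; d \<ge> 1\<rbrakk> \<Longrightarrow>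
    psi j * EE d j - EE d (j + 1) * psi j \<in> webster_rels s n"
| psi_E_right: "\<lbrakk>j \<in> {1..<length s + n}; d \<ge> 1\<rbrakk> \<Longrightarrow>
    EE d j * psi j - psi j * EE d (j + 1) \<in> webster_rels s n"
| psi_psi_far: "\<lbrakk>j \<in> {1..<length s + n}; l \<in> {1..<length s + n}; \<bar>int j - int l\<bar> > 1\<rbrakk> \<Longrightarrow>
    psi j * psi l - psi l * psi j \<in> webster_rels s n"
| x_psi_bb: "\<lbrakk>i \<in> Seq s n; j \<in> {1..<length s + n}; entry i j = Black; entry i (j + 1) = Black\<rbrakk> \<Longrightarrow>
    (xx j * psi j * ee i - psi j * xx (j + 1) * ee i) - ee i \<in> webster_rels s n"
| x_psi_rb: "\<lbrakk>i \<in> Seq s n; j \<in> {1..<length s + n}; entry i j = Red r; entry i (j + 1) = Black\<rbrakk> \<Longrightarrow>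
    xx j * psi j * ee i - psi j * xx (j + 1) * ee i \<in> webster_rels s n"
| psi_x_bb: "\<lbrakk>i \<in> Seq s n; j \<in> {1..<length s + n}; entry i j = Black; entry i (j + 1) = Black\<rbrakk> \<Longrightarrow>
    (psi j * xx j * ee i - xx (j + 1) * psi j * ee i) - ee i \<in> webster_rels s n"
| psi_x_br: "\<lbrakk>i \<in> Seq s n; j \<in> {1..<length s + n}; entry i j = Black; entry i (j + 1) = Red r\<rbrakk> \<Longrightarrow>
    psi j * xx j * ee i - xx (j + 1) * psi j * ee i \<in> webster_rels s n"
| psi_sq_bb: "\<lbrakk>i \<in> Seq s n; j \<in> {1..<length s + n}; entry i j = Black; entry i (j + 1) = Black\<rbrakk> \<Longrightarrow>
    psi j ^ 2 * ee i \<in> webster_rels s n"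
| psi_sq_rb: "\<lbrakk>i \<in> Seq s n; j \<in> {1..<length s + n}; entry i j = Red r; entry i (j + 1) = Black\<rbrakk> \<Longrightarrow>
    psi j ^ 2 * ee i - (\<Sum>d=0..r. (- 1) ^ d * EE d j * xx (j + 1) ^ (r - d) * ee i) \<in> webster_rels s n"
| psi_sq_br: "\<lbrakk>i \<in> Seq s n; j \<in> {1..<length s + n}; entry i j = Black; entry i (j + 1) = Red r\<rbrakk> \<Longrightarrow>
    psi j ^ 2 * ee i - (\<Sum>d=0..r. (- 1) ^ d * xx j ^ (r - d) * EE d (j + 1) * ee i) \<in> webster_rels s n"
| braid_brb: "\<lbrakk>i \<in> Seq s n; 1 \<le> j; j + 2 \<le> length s + n;
      entry i j = Black; entry i (j + 1) = Red r; entry i (j + 2) = Black\<rbrakk> \<Longrightarrow>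
    (psi j * psi (j + 1) * psi j - psi (j + 1) * psi j * psi (j + 1)) * ee i
     - (\<Sum>(d1, d2, d3)\<in>{(d1, d2, d3). d1 + d2 + d3 + 1 = r}.
          (- 1) ^ d3 * xx j ^ d1 * EE d3 (j + 1) * xx (j + 2) ^ d2 * ee i) \<in> webster_rels s n"
| braid: "\<lbrakk>i \<in> Seq s n; 1 \<le> j; j + 2 \<le> length s + n;
      \<not> (entry i j = Black \<and> entry i (j + 1) \<noteq> Black \<and> entry i (j + 2) = Black)\<rbrakk> \<Longrightarrow>
    (psi j * psi (j + 1) * psi j - psi (j + 1) * psi j * psi (j + 1)) * ee i \<in> webster_rels s n"

lemma webster_gen_carrier:
  "i \<in> Seq s n \<Longrightarrow> ee i \<in> carrier (free_algebra (webster_gens s n))"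
  "ee0 s n i \<in> carrier (free_algebra (webster_gens s n))"
  "\<lbrakk>1 \<le> j; j \<le> length s + n\<rbrakk> \<Longrightarrow> xx j \<in> carrier (free_algebra (webster_gens s n))"
  "\<lbrakk>1 \<le> j; j \<le> length s + n\<rbrakk> \<Longrightarrow> EE d j \<in> carrier (free_algebra (webster_gens s n))"
  "\<lbrakk>1 \<le> j; j < length s + n\<rbrakk> \<Longrightarrow> psi j \<in> carrier (free_algebra (webster_gens s n))"
  unfolding EE_def ee0_def
  by (auto simp: webster_gens_def
        intro!: free_carrier_closed)

lemma webster_rels_carrier:
  "(webster_rels s n :: 'k::field free set) \<subseteq> carrier (free_algebra (webster_gens s n))"
proof
  fix f :: "'k free" assume "f \<in> webster_rels s n"
  then show "f \<in> carrier (free_algebra (webster_gens s n))"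
    by induction
      (auto
        simp: webster_gens_def EE_def ee0_def intro!: free_carrier_closed free_carrier_closed')
qed

definition webster_algebra :: "nat list \<Rightarrow> nat \<Rightarrow> ('k::field, 'k free set) module" where
  "webster_algebra s n = presented_algebra (webster_gens s n) (webster_rels s n)"

definition wcls :: "nat list \<Rightarrow> nat \<Rightarrow> 'k::field free \<Rightarrow> 'k free set" where
  "wcls s n f = cls (webster_gens s n) (webster_rels s n) f"

text \<open>Homogeneous generators together with their degrees. A crossing is only homogeneous after
  multiplication by an idempotent; between two red strands this product vanishes and carries no
  degree.\<close>

inductive_set webster_hom_gens :: "nat list \<Rightarrow> nat \<Rightarrow> (int \<times> 'k::field free) set"
  for s :: "nat list" and n :: nat where
  "i \<in> Seq s n \<Longrightarrow> (0, ee i) \<in> webster_hom_gens s n"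
| "j \<in> {1..length s + n} \<Longrightarrow> (2, xx j) \<in> webster_hom_gens s n"
| "\<lbrakk>j \<in> {1..length s + n}; d \<ge> 1\<rbrakk> \<Longrightarrow> (2 * int d, EE d j) \<in> webster_hom_gens s n"
| "\<lbrakk>i \<in> Seq s n; j \<in> {1..<length s + n}; entry i j = Black; entry i (j + 1) = Black\<rbrakk> \<Longrightarrow>
    (- 2, psi j * ee i) \<in> webster_hom_gens s n"
| "\<lbrakk>i \<in> Seq s n; j \<in> {1..<length s + n}; entry i j = Red r; entry i (j + 1) = Black\<rbrakk> \<Longrightarrow>
    (int r, psi j * ee i) \<in> webster_hom_gens s n"
| "\<lbrakk>i \<in> Seq s n; j \<in> {1..<length s + n}; entry i j = Black; entry i (j + 1) = Red r\<rbrakk> \<Longrightarrow>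
    (int r, psi j * ee i) \<in> webster_hom_gens s n"

text \<open>The component of degree \<open>k\<close> is the linear span of the classes of all products of
  homogeneous generators of total degree \<open>k\<close>.\<close>

definition webster_grading :: "nat list \<Rightarrow> nat \<Rightarrow> int \<Rightarrow> 'k::field free set set" where
  "webster_grading s n k =
    (\<lambda>H. submodule H ring_of_type_algebra (webster_algebra s n)) hull
      {wcls s n (prod_list (map snd hs)) | hs.
         set hs \<subseteq> webster_hom_gens s n \<and> sum_list (map fst hs) = k}"

text \<open>A linear derivation of the deformed Webster algebra with the prescribed values on generators.
  No value is prescribed where \<open>EE d j * ee i\<close> or \<open>psi j * ee i\<close> is zero by a defining relation.\<close>

definition webster_differential ::
  "nat list \<Rightarrow> nat \<Rightarrow> ('k::field free set \<Rightarrow> 'k free set) \<Rightarrow> bool" where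
  "webster_differential s n \<delta> \<longleftrightarrow>
    derivation ring_of_type_algebra (webster_algebra s n :: ('k, 'k free set) module) \<delta> \<and>
    (\<forall>i\<in>Seq s n. \<delta> (wcls s n (ee i)) = wcls s n 0) \<and>
    (\<forall>j\<in>{1..length s + n}. \<delta> (wcls s n (xx j)) = wcls s n (xx j ^ 2)) \<and>
    (\<forall>i\<in>Seq s n. \<forall>j\<in>{1..length s + n}. \<forall>d\<ge>1. \<forall>r. entry i j = Red r \<longrightarrow>
       (d < r \<longrightarrow> \<delta> (wcls s n (EE d j * ee i)) =
          wcls s n ((EE d j * EE 1 j - of_nat (d + 1) * EE (d + 1) j) * ee i)) \<and>
       (d = r \<longrightarrow> \<delta> (wcls s n (EE d j * ee i)) = wcls s n (EE d j * EE 1 j * ee i))) \<and>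
    (\<forall>i\<in>Seq s n. \<forall>j\<in>{1..<length s + n}.
       (entry i j = Black \<and> entry i (j + 1) = Black \<longrightarrow>
          \<delta> (wcls s n (psi j * ee i)) =
            wcls s n (- (xx j * psi j * ee i) - psi j * xx (j + 1) * ee i)) \<and>
       (\<forall>r. entry i j = Red r \<and> entry i (j + 1) = Black \<longrightarrow>
          \<delta> (wcls s n (psi j * ee i)) = wcls s n (of_nat r * psi j * xx (j + 1) * ee i)) \<and>
       (\<forall>r. entry i j = Black \<and> entry i (j + 1) = Red r \<longrightarrow>
          \<delta> (wcls s n (psi j * ee i)) = wcls s n (psi j * EE 1 (j + 1) * ee i)))"

end

theory Submission
  imports Defs
begin

text \<open>The prescribed values define a derivation \<open>d\<close> of the free algebra; it descends to the deformed
  Webster algebra because it maps every defining relation into the ideal of relations. After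
  multiplication by idempotents this is a finite list of local computations, the only substantial
  ones being the squares of red-black crossings and the braid relation for a red strand between
  two black ones. There the polynomials in the relations are \<open>R(x) = \<Sum> (-1)\<^sup>m E(m) x\<^bsup>r-m\<^esup>\<close>
  with \<open>d R(x) = (E(1) + r x) R(x)\<close>, and the divided difference of \<open>R\<close>.

  The relations are also homogeneous, so that \<open>f \<mapsto> f t\<^sup>k\<close> for \<open>f\<close> of degree \<open>k\<close> is a well-defined
  homomorphism to Laurent polynomials over the algebra; its coefficients recover the homogeneous
  components, whence these form a direct sum.

  In characteristic \<open>p\<close> the power \<open>d\<^sup>p\<close> is again a derivation, and it vanishes on the generators:
  \<open>d\<^sup>k x = k! x\<^bsup>k+1\<^esup>\<close>; the third power of \<open>d\<close> kills black-black crossings, and so does the second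
  one if \<open>p = 2\<close>; on a crossing of a red strand on the left, \<open>d\<^sup>k\<close> is multiplication by \<open>x\<^sup>k\<close> and a
  rising factorial, which \<open>p\<close> divides for \<open>k = p\<close>; on one of a red strand on the right, and for
  \<open>k = p\<close> also on \<open>E(m)\<close>, it is multiplication by \<open>(d + E(1))\<^sup>k 1\<close>. Since \<open>d 1 = 0\<close>, the case
  \<open>m = 0\<close> shows that this factor is zero for \<open>k = p\<close>.\<close>

section \<open>All quotients of a ring inside one ring\<close>

text \<open>The values on E(m) are those of the elementary symmetric polynomials in r variables y
  with d y = y^2. In this model R(x) is the product of the factors x - y, and d (x - y) = (x + y) (x
  - y) explains the factor E(1) + r x. The flow of d sends y to y / (1 - t y), hence the product of
  all y to itself times the generating series of the complete symmetric polynomials h_k; so (d +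
  E(1))^k 1 is k! h_k, which is zero for k = p. The algebra contains no such variables. The formulas
  are therefore proved for abstract sequences \<open>E\<close>, and the truncation E(r + 1) = 0
  enters only after multiplication by an idempotent. Two features of the presentation shape the
  rest. Most relations hold for elements starting at a given sequence, whereas a derivation or a
  coaction of the free algebra needs values on the bare crossings: these values are sums over all
  sequences. And the quotient sits in a ring with a larger unit, so the image of 1 has to be treated
  as an idempotent.\<close>

definition two_sided :: "'a::ring_1 set \<Rightarrow> bool" where
  "two_sided J \<longleftrightarrow> 0 \<in> J \<and> (\<forall>a\<in>J. \<forall>b\<in>J. a - b \<in> J) \<and> (\<forall>a\<in>J. \<forall>r. r * a \<in> J \<and> a * r \<in> J)"

lemma two_sided_closed:
  assumes "two_sided J"
  shows "0 \<in> J" "a \<in> J \<Longrightarrow> b \<in> J \<Longrightarrow> a - b \<in> J" "a \<in> J \<Longrightarrow> r * a \<in> J" "a \<in> J \<Longrightarrow> a * r \<in> J"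
    "a \<in> J \<Longrightarrow> - a \<in> J" "a \<in> J \<Longrightarrow> b \<in> J \<Longrightarrow> a + b \<in> J"
proof -
  show *: "0 \<in> J" "a \<in> J \<Longrightarrow> b \<in> J \<Longrightarrow> a - b \<in> J" "a \<in> J \<Longrightarrow> r * a \<in> J" "a \<in> J \<Longrightarrow> a * r \<in> J" for a b r
    using assms by (auto simp: two_sided_def)
  show **: "- a \<in> J" if "a \<in> J" for a
    using *(2)[OF *(1) that] by simp
  show "a \<in> J \<Longrightarrow> b \<in> J \<Longrightarrow> a + b \<in> J"
    using *(2)[of a "- b"] ** by simp
qed

text \<open>The ideal of a presentation depends on parameters, so its quotient is not a type.
  The product of the quotients by all two-sided ideals is one, and it contains every
  single quotient as a corner; calculations modulo an ideal become calculations in a type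
  of class \<open>ring_1\<close>.\<close>

quotient_type (overloaded) 'a quots = "'a::ring_1 set \<Rightarrow> 'a" /
  "\<lambda>f g. \<forall>J. two_sided J \<longrightarrow> f J - g J \<in> J"
proof (rule equivpI)
  show "reflp (\<lambda>f g :: 'a set \<Rightarrow> 'a. \<forall>J. two_sided J \<longrightarrow> f J - g J \<in> J)"
    by (auto simp: reflp_def two_sided_closed)
  show "symp (\<lambda>f g :: 'a set \<Rightarrow> 'a. \<forall>J. two_sided J \<longrightarrow> f J - g J \<in> J)"
    by (auto simp: symp_def dest: two_sided_closed(5)) (metis minus_diff_eq two_sided_closed(5))
  show "transp (\<lambda>f g :: 'a set \<Rightarrow> 'a. \<forall>J. two_sided J \<longrightarrow> f J - g J \<in> J)"
    unfolding transp_def by (metis diff_add_cancel add_diff_eq two_sided_closed(6))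
qed

lemma two_sided_diff_diff:
  assumes "two_sided J" "a - a' \<in> J" "b - b' \<in> J"
  shows "(a - b) - (a' - b') \<in> J"
proof -
  have "(a - b) - (a' - b') = (a - a') - (b - b')"
    by (simp add: algebra_simps)
  then show ?thesis
    using assms by (simp only: two_sided_closed(2))
qed

lemma two_sided_mult_diff:
  assumes "two_sided J" "a - a' \<in> J" "b - b' \<in> J"
  shows "a * b - a' * b' \<in> J"
proof -
  have "a * b - a' * b' = (a - a') * b + a' * (b - b')"
    by (simp add: algebra_simps)
  then show ?thesis
    using assms by (simp add: two_sided_closed)
qed

instantiation quots :: (ring_1) ring_1
begin

lift_definition zero_quots :: "'a quots" is "\<lambda>J. 0" .
lift_definition one_quots :: "'a quots" is "\<lambda>J. 1" .
lift_definition plus_quots :: "'a quots \<Rightarrow> 'a quots \<Rightarrow> 'a quots" is "\<lambda>f g J. f J + g J"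
  by (metis add_diff_add two_sided_closed(6))
lift_definition uminus_quots :: "'a quots \<Rightarrow> 'a quots" is "\<lambda>f J. - f J"
  by (metis minus_diff_minus two_sided_closed(5))
lift_definition minus_quots :: "'a quots \<Rightarrow> 'a quots \<Rightarrow> 'a quots" is "\<lambda>f g J. f J - g J"
  by (metis two_sided_diff_diff)
lift_definition times_quots :: "'a quots \<Rightarrow> 'a quots \<Rightarrow> 'a quots" is "\<lambda>f g J. f J * g J"
  by (blast intro: two_sided_mult_diff)

instance
proof
  show "(0::'a quots) \<noteq> 1"
  proof
    assume "(0::'a quots) = 1"
    then have "\<forall>J::'a set. two_sided J \<longrightarrow> 0 - 1 \<in> J"
      by transfer
    \<comment> \<open>The whole ring is one of the ideals and contributes a zero component; the
      component at the zero ideal keeps the product nontrivial.\<close>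
    moreover have "two_sided {0::'a}"
      by (simp add: two_sided_def)
    ultimately show False
      by force
  qed
qed (transfer, simp add: algebra_simps two_sided_closed(1))+

end

text \<open>Supported in the single component \<open>J\<close>, so that for a two-sided
  \<open>J\<close> the kernel is exactly \<open>J\<close>. The price is that 1 goes to the unit of
  that component only.\<close>

lift_definition quot :: "'a::ring_1 set \<Rightarrow> 'a \<Rightarrow> 'a quots" is "\<lambda>J a K. if K = J then a else 0" .

lemma quot_hom:
  "quot J (a + b) = quot J a + quot J b"
  "quot J (a - b) = quot J a - quot J b"
  "quot J (- a) = - quot J a"
  "quot J (a * b) = quot J a * quot J b"
  "quot J 0 = 0"
  by (transfer, simp add: two_sided_closed(1))+

lemma quot_eq_0_iff: "two_sided J \<Longrightarrow> quot J a = 0 \<longleftrightarrow> a \<in> J"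
  by transfer (auto simp: two_sided_closed(1))

lemma quot_sum: "quot J (sum f A) = (\<Sum>a\<in>A. quot J (f a))"
  by (induction A rule: infinite_finite_induct) (simp_all add: quot_hom)

section \<open>Linear extension from words\<close>

lemma of_nat_left_commute: "a * (of_nat m * b) = of_nat m * (a * (b :: 'a::semiring_1))"
  by (metis mult.assoc mult_of_nat_commute)

lemma poly_mapping_induct_add [case_names zero single add]:
  assumes "P 0" "\<And>w c. P (Poly_Mapping.single w c)" "\<And>f g. P f \<Longrightarrow> P g \<Longrightarrow> P (f + g)"
  shows "P (f :: 'w \<Rightarrow>\<^sub>0 'k::comm_monoid_add)"
proof (induction f rule: Poly_Mapping.update_induct)
  case (update f a b)
  have "Poly_Mapping.update a b f = f + Poly_Mapping.single a b"
    using update(1)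
    by (intro poly_mapping_eqI)
      (auto simp: lookup_update lookup_add lookup_single when_def in_keys_iff)
  then show ?case
    using update assms by simp
qed (rule assms)

text \<open>The map \<open>\<kappa>\<close> embeds the coefficients: it is \<open>scalar\<close> for
  \<open>deriv\<close> and \<open>retr\<close>, and a constant Laurent polynomial for
  \<open>graded\<close>. The values \<open>v\<close> on words are arbitrary, so that derivations
  arise as well as homomorphisms.\<close>

definition lin :: "('k::zero \<Rightarrow> 'r) \<Rightarrow> ('w \<Rightarrow> 'r) \<Rightarrow> ('w \<Rightarrow>\<^sub>0 'k) \<Rightarrow> 'r::ring" where
  "lin \<kappa> v f = (\<Sum>w\<in>Poly_Mapping.keys f. \<kappa> (Poly_Mapping.lookup f w) * v w)"

lemma lin_superset:
  assumes "\<kappa> 0 = 0" "finite A" "Poly_Mapping.keys f \<subseteq> A"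
  shows "lin \<kappa> v f = (\<Sum>w\<in>A. \<kappa> (Poly_Mapping.lookup f w) * v w)"
  unfolding lin_def using assms by (intro sum.mono_neutral_left) (auto simp: in_keys_iff)

lemma lin_0: "lin \<kappa> v 0 = 0"
  by (simp add: lin_def)

lemma lin_single: "\<kappa> 0 = 0 \<Longrightarrow> lin \<kappa> v (Poly_Mapping.single w c) = \<kappa> c * v w"
  by (subst lin_superset[where A = "{w}"]) auto

lemma lin_add:
  fixes \<kappa> :: "'k::comm_monoid_add \<Rightarrow> 'r::ring"
  assumes "\<And>a b. \<kappa> (a + b) = \<kappa> a + \<kappa> b"
  shows "lin \<kappa> v (f + g) = lin \<kappa> v f + lin \<kappa> v g"
proof -
  have 0: "\<kappa> 0 = 0"
    using assms[of 0 0] by simp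
  let ?A = "Poly_Mapping.keys f \<union> Poly_Mapping.keys g"
  have "lin \<kappa> v h = (\<Sum>w\<in>?A. \<kappa> (Poly_Mapping.lookup h w) * v w)" if "h \<in> {f, g, f + g}" for h
    using that keys_add[of f g] by (intro lin_superset 0) auto
  then show ?thesis
    by (simp add: lookup_add assms sum.distrib distrib_right)
qed

lemma lin_mult:
  fixes \<kappa> :: "'k::comm_semiring_0 \<Rightarrow> 'r::ring" and v :: "'w::monoid_add \<Rightarrow> 'r"
  assumes add: "\<And>a b. \<kappa> (a + b) = \<kappa> a + \<kappa> b" and mult: "\<And>a b. \<kappa> (a * b) = \<kappa> a * \<kappa> b"
    and central: "\<And>c w. \<kappa> c * v w = v w * \<kappa> c" and v: "\<And>u w. v (u + w) = v u * v w"
  shows "lin \<kappa> v (f * g) = lin \<kappa> v f * lin \<kappa> v g"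
proof -
  have 0: "\<kappa> 0 = 0"
    using add[of 0 0] by simp
  show ?thesis
  proof (induction f rule: poly_mapping_induct_add)
    case (single u a)
    show ?case
    proof (induction g rule: poly_mapping_induct_add)
      case (single w b)
      have "lin \<kappa> v (Poly_Mapping.single u a * Poly_Mapping.single w b) = \<kappa> a * (\<kappa> b * v u) * v w"
        by (simp add: mult_single lin_single[of \<kappa>, OF 0] mult v mult.assoc)
      also have "\<dots> = \<kappa> a * (v u * \<kappa> b) * v w"
        by (simp only: central)
      also have "\<dots> = lin \<kappa> v (Poly_Mapping.single u a) * lin \<kappa> v (Poly_Mapping.single w b)"
        by (simp add: lin_single[of \<kappa>, OF 0] mult.assoc)
      finally show ?case .
    qed (simp_all add: lin_0 distrib_left lin_add[of \<kappa>, OF add])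
  qed (simp_all add: lin_0 distrib_right lin_add[of \<kappa>, OF add])
qed

lemma scalar_hom:
  "scalar (a + b) = scalar a + scalar b" "scalar (a * b) = scalar a * scalar b"
  "scalar 0 = 0" "scalar 1 = 1"
  by (simp_all add: scalar_def single_add mult_single)

lemma scalar_single: "scalar c * Poly_Mapping.single w a = Poly_Mapping.single w (c * a)"
  by (simp add: scalar_def mult_single)

lemma scalar_commute: "scalar c * f = f * scalar (c::'k::field)"
  by (induction f rule: poly_mapping_induct_add)
    (simp_all add: scalar_def mult_single mult.commute distrib_left distrib_right)

lemma single_Word_Cons:
  "Poly_Mapping.single (Word (g # ws)) 1 = gen g * Poly_Mapping.single (Word ws) (1::'k::field)"
  by (simp add: gen_def mult_single plus_word_def)

primrec word_deriv :: "('g \<Rightarrow> ('g word \<Rightarrow>\<^sub>0 'k)) \<Rightarrow> 'g list \<Rightarrow> ('g word \<Rightarrow>\<^sub>0 'k::field)" where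
  "word_deriv D [] = 0"
| "word_deriv D (g # ws) = D g * Poly_Mapping.single (Word ws) 1 + gen g * word_deriv D ws"

lemma word_deriv_append:
  "word_deriv D (us @ ws) =
    word_deriv D us * Poly_Mapping.single (Word ws) 1 + Poly_Mapping.single (Word us) 1 * word_deriv D ws"
proof (induction us)
  case (Cons g us)
  have "Poly_Mapping.single (Word (us @ ws)) (1::'b) =
    Poly_Mapping.single (Word us) 1 * Poly_Mapping.single (Word ws) 1"
    by (simp add: mult_single plus_word_def)
  with Cons show ?case
    by (simp add: single_Word_Cons algebra_simps)
qed (simp flip: zero_word_def)

definition deriv :: "('g \<Rightarrow> ('g word \<Rightarrow>\<^sub>0 'k)) \<Rightarrow> ('g word \<Rightarrow>\<^sub>0 'k::field) \<Rightarrow> ('g word \<Rightarrow>\<^sub>0 'k)" where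
  "deriv D = lin scalar (\<lambda>w. word_deriv D (letters w))"

lemma deriv_0: "deriv D 0 = 0"
  by (simp add: deriv_def lin_0)

lemma deriv_add: "deriv D (f + g) = deriv D f + deriv D g"
  by (simp add: deriv_def lin_add scalar_hom)

lemma deriv_minus: "deriv D (- f) = - deriv D f"
  using deriv_add[of D f "- f"] by (simp add: deriv_0 eq_neg_iff_add_eq_0 add.commute)

lemma deriv_diff: "deriv D (f - g) = deriv D f - deriv D g"
  using deriv_add[of D f "- g"] by (simp add: deriv_minus)

lemma deriv_sum: "deriv D (sum f A) = (\<Sum>a\<in>A. deriv D (f a))"
  by (induction A rule: infinite_finite_induct) (simp_all add: deriv_0 deriv_add)

lemma deriv_single: "deriv D (Poly_Mapping.single w c) = scalar c * word_deriv D (letters w)"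
  by (simp add: deriv_def lin_single scalar_hom)

lemma deriv_gen: "deriv D (gen g) = D g"
  by (simp add: gen_def deriv_single scalar_hom flip: zero_word_def)

lemma deriv_scalar: "deriv D (scalar c) = 0"
  by (simp add: scalar_def deriv_single zero_word_def)

lemma deriv_1: "deriv D 1 = 0"
  using deriv_scalar[of D 1] by (simp add: scalar_hom)

lemma deriv_mult: "deriv D (f * g) = deriv D f * g + f * deriv D g"
proof (induction f rule: poly_mapping_induct_add)
  case (single u a)
  show ?case
  proof (induction g rule: poly_mapping_induct_add)
    case (single w b)
    let ?u = "Poly_Mapping.single u (1::'b)" and ?w = "Poly_Mapping.single w (1::'b)"
    have sing: "Poly_Mapping.single u a = scalar a * ?u" "Poly_Mapping.single w b = scalar b * ?w"
      by (simp_all add: scalar_single)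
    have comm: "f * (scalar b * h) = scalar b * (f * h)" for f h :: "'a word \<Rightarrow>\<^sub>0 'b"
      by (metis mult.assoc scalar_commute)
    have "deriv D (Poly_Mapping.single u a * Poly_Mapping.single w b) =
      scalar a * (scalar b * (word_deriv D (letters u) * ?w + ?u * word_deriv D (letters w)))"
      by (simp add: mult_single deriv_single plus_word_def word_deriv_append scalar_hom mult.assoc)
    moreover have "deriv D (Poly_Mapping.single u a) * Poly_Mapping.single w b =
      scalar a * (scalar b * (word_deriv D (letters u) * ?w))"
      unfolding deriv_single by (simp only: sing mult.assoc comm)
    moreover have "Poly_Mapping.single u a * deriv D (Poly_Mapping.single w b) =
      scalar a * (scalar b * (?u * word_deriv D (letters w)))"
      unfolding deriv_single by (simp only: sing mult.assoc comm)
    ultimately show ?case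
      by (simp only: distrib_left)
  qed (simp_all add: deriv_0 deriv_add distrib_left)
qed (simp_all add: deriv_0 deriv_add distrib_right)

lemma deriv_scalar_mult: "deriv D (scalar c * f) = scalar c * deriv D f"
  by (simp add: deriv_mult deriv_scalar)

text \<open>Elements are sums of scalars times words, and words are products of generators. The
  cases \<open>add\<close> and \<open>mult\<close> keep membership in the subalgebra, because
  statements on classes, as in \<open>differential_eq\<close>, can be combined only there.\<close>

lemma free_algebra_induct [consumes 1, case_names scalar gen add mult]:
  fixes f :: "'g word \<Rightarrow>\<^sub>0 'k::field"
  assumes "f \<in> carrier (free_algebra Z)"
    and scal: "\<And>c. P (scalar c)" and gn: "\<And>g. g \<in> Z \<Longrightarrow> P (gen g)"
    and add: "\<And>f g. f \<in> carrier (free_algebra Z) \<Longrightarrow> g \<in> carrier (free_algebra Z) \<Longrightarrow> P f \<Longrightarrow> P g \<Longrightarrow> P (f + g)"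
    and mult: "\<And>f g. f \<in> carrier (free_algebra Z) \<Longrightarrow> g \<in> carrier (free_algebra Z) \<Longrightarrow> P f \<Longrightarrow> P g \<Longrightarrow> P (f * g)"
  shows "P f"
proof -
  let ?C = "carrier (free_algebra Z) :: ('g word \<Rightarrow>\<^sub>0 'k) set"
  have sC: "scalar c \<in> ?C" for c
    by (auto simp: free_algebra_simps scalar_def zero_word_def)
  have word: "Poly_Mapping.single (Word ws) 1 \<in> ?C \<and> P (Poly_Mapping.single (Word ws) 1)" if "set ws \<subseteq> Z" for ws
    using that
  proof (induction ws)
    case Nil
    have "Poly_Mapping.single (Word []) 1 = (scalar 1 :: 'g word \<Rightarrow>\<^sub>0 'k)"
      by (simp add: scalar_def zero_word_def)
    then show ?case
      using scal sC by metis
  next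
    case (Cons g ws)
    then show ?case
      using mult gn free_carrier_closed(3)[of g Z] free_carrier_closed(6)[of "gen g" Z]
      by (auto simp: single_Word_Cons)
  qed
  have "f \<in> ?C \<longrightarrow> f \<in> ?C \<and> P f"
  proof (induction f rule: Poly_Mapping.update_induct)
    case const
    show ?case
      using scal[of 0] by (simp add: scalar_hom)
  next
    case (update f w b)
    have eq: "Poly_Mapping.update w b f = f + scalar b * Poly_Mapping.single (Word (letters w)) 1"
      using update(1)
      by (intro poly_mapping_eqI)
        (auto simp: lookup_update lookup_add lookup_single when_def in_keys_iff scalar_single)
    show ?case
    proof
      assume C: "Poly_Mapping.update w b f \<in> ?C"
      then have "f \<in> ?C" "set (letters w) \<subseteq> Z"
        using update by (auto simp: free_algebra_simps keys_update)
      then show "Poly_Mapping.update w b f \<in> ?C \<and> P (Poly_Mapping.update w b f)"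
        using C update word[of "letters w"] scal sC unfolding eq
        by (auto intro!: add mult free_carrier_closed(6))
    qed
  qed
  then show ?thesis
    using assms(1) by simp
qed

section \<open>Presented algebras\<close>

locale presentation =
  fixes Z :: "'g set" and R :: "('g word \<Rightarrow>\<^sub>0 'k::field) set"
  assumes rels: "R \<subseteq> carrier (free_algebra Z)"
begin

abbreviation C :: "('g word \<Rightarrow>\<^sub>0 'k) set" where "C \<equiv> carrier (free_algebra Z)"

definition I :: "('g word \<Rightarrow>\<^sub>0 'k) set" where "I = Idl\<^bsub>free_algebra Z\<^esub> R"

lemma I_ideal: "ideal I (free_algebra Z)"
  unfolding I_def by (rule ring.genideal_ideal[OF ring_free_algebra rels])

lemma rels_I: "R \<subseteq> I"
  unfolding I_def by (rule ring.genideal_self[OF ring_free_algebra rels])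

lemma I_C: "a \<in> I \<Longrightarrow> a \<in> C"
  using ideal.Icarr[OF I_ideal] .

lemma scalar_C: "scalar c \<in> C"
  by (auto simp: free_algebra_simps scalar_def zero_word_def)

lemma I_0: "0 \<in> I"
  using additive_subgroup.zero_closed[OF ideal.axioms(1)[OF I_ideal]] by (simp add: free_algebra_simps)

lemma I_add: "a \<in> I \<Longrightarrow> b \<in> I \<Longrightarrow> a + b \<in> I"
  using additive_subgroup.a_closed[OF ideal.axioms(1)[OF I_ideal]] by (simp add: free_algebra_simps)

lemma I_mult_left: "a \<in> I \<Longrightarrow> r \<in> C \<Longrightarrow> r * a \<in> I"
  using ideal.I_l_closed[OF I_ideal] by (simp add: free_algebra_simps)

lemma I_mult_right: "a \<in> I \<Longrightarrow> r \<in> C \<Longrightarrow> a * r \<in> I"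
  using ideal.I_r_closed[OF I_ideal] by (simp add: free_algebra_simps)

lemma I_minus: "a \<in> I \<Longrightarrow> - a \<in> I"
  using I_mult_left[OF _ free_carrier_closed(4)[OF free_carrier_closed(2)], of a] by simp

lemma I_diff: "a \<in> I \<Longrightarrow> b \<in> I \<Longrightarrow> a - b \<in> I"
  using I_add[of a "- b"] I_minus by simp

text \<open>The elements of \<open>I\<close> with the property form an ideal that contains the
  relations. The case \<open>diff\<close> yields negatives as 0 - a and then sums as a - (-
  b).\<close>

lemma I_induct [consumes 1, case_names rel zero diff left right]:
  assumes "a \<in> I"
    and rel: "\<And>r. r \<in> R \<Longrightarrow> P r" and zero: "P 0"
    and diff: "\<And>a b. a \<in> I \<Longrightarrow> b \<in> I \<Longrightarrow> P a \<Longrightarrow> P b \<Longrightarrow> P (a - b)"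
    and left: "\<And>a r. a \<in> I \<Longrightarrow> r \<in> C \<Longrightarrow> P a \<Longrightarrow> P (r * a)"
    and right: "\<And>a r. a \<in> I \<Longrightarrow> r \<in> C \<Longrightarrow> P a \<Longrightarrow> P (a * r)"
  shows "P a"
proof -
  let ?K = "{a \<in> I. P a}"
  have "ideal ?K (free_algebra Z)"
  proof (rule idealI[OF ring_free_algebra])
    have neg: "- a \<in> ?K" if "a \<in> ?K" for a
      using that diff[of 0 a] zero I_0 I_minus by auto
    have add: "a + b \<in> ?K" if "a \<in> ?K" "b \<in> ?K" for a b
      using that neg[of b] diff[of a "- b"] I_add by auto
    show "subgroup ?K (add_monoid (free_algebra Z))"
    proof (rule group.subgroupI)
      show "group (add_monoid (free_algebra Z))"
        using abelian_group.a_group[OF ring.is_abelian_group[OF ring_free_algebra]] .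
      show "inv\<^bsub>add_monoid (free_algebra Z)\<^esub> a \<in> ?K" if a: "a \<in> ?K" for a
      proof -
        have "a \<in> C" "- a \<in> C"
          using a I_C neg[OF a] by auto
        then have "\<ominus>\<^bsub>free_algebra Z\<^esub> a = - a"
          by (intro abelian_group.minus_equality[OF ring.is_abelian_group[OF ring_free_algebra]])
            (simp_all add: free_algebra_simps(2-))
        then show ?thesis
          using neg[OF a] by (simp add: a_inv_def)
      qed
    qed (use add zero I_0 I_C in \<open>auto simp: free_algebra_simps(2-)\<close>)
  qed (use left right I_mult_left I_mult_right in \<open>auto simp: free_algebra_simps(2-)\<close>)
  moreover have "R \<subseteq> ?K"
    using rel rels_I by auto
  ultimately have "I \<subseteq> ?K"
    unfolding I_def using ring.genideal_minimal[OF ring_free_algebra] by blast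
  then show ?thesis
    using assms(1) by blast
qed

text \<open>The retraction of the algebra of all words onto the words in \<open>Z\<close> turns \<open>I\<close>
  into a two-sided ideal of a type.\<close>

definition retr :: "('g word \<Rightarrow>\<^sub>0 'k) \<Rightarrow> ('g word \<Rightarrow>\<^sub>0 'k)" where
  "retr = lin scalar (\<lambda>w. if set (letters w) \<subseteq> Z then Poly_Mapping.single w 1 else 0)"

lemma retr_add: "retr (f + g) = retr f + retr g"
  by (simp add: retr_def lin_add scalar_hom)

lemma retr_0: "retr 0 = 0"
  by (simp add: retr_def lin_0)

lemma retr_diff: "retr (f - g) = retr f - retr g"
  using retr_add[of "f - g" g] by simp

lemma retr_mult: "retr (f * g) = retr f * retr g"
  unfolding retr_def
  by (rule lin_mult) (auto simp: scalar_hom mult_single plus_word_def intro: scalar_commute)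

lemma retr_C: "retr f \<in> C"
proof -
  have "scalar c * Poly_Mapping.single w 1 \<in> C" if "set (letters w) \<subseteq> Z" for c w
    using that by (auto simp: free_algebra_simps scalar_single)
  then show ?thesis
    unfolding retr_def lin_def by (auto intro!: free_carrier_closed' free_carrier_closed(1))
qed

lemma retr_eq: "f \<in> C \<Longrightarrow> retr f = f"
proof (induction rule: free_algebra_induct)
  case (scalar c)
  then show ?case
    by (simp add: retr_def scalar_def lin_single scalar_hom zero_word_def mult_single plus_word_def)
next
  case (gen g)
  then show ?case
    by (simp add: retr_def gen_def lin_single scalar_hom)
qed (simp_all add: retr_add retr_mult)

definition q :: "('g word \<Rightarrow>\<^sub>0 'k) \<Rightarrow> ('g word \<Rightarrow>\<^sub>0 'k) quots" where
  "q = quot {f. retr f \<in> I}"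

lemma q_hom:
  "q (f + g) = q f + q g" "q (f - g) = q f - q g" "q (- f) = - q f" "q (f * g) = q f * q g" "q 0 = 0"
  "q (sum F A) = (\<Sum>a\<in>A. q (F a))"
  by (simp_all add: q_def quot_hom quot_sum)

lemma q_1: "q 1 * q f = q f" "q f * q 1 = q f" "q 1 * (q f * r) = q f * r"
  by (simp_all flip: q_hom(4) mult.assoc)

lemma q_0_iff: "q f = 0 \<longleftrightarrow> retr f \<in> I"
proof -
  have "two_sided {f. retr f \<in> I}"
    unfolding two_sided_def
    by (auto simp: retr_0 retr_diff retr_mult I_0 I_diff retr_C intro: I_mult_left I_mult_right)
  then show ?thesis
    by (simp add: q_def quot_eq_0_iff)
qed

lemma q_eq_iff: "f \<in> C \<Longrightarrow> g \<in> C \<Longrightarrow> q f = q g \<longleftrightarrow> f - g \<in> I"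
  using q_0_iff[of "f - g"] retr_eq[OF free_carrier_closed'(1)[of f Z g]] by (simp add: q_hom)

lemma q_rel: "r \<in> R \<Longrightarrow> q r = 0"
  using q_0_iff[of r] subsetD[OF rels_I] subsetD[OF rels] retr_eq[of r] by simp

lemma q_scalar_commute: "q (scalar c) * q f = q f * q (scalar c)"
  by (metis scalar_commute q_hom(4))

lemma q_of_nat: "q (of_nat k * f) = of_nat k * q f"
  by (induction k) (simp_all add: q_hom distrib_right)

lemma q_neg_one_power: "q ((- 1) ^ k * f) = (- 1) ^ k * q f"
  by (induction k) (simp_all add: q_hom)

text \<open>The universal property of the presentation, in the form needed for the coaction
  \<open>graded\<close>.\<close>

lemma hom_kills_I:
  fixes h :: "('g word \<Rightarrow>\<^sub>0 'k) \<Rightarrow> 'b::ring"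
  assumes add: "\<And>f g. h (f + g) = h f + h g" and mult: "\<And>f g. h (f * g) = h f * h g"
    and rel: "\<And>r. r \<in> R \<Longrightarrow> h r = 0" and a: "a \<in> I"
  shows "h a = 0"
proof -
  have 0: "h 0 = 0"
    using add[of 0 0] by simp
  have diff: "h (f - g) = h f - h g" for f g
    using add[of "f - g" g] by simp
  show ?thesis
    using a by (induction rule: I_induct) (simp_all add: rel 0 diff mult)
qed

lemma deriv_C:
  assumes D: "\<And>g. g \<in> Z \<Longrightarrow> D g \<in> C" and f: "f \<in> C"
  shows "deriv D f \<in> C"
  using f
proof (induction rule: free_algebra_induct)
  case (gen g)
  then show ?case
    using D by (simp add: deriv_gen)
qed (auto simp: deriv_scalar deriv_add deriv_mult intro!: free_carrier_closed)

text \<open>By the Leibniz rule, the elements of \<open>I\<close> with derivative in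
  \<open>I\<close> are closed under multiplication by elements of \<open>C\<close> on either side.
  This reduces well-definedness of the differential to the relations themselves.\<close>

lemma deriv_I:
  assumes D: "\<And>g. g \<in> Z \<Longrightarrow> D g \<in> C" and rel: "\<And>r. r \<in> R \<Longrightarrow> q (deriv D r) = 0" and a: "a \<in> I"
  shows "deriv D a \<in> I"
  using a
proof (induction rule: I_induct)
  case (rel r)
  then have "deriv D r \<in> C" "q (deriv D r) = 0"
    using rels by (auto intro: deriv_C D assms(2))
  then show ?case
    by (simp add: q_0_iff retr_eq)
next
  case (left a r)
  then show ?case
    by (simp add: deriv_mult I_add I_mult_left I_mult_right deriv_C D)
next
  case (right a r)
  then show ?case
    by (simp add: deriv_mult I_add I_mult_left I_mult_right deriv_C D)
qed (auto simp: deriv_0 I_0 deriv_diff intro: I_diff)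

abbreviation A :: "('k, ('g word \<Rightarrow>\<^sub>0 'k) set) module" where "A \<equiv> presented_algebra Z R"

abbreviation cl :: "('g word \<Rightarrow>\<^sub>0 'k) \<Rightarrow> ('g word \<Rightarrow>\<^sub>0 'k) set" where "cl \<equiv> cls Z R"

abbreviation K :: "'k ring" where "K \<equiv> ring_of_type_algebra"

text \<open>The bridge between the cosets that make up the algebra and the calculations with
  \<open>q\<close> in a type.\<close>

lemma cls_eq_iff:
  assumes "f \<in> C" "g \<in> C"
  shows "cl f = cl g \<longleftrightarrow> q f = q g"
proof -
  have cls: "cls Z R f = {h + f | h. h \<in> I}" for f
    unfolding cls_def I_def[symmetric] a_r_coset_def' free_algebra_simps(5) by blast
  have "cl f = cl g \<longleftrightarrow> f - g \<in> I"
  proof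
    assume "cl f = cl g"
    then have "0 + f \<in> cl g"
      unfolding cls using I_0 by blast
    then show "f - g \<in> I"
      unfolding cls by auto
  next
    assume fg: "f - g \<in> I"
    have "h + f = (h + (f - g)) + g" "h + g = (h - (f - g)) + f" for h
      by simp_all
    then show "cl f = cl g"
      unfolding cls by (metis (no_types, lifting) fg I_add I_diff)
  qed
  then show ?thesis
    using q_eq_iff[OF assms] by simp
qed

lemma carrier_A: "carrier A = cl ` C"
  by (auto simp: presented_algebra_def Let_def FactRing_def A_RCOSETS_def' cls_def)

lemma A_ops:
  "\<zero>\<^bsub>A\<^esub> = cl 0" "\<one>\<^bsub>A\<^esub> = cl 1"
  "f \<in> C \<Longrightarrow> g \<in> C \<Longrightarrow> cl f \<oplus>\<^bsub>A\<^esub> cl g = cl (f + g)"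
  "f \<in> C \<Longrightarrow> g \<in> C \<Longrightarrow> cl f \<otimes>\<^bsub>A\<^esub> cl g = cl (f * g)"
  "f \<in> C \<Longrightarrow> a \<odot>\<^bsub>A\<^esub> cl f = cl (scalar a * f)"
proof -
  have mult: "[mod I:] cls Z R f \<Otimes>\<^bsub>free_algebra Z\<^esub> cls Z R g = cl (f * g)" if "f \<in> C" "g \<in> C" for f g
    using ideal.rcoset_mult_add[OF I_ideal that] by (simp add: cls_def I_def free_algebra_simps(2-))
  show "\<zero>\<^bsub>A\<^esub> = cl 0"
    by (simp add: presented_algebra_def Let_def FactRing_def cls_def a_r_coset_def' free_algebra_simps(5))
  show "\<one>\<^bsub>A\<^esub> = cl 1"
    by (simp add: presented_algebra_def Let_def FactRing_def cls_def free_algebra_simps(3))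
  show "f \<in> C \<Longrightarrow> g \<in> C \<Longrightarrow> cl f \<oplus>\<^bsub>A\<^esub> cl g = cl (f + g)"
    using abelian_subgroup.a_rcos_sum[OF abelian_subgroupI3[OF ideal.axioms(1)[OF I_ideal]
        ring.is_abelian_group[OF ring_free_algebra]], of f g]
    by (simp add: presented_algebra_def Let_def FactRing_def cls_def I_def free_algebra_simps(5))
  show "f \<in> C \<Longrightarrow> g \<in> C \<Longrightarrow> cl f \<otimes>\<^bsub>A\<^esub> cl g = cl (f * g)"
    using mult by (simp add: presented_algebra_def Let_def FactRing_def I_def)
  show "f \<in> C \<Longrightarrow> a \<odot>\<^bsub>A\<^esub> cl f = cl (scalar a * f)"
    using mult[OF scalar_C] by (simp add: presented_algebra_def Let_def FactRing_def I_def)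
qed

lemmas C_closed = free_carrier_closed(1-2,4-) free_carrier_closed' scalar_C

lemma abelian_group_A: "abelian_group A"
proof (rule abelian_groupI)
  fix x assume "x \<in> carrier A"
  then obtain f where f: "f \<in> C" "x = cl f"
    by (auto simp: carrier_A)
  then show "\<exists>y\<in>carrier A. y \<oplus>\<^bsub>A\<^esub> x = \<zero>\<^bsub>A\<^esub>"
    by (auto simp: carrier_A A_ops C_closed intro!: bexI[of _ "- f"])
qed (auto simp: carrier_A A_ops C_closed algebra_simps)

lemma ring_A: "ring A"
proof (rule ringI[OF abelian_group_A])
  show "monoid A"
    by (rule monoidI) (auto simp: carrier_A A_ops C_closed algebra_simps)
qed (auto simp: carrier_A A_ops C_closed algebra_simps)

lemma module_A: "module K A"
proof (rule moduleI[OF cring_from_type_algebra abelian_group_A])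
qed (auto simp: carrier_A A_ops C_closed scalar_hom ring_of_type_algebra_def distrib_left distrib_right mult.assoc)

lemma assoc_algebra_A: "assoc_algebra K A"
  unfolding assoc_algebra_def
proof (intro conjI module_A ring_A ballI)
  have comm: "f * (scalar a * g) = scalar a * (f * g)" for a and f g :: "'g word \<Rightarrow>\<^sub>0 'k"
    by (metis mult.assoc scalar_commute)
  fix a x y assume "x \<in> carrier A" "y \<in> carrier A"
  then show "(a \<odot>\<^bsub>A\<^esub> x) \<otimes>\<^bsub>A\<^esub> y = a \<odot>\<^bsub>A\<^esub> (x \<otimes>\<^bsub>A\<^esub> y)"
    "x \<otimes>\<^bsub>A\<^esub> (a \<odot>\<^bsub>A\<^esub> y) = a \<odot>\<^bsub>A\<^esub> (x \<otimes>\<^bsub>A\<^esub> y)"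
    by (auto simp: carrier_A A_ops C_closed mult.assoc comm)
qed

lemma finsum_A: "finite S \<Longrightarrow> (\<And>k. k \<in> S \<Longrightarrow> F k \<in> C) \<Longrightarrow> finsum A (\<lambda>k. cl (F k)) S = cl (sum F S)"
proof (induction S rule: finite_induct)
  interpret ab: abelian_group A by (rule abelian_group_A)
  case empty
  show ?case by (simp add: A_ops)
next
  interpret ab: abelian_group A by (rule abelian_group_A)
  case (insert k S)
  then have "finsum A (\<lambda>k. cl (F k)) (insert k S) = cl (F k) \<oplus>\<^bsub>A\<^esub> finsum A (\<lambda>k. cl (F k)) S"
    by (intro ab.finsum_insert) (auto simp: carrier_A)
  then show ?case
    using insert by (simp add: A_ops C_closed)
qed

end

section \<open>Calculus in the deformed Webster algebra\<close>

lemma length_Seq: "i \<in> Seq s n \<Longrightarrow> length i = length s + n"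
proof -
  assume "i \<in> Seq s n"
  then have "count_list i Black = n" "length (filter (\<lambda>c. c \<noteq> Black) i) = length s"
    by (simp_all add: Seq_def)
  moreover have "count_list i Black + length (filter (\<lambda>c. c \<noteq> Black) i) = length i"
    by (induction i) auto
  ultimately show ?thesis
    by simp
qed

lemma swap_split:
  assumes "1 \<le> j" "j < length i"
  obtains u v where "i = u @ entry i j # entry i (Suc j) # v"
    "swap j i = u @ entry i (Suc j) # entry i j # v" "length u = j - 1"
proof
  let ?u = "take (j - 1) i" and ?v = "drop (j + 1) i"
  have "i = ?u @ drop (j - 1) i"
    by simp
  also have "drop (j - 1) i = entry i j # entry i (Suc j) # ?v"
    using assms by (metis Cons_nth_drop_Suc Suc_eq_plus1 add_diff_cancel_right' diff_less_mono2 entry_def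
        le_add_diff_inverse2 less_imp_diff_less)
  finally show i: "i = ?u @ entry i j # entry i (Suc j) # ?v" .
  show u: "length ?u = j - 1"
    using assms by simp
  have "swap j (?u @ a # b # ?v) = ?u @ b # a # ?v" for a b
    using assms by (auto simp: swap_def entry_def list_update_append nth_append split: nat.split)
  then show "swap j i = ?u @ entry i (Suc j) # entry i j # ?v"
    using i by metis
qed

lemma entry_swap:
  assumes "1 \<le> j" "j < length i"
  shows "entry (swap j i) j = entry i (Suc j)" "entry (swap j i) (Suc j) = entry i j"
    "1 \<le> l \<Longrightarrow> l \<noteq> j \<Longrightarrow> l \<noteq> Suc j \<Longrightarrow> entry (swap j i) l = entry i l"
    "swap j (swap j i) = i"
  using assms by (auto simp: swap_def entry_def nth_list_update intro!: nth_equalityI)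

lemma length_swap [simp]: "length (swap j i) = length i"
  by (simp add: swap_def)

lemma swap_same: "entry i j = entry i (Suc j) \<Longrightarrow> swap j i = i"
  by (simp add: entry_def swap_def) (metis list_update_id)

text \<open>Exchanging a black letter with a neighbour changes neither the number of black letters
  nor the order of the red ones.\<close>

lemma swap_Seq:
  assumes "i \<in> Seq s n" "1 \<le> j" "j < length i" "entry i j = Black \<or> entry i (Suc j) = Black"
  shows "swap j i \<in> Seq s n"
proof -
  obtain u v where "i = u @ entry i j # entry i (Suc j) # v"
    "swap j i = u @ entry i (Suc j) # entry i j # v"
    using swap_split assms by metis
  moreover define a b where "a = entry i j" "b = entry i (Suc j)"
  ultimately have "i = u @ a # b # v" "swap j i = u @ b # a # v"
    by simp_all
  then show ?thesis
    using assms unfolding Seq_def a_b_def[symmetric] by (auto split: if_splits)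
qed

locale webster =
  fixes s :: "nat list" and n :: nat and ty :: "'k::field itself"
begin

sublocale presentation "webster_gens s n" "webster_rels s n :: 'k free set"
  by unfold_locales (rule webster_rels_carrier)

abbreviation pos :: "nat \<Rightarrow> bool" where "pos j \<equiv> 1 \<le> j \<and> j \<le> length s + n"
abbreviation crs :: "nat \<Rightarrow> bool" where "crs j \<equiv> 1 \<le> j \<and> j < length s + n"

abbreviation e :: "letter list \<Rightarrow> 'k free quots" where "e i \<equiv> q (ee i)"
abbreviation xq :: "nat \<Rightarrow> 'k free quots" where "xq j \<equiv> q (xx j)"
abbreviation P :: "nat \<Rightarrow> 'k free quots" where "P j \<equiv> q (psi j)"

text \<open>\<open>q 1\<close> is only the unit of a corner; \<open>q (EE 0 j)\<close> and \<open>q (xx j ^ 0)\<close> therefore differ from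
  \<open>E 0 j = 1\<close> and \<open>xq j ^ 0 = 1\<close>, but not after multiplication by an element of the image of \<open>q\<close>.\<close>

definition E :: "nat \<Rightarrow> nat \<Rightarrow> 'k free quots" where
  "E d j = (if d = 0 then 1 else q (gen (Elem d j)))"

lemma E_0 [simp]: "E 0 j = 1"
  by (simp add: E_def)

lemma q_EE: "q (EE d j * f) = E d j * q f" "0 < d \<Longrightarrow> q (EE d j) = E d j"
  by (simp_all add: EE_def E_def q_hom q_1)

lemma q_xx_power: "q (xx j ^ k * f) = xq j ^ k * q f"
  by (induction k) (simp_all add: q_hom mult.assoc)

text \<open>\<open>loc z i\<close>: the element \<open>z\<close> starts at the sequence \<open>i\<close>. All relations are used
  in the form \<open>a * z = b * z\<close> for such \<open>z\<close>.\<close>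

definition loc :: "'k free quots \<Rightarrow> letter list \<Rightarrow> bool" where
  "loc z i \<longleftrightarrow> i \<in> Seq s n \<and> e i * z = z"

lemma loc_Seq: "loc z i \<Longrightarrow> i \<in> Seq s n"
  by (simp add: loc_def)

lemma loc_length: "loc z i \<Longrightarrow> length i = length s + n"
  using length_Seq loc_Seq by blast

lemma unit_sum: "q 1 = (\<Sum>i\<in>Seq s n. e i)"
  using q_rel[OF webster_rels.unit] by (simp add: q_hom)

lemma e_e: "i \<in> Seq s n \<Longrightarrow> i' \<in> Seq s n \<Longrightarrow> e i * e i' = (if i = i' then e i else 0)"
  using q_rel[OF webster_rels.e_e] by (auto simp: q_hom split: if_splits)

lemma loc_e: "i \<in> Seq s n \<Longrightarrow> loc (e i) i"
  by (simp add: loc_def e_e)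

lemma e_loc: "loc z i \<Longrightarrow> i' \<in> Seq s n \<Longrightarrow> e i' * z = (if i' = i then z else 0)"
proof -
  assume z: "loc z i" and i': "i' \<in> Seq s n"
  have "e i' * z = (e i' * e i) * z"
    using z by (simp add: loc_def mult.assoc)
  also have "\<dots> = (if i' = i then z else 0)"
    using z i' by (simp add: e_e loc_def del: mult.assoc)
  finally show ?thesis .
qed

lemma loc_mult: "loc z i \<Longrightarrow> loc (z * w) i"
  by (simp add: loc_def flip: mult.assoc)

lemma loc_add: "loc z i \<Longrightarrow> loc w i \<Longrightarrow> loc (z + w) i"
  "loc z i \<Longrightarrow> loc w i \<Longrightarrow> loc (z - w) i" "loc z i \<Longrightarrow> loc (- z) i" "i \<in> Seq s n \<Longrightarrow> loc 0 i"
  by (simp_all add: loc_def distrib_left right_diff_distrib)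

lemma E_e: "i \<in> Seq s n \<Longrightarrow> pos j \<Longrightarrow> E d j * e i = e i * E d j"
  using q_rel[OF webster_rels.E_e[of i s n j d]] by (cases "d = 0") (simp_all add: q_hom q_EE)

lemma x_e: "i \<in> Seq s n \<Longrightarrow> pos j \<Longrightarrow> xq j * e i = e i * xq j"
  using q_rel[OF webster_rels.x_e[of i s n j]] by (simp_all add: q_hom)

lemma psi_e: "i \<in> Seq s n \<Longrightarrow> crs j \<Longrightarrow> P j * e i = q (ee0 s n (swap j i)) * P j"
  using q_rel[OF webster_rels.psi_e[of i s n j]] by (simp_all add: q_hom)

lemma loc_move:
  assumes "a * e i = e i' * a" "loc z i" "i' \<in> Seq s n"
  shows "loc (a * z) i'"
proof -
  have "e i' * (a * z) = (a * e i) * z"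
    by (simp only: assms(1) mult.assoc)
  also have "\<dots> = a * z"
    using assms(2) by (simp add: loc_def mult.assoc)
  finally show ?thesis
    using assms(3) by (simp add: loc_def)
qed

lemma loc_E: "loc z i \<Longrightarrow> pos j \<Longrightarrow> loc (E d j * z) i"
  using loc_move[of "E d j" i i z] E_e[of i j d] loc_Seq by blast

lemma loc_X: "loc z i \<Longrightarrow> pos j \<Longrightarrow> loc (xq j * z) i"
  using loc_move[of "xq j" i i z] x_e[of i j] loc_Seq by blast

lemma loc_X_power: "loc z i \<Longrightarrow> pos j \<Longrightarrow> loc (xq j ^ k * z) i"
  by (induction k) (simp_all add: mult.assoc loc_X)

lemma loc_P: "loc z i \<Longrightarrow> crs j \<Longrightarrow> swap j i \<in> Seq s n \<Longrightarrow> loc (P j * z) (swap j i)"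
  using psi_e[of i j] by (intro loc_move[of "P j" i]) (simp_all add: ee0_def loc_Seq)

lemma loc_P_same: "loc z i \<Longrightarrow> crs j \<Longrightarrow> entry i j = Black \<Longrightarrow> entry i (Suc j) = Black \<Longrightarrow> loc (P j * z) i"
  using loc_P[of z i j] swap_same[of i j] by (simp add: loc_def)

lemma on_loc: "a * e i = b * e i \<Longrightarrow> loc z i \<Longrightarrow> a * z = b * z"
proof -
  assume ab: "a * e i = b * e i" and "loc z i"
  then have z: "e i * z = z"
    by (simp add: loc_def)
  have "a * (e i * z) = b * (e i * z)"
    using ab by (simp flip: mult.assoc)
  then show ?thesis
    by (simp only: z)
qed

text \<open>The idempotents sum to \<open>q 1\<close>, which is a unit for the image of
  \<open>q\<close>; so an equation may be checked on one starting sequence at a time.\<close>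

lemma eq_on_e:
  assumes "\<And>i. i \<in> Seq s n \<Longrightarrow> q f * e i = q g * e i"
  shows "q f = q g"
proof -
  have "q f * q 1 = q g * q 1"
    unfolding unit_sum sum_distrib_left by (rule sum.cong[OF refl assms])
  then show ?thesis
    by (simp add: q_1)
qed

section \<open>The defining relations as equations between operators\<close>

lemma E_black: "loc z i \<Longrightarrow> pos j \<Longrightarrow> entry i j = Black \<Longrightarrow> 1 \<le> d \<Longrightarrow> E d j * z = 0"
  using on_loc[of "E d j" i 0 z] q_rel[OF webster_rels.E_black[of i s n j d]]
  by (simp add: loc_Seq q_EE)

lemma E_large: "loc z i \<Longrightarrow> pos j \<Longrightarrow> entry i j = Red r \<Longrightarrow> r < d \<Longrightarrow> E d j * z = 0"
  using on_loc[of "E d j" i 0 z] q_rel[OF webster_rels.E_large[of i s n j d r]]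
  by (simp add: loc_Seq q_EE)

lemma x_red: "loc z i \<Longrightarrow> pos j \<Longrightarrow> entry i j = Red r \<Longrightarrow> xq j * z = 0"
  using on_loc[of "xq j" i 0 z] q_rel[OF webster_rels.x_red[of i s n j r]]
  by (simp add: loc_Seq q_hom)

lemma psi_red_red: "loc z i \<Longrightarrow> crs j \<Longrightarrow> entry i j = Red r \<Longrightarrow> entry i (Suc j) = Red r' \<Longrightarrow> P j * z = 0"
  using on_loc[of "P j" i 0 z] q_rel[OF webster_rels.psi_red_red[of i s n j r r']]
  by (simp add: loc_Seq q_hom)

lemma x_x: "pos j \<Longrightarrow> pos l \<Longrightarrow> xq j * xq l = xq l * xq j"
  using q_rel[OF webster_rels.x_x[of j s n l]] by (simp add: q_hom)

lemma E_x: "pos j \<Longrightarrow> pos l \<Longrightarrow> E d j * xq l = xq l * E d j"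
  using q_rel[OF webster_rels.E_x[of j s n l d]] by (cases "d = 0") (simp_all add: q_hom q_EE)

lemma E_E: "pos j \<Longrightarrow> pos l \<Longrightarrow> E d j * E d' l = E d' l * E d j"
  using q_rel[OF webster_rels.E_E[of j s n l d d']]
  by (cases "d = 0"; cases "d' = 0") (simp_all add: q_hom q_EE)

lemma psi_x: "crs j \<Longrightarrow> pos l \<Longrightarrow> l \<noteq> j \<Longrightarrow> l \<noteq> Suc j \<Longrightarrow> P j * xq l = xq l * P j"
  using q_rel[OF webster_rels.psi_x[of j s n l]] by (simp add: q_hom)

lemma psi_E: "crs j \<Longrightarrow> pos l \<Longrightarrow> l \<noteq> j \<Longrightarrow> l \<noteq> Suc j \<Longrightarrow> P j * E d l = E d l * P j"
  using q_rel[OF webster_rels.psi_E[of j s n l d]] by (cases "d = 0") (simp_all add: q_hom q_EE)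

lemma psi_E_left: "crs j \<Longrightarrow> P j * E d j = E d (Suc j) * P j"
  using q_rel[OF webster_rels.psi_E_left[of j s n d]] by (cases "d = 0") (simp_all add: q_hom q_EE)

lemma psi_E_right: "crs j \<Longrightarrow> E d j * P j = P j * E d (Suc j)"
  using q_rel[OF webster_rels.psi_E_right[of j s n d]] by (cases "d = 0") (simp_all add: q_hom q_EE)

lemma psi_psi_far: "crs j \<Longrightarrow> crs l \<Longrightarrow> 1 < \<bar>int j - int l\<bar> \<Longrightarrow> P j * P l = P l * P j"
  using q_rel[OF webster_rels.psi_psi_far[of j s n l]] by (simp add: q_hom)

lemma x_psi_bb:
  assumes "loc z i" "crs j" "entry i j = Black" "entry i (Suc j) = Black"
  shows "xq j * (P j * z) = P j * (xq (Suc j) * z) + z"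
proof -
  have "(xq j * P j - P j * xq (Suc j)) * e i = 1 * e i"
    using q_rel[OF webster_rels.x_psi_bb[of i s n j]] assms by (simp add: loc_Seq q_hom algebra_simps)
  from on_loc[OF this assms(1)] show ?thesis
    by (simp add: algebra_simps)
qed

lemma x_psi_rb:
  assumes "loc z i" "crs j" "entry i j = Red r" "entry i (Suc j) = Black"
  shows "xq j * (P j * z) = P j * (xq (Suc j) * z)"
proof -
  have "(xq j * P j) * e i = (P j * xq (Suc j)) * e i"
    using q_rel[OF webster_rels.x_psi_rb[of i s n j]] assms by (simp add: loc_Seq q_hom algebra_simps)
  from on_loc[OF this assms(1)] show ?thesis
    by (simp add: algebra_simps)
qed

lemma psi_x_bb:
  assumes "loc z i" "crs j" "entry i j = Black" "entry i (Suc j) = Black"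
  shows "xq (Suc j) * (P j * z) = P j * (xq j * z) - z"
proof -
  have "(xq (Suc j) * P j + 1) * e i = (P j * xq j) * e i"
    using q_rel[OF webster_rels.psi_x_bb[of i s n j]] assms by (simp add: loc_Seq q_hom algebra_simps)
  from on_loc[OF this assms(1)] show ?thesis
    by (simp add: algebra_simps)
qed

lemma psi_x_br:
  assumes "loc z i" "crs j" "entry i j = Black" "entry i (Suc j) = Red r"
  shows "xq (Suc j) * (P j * z) = P j * (xq j * z)"
proof -
  have "(xq (Suc j) * P j) * e i = (P j * xq j) * e i"
    using q_rel[OF webster_rels.psi_x_br[of i s n j]] assms by (simp add: loc_Seq q_hom algebra_simps)
  from on_loc[OF this assms(1)] show ?thesis
    by (simp add: algebra_simps)
qed

lemma psi_sq_bb: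
  assumes "loc z i" "crs j" "entry i j = Black" "entry i (Suc j) = Black"
  shows "P j * (P j * z) = 0"
proof -
  have "(P j * P j) * e i = 0 * e i"
    using q_rel[OF webster_rels.psi_sq_bb[of i s n j]] assms
    by (simp add: loc_Seq q_hom power2_eq_square)
  from on_loc[OF this assms(1)] show ?thesis
    by (simp add: algebra_simps)
qed

lemma psi_sq_rb:
  assumes "loc z i" "crs j" "entry i j = Red r" "entry i (Suc j) = Black"
  shows "P j * (P j * z) = (\<Sum>d=0..r. (- 1) ^ d * (E d j * (xq (Suc j) ^ (r - d) * z)))"
proof -
  have "(P j * P j) * e i = (\<Sum>d=0..r. (- 1) ^ d * (E d j * xq (Suc j) ^ (r - d))) * e i"
    using q_rel[OF webster_rels.psi_sq_rb[of i s n j]] assms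
    by (simp add: loc_Seq q_hom(2,6) power2_eq_square mult.assoc q_neg_one_power q_EE q_xx_power
        sum_distrib_right) (simp add: q_hom(4) mult.assoc)
  from on_loc[OF this assms(1)] show ?thesis
    by (simp add: sum_distrib_right mult.assoc)
qed

lemma psi_sq_br:
  assumes "loc z i" "crs j" "entry i j = Black" "entry i (Suc j) = Red r"
  shows "P j * (P j * z) = (\<Sum>d=0..r. (- 1) ^ d * (xq j ^ (r - d) * (E d (Suc j) * z)))"
proof -
  have "(P j * P j) * e i = (\<Sum>d=0..r. (- 1) ^ d * (xq j ^ (r - d) * E d (Suc j))) * e i"
    using q_rel[OF webster_rels.psi_sq_br[of i s n j]] assms
    by (simp add: loc_Seq q_hom(2,6) power2_eq_square mult.assoc q_neg_one_power q_EE q_xx_power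
        sum_distrib_right) (simp add: q_hom(4) mult.assoc)
  from on_loc[OF this assms(1)] show ?thesis
    by (simp add: sum_distrib_right mult.assoc)
qed

lemma braid_brb:
  assumes "loc z i" "1 \<le> j" "j + 2 \<le> length s + n"
    "entry i j = Black" "entry i (Suc j) = Red r" "entry i (Suc (Suc j)) = Black"
  shows "P j * (P (Suc j) * (P j * z)) - P (Suc j) * (P j * (P (Suc j) * z)) =
    (\<Sum>(d1, d2, d3)\<in>{(d1, d2, d3). d1 + d2 + d3 + 1 = r}.
      (- 1) ^ d3 * (xq j ^ d1 * (E d3 (Suc j) * (xq (Suc (Suc j)) ^ d2 * z))))"
proof -
  have "(P j * P (Suc j) * P j - P (Suc j) * P j * P (Suc j)) * e i =
    (\<Sum>(d1, d2, d3)\<in>{(d1, d2, d3). d1 + d2 + d3 + 1 = r}.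
      (- 1) ^ d3 * (xq j ^ d1 * (E d3 (Suc j) * xq (Suc (Suc j)) ^ d2))) * e i"
    using q_rel[OF webster_rels.braid_brb[of i s n j]] assms
    by (simp add: loc_Seq q_hom(2,6) left_diff_distrib mult.assoc q_neg_one_power q_EE q_xx_power
        sum_distrib_right case_prod_beta) (simp add: q_hom(4) mult.assoc)
  from on_loc[OF this assms(1)] show ?thesis
    by (simp add: sum_distrib_right mult.assoc case_prod_beta left_diff_distrib)
qed

lemma braid:
  assumes "loc z i" "1 \<le> j" "j + 2 \<le> length s + n"
    "\<not> (entry i j = Black \<and> entry i (Suc j) \<noteq> Black \<and> entry i (Suc (Suc j)) = Black)"
  shows "P j * (P (Suc j) * (P j * z)) = P (Suc j) * (P j * (P (Suc j) * z))"
proof -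
  have "(P j * P (Suc j) * P j) * e i = (P (Suc j) * P j * P (Suc j)) * e i"
    using q_rel[OF webster_rels.braid[of i s n j]] assms
    by (simp add: loc_Seq q_hom left_diff_distrib)
  from on_loc[OF this assms(1)] show ?thesis
    by (simp add: mult.assoc)
qed

end

section \<open>Compatibility of the differential with the relations\<close>

text \<open>The sum over \<open>d\<close> telescopes: the terms \<open>(d + 1) E (d + 1)\<close> of the derivatives are
  collected with the factor \<open>E d\<close> of the next summand.\<close>

lemma square_identity:
  fixes E :: "nat \<Rightarrow> 'a::ring_1" and x :: 'a
  assumes Ex: "\<And>d. E d * x = x * E d" and EE: "\<And>d. E d * E 1 = E 1 * E d"
  shows "(\<Sum>d=0..r. (- 1) ^ d * ((E d * E 1 - of_nat (d + 1) * E (d + 1)) * x ^ (r - d) +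
      of_nat (r - d) * (E d * x ^ (r - d + 1)))) =
    (\<Sum>d=0..r. (- 1) ^ d * (E d * x ^ (r - d))) * (E 1 + of_nat r * x) +
    (- 1) ^ (r + 1) * (of_nat (r + 1) * E (r + 1))"
proof -
  define g where "g d = (- 1) ^ d * (of_nat d * (E d * x ^ (r + 1 - d)))" for d
  have E1x: "E 1 * x ^ k = x ^ k * E 1" for k
    using power_commuting_commutes[OF Ex[of 1, symmetric], of k] by simp
  have "(- 1) ^ d * ((E d * E 1 - of_nat (d + 1) * E (d + 1)) * x ^ (r - d) +
      of_nat (r - d) * (E d * x ^ (r - d + 1))) =
    (- 1) ^ d * (E d * x ^ (r - d)) * (E 1 + of_nat r * x) + (g (Suc d) - g d)" if "d \<in> {0..r}" for d
  proof -
    have r: "of_nat r = (of_nat (r - d) + of_nat d :: 'a)" "r + 1 - d = r - d + 1"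
      using that by (simp_all flip: of_nat_add)
    have "(- 1) ^ d * (E d * x ^ (r - d)) * (E 1 + of_nat r * x) =
      (- 1) ^ d * (E d * E 1 * x ^ (r - d) + of_nat r * (E d * x ^ (r - d + 1)))"
      by (simp add: distrib_left mult.assoc of_nat_left_commute E1x[unfolded One_nat_def] power_commutes)
    also have "\<dots> = (- 1) ^ d * (E d * E 1 * x ^ (r - d) + of_nat (r - d) * (E d * x ^ (r - d + 1)) +
        of_nat d * (E d * x ^ (r - d + 1)))"
      by (simp only: r distrib_right add.assoc)
    finally have eq: "(- 1) ^ d * (E d * x ^ (r - d)) * (E 1 + of_nat r * x) =
      (- 1) ^ d * (E d * E 1 * x ^ (r - d) + of_nat (r - d) * (E d * x ^ (r - d + 1)) +
        of_nat d * (E d * x ^ (r - d + 1)))" .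
    have g: "g d = (- 1) ^ d * (of_nat d * (E d * x ^ (r - d + 1)))"
      "g (Suc d) = - ((- 1) ^ d * (of_nat (d + 1) * (E (d + 1) * x ^ (r - d))))"
      unfolding g_def r(2) by simp_all
    show ?thesis
      unfolding eq g by (simp add: algebra_simps)
  qed
  then have "(\<Sum>d=0..r. (- 1) ^ d * ((E d * E 1 - of_nat (d + 1) * E (d + 1)) * x ^ (r - d) +
      of_nat (r - d) * (E d * x ^ (r - d + 1)))) =
    (\<Sum>d=0..r. (- 1) ^ d * (E d * x ^ (r - d)) * (E 1 + of_nat r * x) + (g (Suc d) - g d))"
    by (intro sum.cong refl)
  also have "\<dots> = (\<Sum>d=0..r. (- 1) ^ d * (E d * x ^ (r - d))) * (E 1 + of_nat r * x) + (g (Suc r) - g 0)"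
    by (simp only: sum.distrib sum_distrib_right sum_Suc_diff[of 0 r g] zero_le)
  finally show ?thesis
    by (simp add: g_def)
qed

text \<open>The polynomial \<open>(x\<^sup>m - y\<^sup>m) / (x - y)\<close>, and its derivative for \<open>x' = x\<^sup>2\<close> and \<open>y' = y\<^sup>2\<close>.\<close>

definition hsum :: "'a::ring_1 \<Rightarrow> 'a \<Rightarrow> nat \<Rightarrow> 'a" where
  "hsum x y m = (\<Sum>a<m. x ^ a * y ^ (m - 1 - a))"

definition dhsum :: "'a::ring_1 \<Rightarrow> 'a \<Rightarrow> nat \<Rightarrow> 'a" where
  "dhsum x y m = (\<Sum>a<m. of_nat a * (x ^ (a + 1) * y ^ (m - 1 - a)) +
    of_nat (m - 1 - a) * (x ^ a * y ^ (m - 1 - a + 1)))"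

lemma hsum_Suc: "hsum x y (Suc m) = hsum x y m * y + x ^ m"
proof -
  have "x ^ a * y ^ (m - a) = x ^ a * y ^ (m - 1 - a) * y" if "a < m" for a
  proof -
    have "m - a = Suc (m - 1 - a)"
      using that by simp
    then show ?thesis
      by (simp only: power_Suc2 mult.assoc)
  qed
  then show ?thesis
    by (simp add: hsum_def sum_distrib_right)
qed

text \<open>The derivative of the recursion \<open>hsum_Suc\<close>: the factor \<open>y\<close>
  contributes \<open>y\<^sup>2\<close> and the last power its multiple by m x.\<close>

lemma dhsum_Suc:
  assumes "x * y = y * x"
  shows "dhsum x y (Suc m) = dhsum x y m * y + hsum x y m * y\<^sup>2 + of_nat m * x ^ (m + 1)"
proof -
  have step: "of_nat a * (x ^ (a + 1) * y ^ (m - a)) + of_nat (m - a) * (x ^ a * y ^ (m - a + 1)) =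
    (of_nat a * (x ^ (a + 1) * y ^ (m - 1 - a)) + of_nat (m - 1 - a) * (x ^ a * y ^ (m - 1 - a + 1))) * y +
    x ^ a * y ^ (m - 1 - a) * y\<^sup>2" if am: "a < m" for a
  proof -
    obtain k where "m = Suc (a + k)"
      using less_imp_Suc_add[OF am] by blast
    moreover have "y ^ k * (y * y) = y * (y * y ^ k)"
      by (metis power_commutes mult.assoc)
    ultimately show ?thesis
      by (simp add: distrib_right mult.assoc power_commutes power2_eq_square add.assoc)
  qed
  have "(\<Sum>a<m. of_nat a * (x ^ (a + 1) * y ^ (m - a)) + of_nat (m - a) * (x ^ a * y ^ (m - a + 1))) =
    dhsum x y m * y + hsum x y m * y\<^sup>2"
    unfolding dhsum_def hsum_def sum_distrib_right sum.distrib[symmetric]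
    by (rule sum.cong[OF refl]) (rule step, simp)
  then show ?thesis
    by (simp add: dhsum_def[of x y "Suc m"])
qed

text \<open>With h = (x^m - y^m) / (x - y), the quotient rule gives d h = m (h y + x^m) - (x + y) h,
  and x h = h y + x^m - y^m removes the factor x. Since x - y need not be invertible, the proof is
  by recursion on m.\<close>

lemma dhsum_eq:
  assumes xy: "x * y = y * x"
  shows "dhsum x y m = (of_nat m - 2) * (hsum x y m * y) + y ^ m + (of_nat m - 1) * x ^ m"
proof (induction m)
  case 0
  show ?case
    by (simp add: dhsum_def hsum_def)
next
  case (Suc m)
  have xm: "x ^ m * y = y * x ^ m"
    by (rule power_commuting_commutes[OF xy])
  show ?case
    unfolding dhsum_Suc[OF xy] Suc hsum_Suc
    by (simp add: algebra_simps power2_eq_square power_commutes mult_2)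
qed

text \<open>This differentiates B = (R(x) - R(y)) / (x - y). From d R(x) = (E(1) + r x) R(x) and d
  (x - y) = (x + y) (x - y) one finds d B = B (E(1) + (r - 2) y) + R(y) + (r - 1) R(x). The proof
  telescopes as in \<open>square_identity\<close>, but no boundary term remains because
  \<open>hsum x y 0 = 0\<close>.\<close>

lemma braid_identity:
  fixes E :: "nat \<Rightarrow> 'a::ring_1" and x y :: 'a
  assumes xy: "x * y = y * x" and Ex: "\<And>d. E d * x = x * E d" and Ey: "\<And>d. E d * y = y * E d"
    and EE: "\<And>d. E d * E 1 = E 1 * E d"
  shows "(\<Sum>d=0..r. (- 1) ^ d * ((E d * E 1 - of_nat (d + 1) * E (d + 1)) * hsum x y (r - d) +
      E d * dhsum x y (r - d))) =
    (\<Sum>d=0..r. (- 1) ^ d * (E d * hsum x y (r - d))) * (E 1 + (of_nat r - 2) * y) +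
    (\<Sum>d=0..r. (- 1) ^ d * (E d * y ^ (r - d))) +
    (of_nat r - 1) * (\<Sum>d=0..r. (- 1) ^ d * (E d * x ^ (r - d)))"
proof -
  define g where "g d = (- 1) ^ d * (of_nat d * (E d * hsum x y (r + 1 - d)))" for d
  have E1h: "E 1 * hsum x y k = hsum x y k * E 1" for k
  proof -
    have "E 1 * (x ^ a * y ^ b) = x ^ a * y ^ b * E 1" for a b
      using power_commuting_commutes[OF Ex[of 1, symmetric], of a]
        power_commuting_commutes[OF Ey[of 1, symmetric], of b]
      by (metis mult.assoc)
    then show ?thesis
      by (simp add: hsum_def sum_distrib_left sum_distrib_right)
  qed
  have "(- 1) ^ d * ((E d * E 1 - of_nat (d + 1) * E (d + 1)) * hsum x y (r - d) + E d * dhsum x y (r - d)) =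
    (- 1) ^ d * (E d * hsum x y (r - d)) * (E 1 + (of_nat r - 2) * y) + (- 1) ^ d * (E d * y ^ (r - d)) +
    (of_nat r - 1) * ((- 1) ^ d * (E d * x ^ (r - d))) + (g (Suc d) - g d)" if "d \<in> {0..r}" for d
  proof -
    have r: "of_nat r = (of_nat (r - d) + of_nat d :: 'a)" "r + 1 - d = Suc (r - d)"
      using that by (simp_all flip: of_nat_add)
    show ?thesis
      unfolding dhsum_eq[OF xy] g_def r hsum_Suc
      by (simp add: algebra_simps of_nat_left_commute E1h[simplified] mult_2)
  qed
  then have "(\<Sum>d=0..r. (- 1) ^ d * ((E d * E 1 - of_nat (d + 1) * E (d + 1)) * hsum x y (r - d) +
      E d * dhsum x y (r - d))) =
    (\<Sum>d=0..r. (- 1) ^ d * (E d * hsum x y (r - d)) * (E 1 + (of_nat r - 2) * y) + (- 1) ^ d * (E d * y ^ (r - d)) +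
    (of_nat r - 1) * ((- 1) ^ d * (E d * x ^ (r - d))) + (g (Suc d) - g d))"
    by (intro sum.cong refl)
  also have "\<dots> = (\<Sum>d=0..r. (- 1) ^ d * (E d * hsum x y (r - d))) * (E 1 + (of_nat r - 2) * y) +
    (\<Sum>d=0..r. (- 1) ^ d * (E d * y ^ (r - d))) +
    (of_nat r - 1) * (\<Sum>d=0..r. (- 1) ^ d * (E d * x ^ (r - d))) + (g (Suc r) - g 0)"
    by (simp only: sum.distrib sum_distrib_right sum_distrib_left sum_Suc_diff[of 0 r g] zero_le)
  finally show ?thesis
    by (simp add: g_def hsum_def)
qed

text \<open>The index of \<open>E\<close> becomes the outer one, which turns the inner sums into the
  polynomials \<open>hsum x y (r - d)\<close>; the outer index r contributes an empty sum.\<close>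

lemma sum_triples:
  fixes f :: "nat \<Rightarrow> nat \<Rightarrow> nat \<Rightarrow> 'a::comm_monoid_add"
  shows "(\<Sum>(a, b, d)\<in>{(a, b, d). a + b + d + 1 = r}. f a b d) = (\<Sum>d=0..r. \<Sum>a<r - d. f a (r - d - 1 - a) d)"
  unfolding sum.Sigma[OF finite_atLeastAtMost ballI[OF finite_lessThan]]
  by (rule sum.reindex_bij_witness[of _ "\<lambda>(d, a). (a, r - d - 1 - a, d)" "\<lambda>(a, b, d). (d, a)"]) auto

text \<open>The prescribed derivative of a crossing with the idempotent stripped off. Between two
  red strands the crossing vanishes, hence the value 0.\<close>

fun cross_val :: "letter \<Rightarrow> letter \<Rightarrow> nat \<Rightarrow> 'k::field free" where
  "cross_val Black Black j = - (xx j * psi j) - psi j * xx (Suc j)"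
| "cross_val (Red r) Black j = of_nat r * (psi j * xx (Suc j))"
| "cross_val Black (Red r) j = psi j * EE 1 (Suc j)"
| "cross_val (Red r) (Red r') j = 0"

declare cross_val.simps [simp del]

context webster
begin

text \<open>The values are prescribed after multiplication by idempotents, but a derivation of the
  free algebra needs them on the generators. For \<open>Elem\<close> one formula serves all strands,
  because the relations kill E(d + 1) where it should be absent; for a crossing the pieces at all
  sequences are added.\<close>

fun gen_val :: "webster_gen \<Rightarrow> 'k free" where
  "gen_val (Idempotent i) = 0"
| "gen_val (Dot j) = xx j * xx j"
| "gen_val (Elem d j) = EE d j * EE 1 j - of_nat (d + 1) * EE (d + 1) j"
| "gen_val (Cross j) = (\<Sum>i\<in>Seq s n. cross_val (entry i j) (entry i (Suc j)) j * ee i)"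

abbreviation d :: "'k free \<Rightarrow> 'k free" where "d \<equiv> deriv gen_val"

abbreviation DP :: "nat \<Rightarrow> 'k free quots" where "DP j \<equiv> q (d (psi j))"

definition DE :: "nat \<Rightarrow> nat \<Rightarrow> 'k free quots" where
  "DE m j = E m j * E 1 j - of_nat (m + 1) * E (m + 1) j"

text \<open>For m = 0 the right hand side is E(1) - E(1) = 0, in accordance with E(0) = 1; sums that
  start at E(0) need no separate first term.\<close>

lemma d_EE: "d (EE m j) = EE m j * EE 1 j - of_nat (m + 1) * EE (m + 1) j"
  by (cases "m = 0") (simp_all add: EE_def deriv_1 deriv_gen)

lemma qd_mult: "q (d (f * g)) = q (d f) * q g + q f * q (d g)"
  by (simp add: deriv_mult q_hom)

lemma qd_add: "q (d (f + g)) = q (d f) + q (d g)" "q (d (f - g)) = q (d f) - q (d g)"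
  "q (d (- f)) = - q (d f)" "q (d 0) = 0" "q (d 1) = 0" "q (d (sum F S)) = (\<Sum>a\<in>S. q (d (F a)))"
  by (simp_all add: deriv_add deriv_diff deriv_minus deriv_sum deriv_1 deriv_0 q_hom)

lemma qd_gen: "q (d (ee i)) = 0" "q (d (xx j)) = xq j * xq j" "q (d (EE m j) * f) = DE m j * q f"
  "q (d (EE m j)) = DE m j"
proof -
  show "q (d (ee i)) = 0" "q (d (xx j)) = xq j * xq j"
    by (simp_all add: deriv_gen q_hom)
  show "q (d (EE m j) * f) = DE m j * q f"
    by (simp only: d_EE DE_def left_diff_distrib mult.assoc q_hom(2) q_of_nat q_EE(1))
  show "q (d (EE m j)) = DE m j"
    by (simp only: d_EE DE_def q_hom(2) q_of_nat q_EE(1)) (simp add: q_EE(2))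
qed

lemma qd_neg_power: "q (d ((- 1) ^ k * f)) = (- 1) ^ k * q (d f)"
  by (induction k arbitrary: f) (simp_all add: deriv_minus q_hom)

lemma qd_xx_power: "q (d (xx j ^ k * f)) = of_nat k * (xq j ^ (k + 1) * q f) + xq j ^ k * q (d f)"
proof (induction k)
  case (Suc k)
  have "q (d (xx j ^ Suc k * f)) = xq j * xq j * q (xx j ^ k * f) + xq j * q (d (xx j ^ k * f))"
    by (simp add: mult.assoc qd_mult qd_gen)
  then show ?case
    by (simp add: Suc q_xx_power of_nat_left_commute algebra_simps)
qed simp

lemma qd_EE: "q (d (EE m j * f)) = DE m j * q f + E m j * q (d f)"
  by (simp add: deriv_mult q_hom(1) q_EE qd_gen(3))

lemma q_cross_val:
  "q (cross_val Black Black j) = - (xq j * P j) - P j * xq (Suc j)"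
  "q (cross_val (Red r) Black j) = of_nat r * (P j * xq (Suc j))"
  "q (cross_val Black (Red r) j) = P j * E 1 (Suc j)"
  "q (cross_val (Red r) (Red r') j) = 0"
  by (simp_all only: cross_val.simps q_of_nat) (simp_all add: q_hom q_EE)

lemma DP_loc:
  assumes "loc z i" "crs j"
  shows "DP j * z = q (cross_val (entry i j) (entry i (Suc j)) j) * z"
proof -
  have "DP j * z = (\<Sum>i'\<in>Seq s n. q (cross_val (entry i' j) (entry i' (Suc j)) j) * (e i' * z))"
    by (simp add: deriv_gen q_hom sum_distrib_right mult.assoc)
  also have "\<dots> = (\<Sum>i'\<in>Seq s n. if i' = i then q (cross_val (entry i' j) (entry i' (Suc j)) j) * z else 0)"
    using e_loc[OF assms(1)] by (intro sum.cong) auto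
  finally show ?thesis
    using loc_Seq[OF assms(1)] by (simp add: finite_Seq sum.delta)
qed

lemma DP_bb: "loc z i \<Longrightarrow> crs j \<Longrightarrow> entry i j = Black \<Longrightarrow> entry i (Suc j) = Black \<Longrightarrow>
    DP j * z = - (xq j * (P j * z)) - P j * (xq (Suc j) * z)"
  by (simp add: DP_loc q_cross_val left_diff_distrib mult.assoc)

lemma DP_rb: "loc z i \<Longrightarrow> crs j \<Longrightarrow> entry i j = Red r \<Longrightarrow> entry i (Suc j) = Black \<Longrightarrow>
    DP j * z = of_nat r * (P j * (xq (Suc j) * z))"
  by (simp add: DP_loc q_cross_val mult.assoc)

lemma DP_br: "loc z i \<Longrightarrow> crs j \<Longrightarrow> entry i j = Black \<Longrightarrow> entry i (Suc j) = Red r \<Longrightarrow>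
    DP j * z = P j * (E 1 (Suc j) * z)"
  by (simp add: DP_loc q_cross_val mult.assoc)

lemma DP_rr: "loc z i \<Longrightarrow> crs j \<Longrightarrow> entry i j = Red r \<Longrightarrow> entry i (Suc j) = Red r' \<Longrightarrow> DP j * z = 0"
  by (simp add: DP_loc q_cross_val)

section \<open>Commutation relations under the differential\<close>

lemma loc_of_nat: "loc z i \<Longrightarrow> loc (of_nat k * z) i"
  by (metis loc_mult mult_of_nat_commute)

text \<open>Shared by \<open>P j\<close> and \<open>DP j\<close>. Arguments about starting sequences
  therefore apply equally to a word and to the same word with one crossing differentiated.\<close>

definition moves :: "nat \<Rightarrow> 'k free quots \<Rightarrow> bool" where
  "moves j a \<longleftrightarrow> (\<forall>z i. loc z i \<longrightarrow>
    (if entry i j \<noteq> Black \<and> entry i (Suc j) \<noteq> Black then a * z = 0 else loc (a * z) (swap j i)))"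

lemma swap_Seq': "loc z i \<Longrightarrow> crs j \<Longrightarrow> entry i j = Black \<or> entry i (Suc j) = Black \<Longrightarrow> swap j i \<in> Seq s n"
  using swap_Seq[OF loc_Seq] loc_length by simp

lemma moves_P: "crs j \<Longrightarrow> moves j (P j)"
  unfolding moves_def
proof (intro allI impI)
  fix z i assume j: "crs j" and z: "loc z i"
  show "if entry i j \<noteq> Black \<and> entry i (Suc j) \<noteq> Black then P j * z = 0 else loc (P j * z) (swap j i)"
    using psi_red_red[OF z j] loc_P[OF z j swap_Seq'[OF z j]]
    by (cases "entry i j"; cases "entry i (Suc j)") auto
qed

lemma moves_DP: "crs j \<Longrightarrow> moves j (DP j)"
  unfolding moves_def
proof (intro allI impI)
  fix z i assume j: "crs j" and z: "loc z i"
  then have pos: "pos j" "pos (Suc j)"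
    by auto
  have P: "loc w i \<Longrightarrow> loc (P j * w) (swap j i)" if "entry i j = Black \<or> entry i (Suc j) = Black" for w
    using loc_P swap_Seq' j that by blast
  show "if entry i j \<noteq> Black \<and> entry i (Suc j) \<noteq> Black then DP j * z = 0 else loc (DP j * z) (swap j i)"
    using DP_rr[OF z j] DP_bb[OF z j] DP_rb[OF z j] DP_br[OF z j] z j pos
    by (cases "entry i j"; cases "entry i (Suc j)") (auto intro!: loc_add loc_of_nat loc_X loc_E P)
qed

lemma moves_loc: "moves j a \<Longrightarrow> loc z i \<Longrightarrow> entry i j = Black \<or> entry i (Suc j) = Black \<Longrightarrow> loc (a * z) (swap j i)"
  unfolding moves_def by (metis)

lemma moves_zero: "moves j a \<Longrightarrow> loc z i \<Longrightarrow> entry i j \<noteq> Black \<Longrightarrow> entry i (Suc j) \<noteq> Black \<Longrightarrow> a * z = 0"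
  unfolding moves_def by metis

definition cm :: "'k free quots \<Rightarrow> 'k free quots \<Rightarrow> bool" where "cm a b \<longleftrightarrow> a * b = b * a"

lemma cm_intros:
  "cm a c \<Longrightarrow> cm b c \<Longrightarrow> cm (a * b) c" "cm a c \<Longrightarrow> cm b c \<Longrightarrow> cm (a + b) c"
  "cm a c \<Longrightarrow> cm b c \<Longrightarrow> cm (a - b) c" "cm a c \<Longrightarrow> cm (- a) c" "cm (of_nat k) c" "cm 0 c"
  unfolding cm_def
  by (metis mult.assoc) (simp_all add: algebra_simps mult_of_nat_commute)

lemma cm_sym: "cm a b \<Longrightarrow> cm b a"
  by (simp add: cm_def)

lemma cm_DE: "(\<And>m. cm (E m j) b) \<Longrightarrow> cm (DE m j) b"
  unfolding DE_def by (intro cm_intros) auto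

lemma cm_check: "cm (q (d f)) (q g) \<Longrightarrow> cm (q f) (q (d g)) \<Longrightarrow> q (d (f * g - g * f)) = 0"
  by (simp add: qd_add qd_mult cm_def)

lemma cm_cross_val:
  assumes "cm (xq j) b" "cm (xq (Suc j)) b" "cm (P j) b" "cm (E 1 (Suc j)) b"
  shows "cm (q (cross_val a a' j)) b"
  by (cases "(a, a', j)" rule: cross_val.cases)
    (use assms in \<open>auto simp: q_cross_val intro!: cm_intros\<close>)

lemma eq_on_e_cm: "(\<And>i. i \<in> Seq s n \<Longrightarrow> q f * (q g * e i) = q g * (q f * e i)) \<Longrightarrow> cm (q f) (q g)"
  using eq_on_e[of "f * g" "g * f"] by (simp add: cm_def q_hom mult.assoc)

text \<open>\<open>DP j\<close> is given by a different formula at each pair of colours. An element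
  that preserves the colours at \<open>j\<close> and \<open>j + 1\<close> meets the same formula on
  both sides, so it suffices that it commutes with all building blocks of
  \<open>cross_val\<close>.\<close>

lemma cm_DP:
  assumes j: "crs j" and b: "cm (xq j) (q g)" "cm (xq (Suc j)) (q g)" "cm (P j) (q g)" "cm (E 1 (Suc j)) (q g)"
    and loc: "\<And>i. i \<in> Seq s n \<Longrightarrow> q g * e i = 0 \<or>
      (\<exists>i'. loc (q g * e i) i' \<and> entry i' j = entry i j \<and> entry i' (Suc j) = entry i (Suc j))"
  shows "cm (DP j) (q g)"
proof (rule eq_on_e_cm)
  fix i assume i: "i \<in> Seq s n"
  let ?v = "q (cross_val (entry i j) (entry i (Suc j)) j)"
  have "DP j * (q g * e i) = ?v * (q g * e i)"
    using loc[OF i] DP_loc j by (metis mult_zero_right)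
  also have "\<dots> = q g * (?v * e i)"
    using cm_cross_val[OF b, of "entry i j" "entry i (Suc j)"] by (simp add: cm_def flip: mult.assoc)
  also have "?v * e i = DP j * e i"
    using DP_loc[OF loc_e[OF i] j] by simp
  finally show "DP j * (q g * e i) = q g * (DP j * e i)" .
qed

lemma cm_basic:
  "pos j \<Longrightarrow> pos l \<Longrightarrow> cm (xq j) (xq l)" "pos j \<Longrightarrow> pos l \<Longrightarrow> cm (E m j) (xq l)"
  "pos j \<Longrightarrow> pos l \<Longrightarrow> cm (xq l) (E m j)" "pos j \<Longrightarrow> pos l \<Longrightarrow> cm (E m j) (E m' l)"
  "crs j \<Longrightarrow> pos l \<Longrightarrow> l \<noteq> j \<Longrightarrow> l \<noteq> Suc j \<Longrightarrow> cm (P j) (xq l)"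
  "crs j \<Longrightarrow> pos l \<Longrightarrow> l \<noteq> j \<Longrightarrow> l \<noteq> Suc j \<Longrightarrow> cm (P j) (E m l)"
  "crs j \<Longrightarrow> crs l \<Longrightarrow> 1 < \<bar>int j - int l\<bar> \<Longrightarrow> cm (P j) (P l)"
  unfolding cm_def by (simp_all add: x_x E_x E_E psi_x psi_E psi_psi_far)

lemma check_psi_x:
  assumes "crs j" "pos l" "l \<noteq> j" "l \<noteq> Suc j"
  shows "q (d (psi j * xx l - xx l * psi j)) = 0"
proof (rule cm_check)
  show "cm (DP j) (xq l)"
    by (rule cm_DP) (use assms in \<open>auto intro!: cm_basic loc_X loc_e\<close>)
  show "cm (P j) (q (d (xx l)))"
    unfolding qd_gen by (intro cm_sym[OF cm_intros(1)] cm_sym[OF cm_basic(5)] assms)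
qed

lemma check_psi_E:
  assumes "crs j" "pos l" "l \<noteq> j" "l \<noteq> Suc j" "1 \<le> m"
  shows "q (d (psi j * EE m l - EE m l * psi j)) = 0"
proof (rule cm_check)
  have E: "q (EE m l) = E m l"
    using assms by (simp add: q_EE)
  show "cm (DP j) (q (EE m l))"
    by (rule cm_DP) (use assms in \<open>auto simp: E intro!: cm_basic loc_E loc_e\<close>)
  show "cm (P j) (q (d (EE m l)))"
    using assms by (simp add: qd_gen) (intro cm_sym[OF cm_DE] cm_sym[OF cm_basic(6)], auto)
qed

lemma check_psi_psi_far:
  assumes "crs j" "crs l" "1 < \<bar>int j - int l\<bar>"
  shows "q (d (psi j * psi l - psi l * psi j)) = 0"
proof (rule cm_check)
  have DP: "cm (DP j) (P l)" if "crs j" "crs l" "1 < \<bar>int j - int l\<bar>" for j l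
  proof (rule cm_DP[OF \<open>crs j\<close>])
    fix i assume i: "i \<in> Seq s n"
    show "P l * e i = 0 \<or>
      (\<exists>i'. loc (P l * e i) i' \<and> entry i' j = entry i j \<and> entry i' (Suc j) = entry i (Suc j))"
    proof (cases "entry i l = Black \<or> entry i (Suc l) = Black")
      case True
      have "loc (P l * e i) (swap l i)"
        using moves_loc[OF moves_P loc_e[OF i] True] that by simp
      moreover have "entry (swap l i) j = entry i j" "entry (swap l i) (Suc j) = entry i (Suc j)"
        using that length_Seq[OF i] by (auto intro!: entry_swap)
      ultimately show ?thesis
        by blast
    next
      case False
      then show ?thesis
        using moves_zero[OF moves_P loc_e[OF i]] that by blast
    qed
  qed (use that in \<open>auto intro!: cm_basic cm_sym[OF cm_basic(5)] cm_sym[OF cm_basic(6)]\<close>)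
  show "cm (DP j) (P l)" "cm (P j) (DP l)"
    using DP[OF assms] DP[of l j] assms by (auto intro: cm_sym)
qed

text \<open>On sequences with two red strands at \<open>j\<close> both sides are zero, even if equal
  labels make \<open>swap j i\<close> a valid sequence. Elsewhere \<open>DP j\<close> moves
  idempotents just as \<open>P j\<close> does, and \<open>swap j\<close> is an involution.\<close>

lemma check_psi_e:
  assumes i: "i \<in> Seq s n" and j: "crs j"
  shows "q (d (psi j * ee i - ee0 s n (swap j i) * psi j)) = 0"
proof -
  have len: "length i = length s + n"
    using length_Seq[OF i] .
  have d0: "d (ee0 s n k) = 0" for k
    by (simp add: ee0_def deriv_gen deriv_0)
  have "q (d (psi j) * ee i) = q (ee0 s n (swap j i) * d (psi j))"
  proof (rule eq_on_e)
    fix i' assume i': "i' \<in> Seq s n"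
    note z = loc_e[OF i']
    have len': "length i' = length s + n"
      using length_Seq[OF i'] .
    have "q (ee0 s n (swap j i)) * (DP j * e i') = (if i = i' then DP j * e i' else 0)"
    proof (cases "entry i' j = Black \<or> entry i' (Suc j) = Black")
      case True
      have l: "loc (DP j * e i') (swap j i')"
        by (rule moves_loc[OF moves_DP[OF j] z True])
      moreover have "swap j i = swap j i' \<longleftrightarrow> i = i'"
        by (metis entry_swap(4) j len len')
      ultimately show ?thesis
        using e_loc[OF l, of "swap j i"] loc_Seq[OF l] by (auto simp: ee0_def q_hom)
    next
      case False
      then have "DP j * e i' = 0"
        using moves_zero[OF moves_DP[OF j] z] by blast
      then show ?thesis
        by simp
    qed
    moreover have "DP j * (e i * e i') = (if i = i' then DP j * e i' else 0)"
      using e_e[OF i i'] by simp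
    ultimately show "q (d (psi j) * ee i) * e i' = q (ee0 s n (swap j i) * d (psi j)) * e i'"
      by (simp add: q_hom mult.assoc)
  qed
  then show ?thesis
    by (simp add: deriv_diff deriv_mult d0 deriv_gen q_hom)
qed

text \<open>Commutation rules in right-nested form. They serve rewriting to a normal form with the
  crossings on the left and the dots and E(m) on the right.\<close>

lemma tails:
  "pos j \<Longrightarrow> pos l \<Longrightarrow> xq j * (xq l * z) = xq l * (xq j * z)"
  "pos j \<Longrightarrow> pos l \<Longrightarrow> E m j * (xq l * z) = xq l * (E m j * z)"
  "pos j \<Longrightarrow> pos l \<Longrightarrow> E m j * (E m' l * z) = E m' l * (E m j * z)"
  "crs j \<Longrightarrow> pos l \<Longrightarrow> l \<noteq> j \<Longrightarrow> l \<noteq> Suc j \<Longrightarrow> xq l * (P j * z) = P j * (xq l * z)"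
  "crs j \<Longrightarrow> pos l \<Longrightarrow> l \<noteq> j \<Longrightarrow> l \<noteq> Suc j \<Longrightarrow> E m l * (P j * z) = P j * (E m l * z)"
  "crs j \<Longrightarrow> E m (Suc j) * (P j * z) = P j * (E m j * z)"
  "crs j \<Longrightarrow> E m j * (P j * z) = P j * (E m (Suc j) * z)"
  by (simp_all only: simp_thms mult.assoc[symmetric] x_x[of j l] E_x[of j l] E_E[of j l] psi_x[of j l, symmetric]
      psi_E[of j l, symmetric] psi_E_left[of j, symmetric] psi_E_right[of j])

lemma psi_DE:
  assumes "crs j"
  shows "P j * DE m j = DE m (Suc j) * P j" "DE m j * P j = P j * DE m (Suc j)"
proof -
  show "P j * DE m j = DE m (Suc j) * P j"
    using assms by (simp add: DE_def right_diff_distrib left_diff_distrib of_nat_left_commute mult.assoc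
        psi_E_left[symmetric] tails(6)
        del: of_nat_Suc of_nat_add)
  show "DE m j * P j = P j * DE m (Suc j)"
    using assms by (simp add: DE_def right_diff_distrib left_diff_distrib of_nat_left_commute mult.assoc
        psi_E_right tails(7) del: of_nat_Suc of_nat_add)
qed

lemma check_psi_E_left:
  assumes j: "crs j" and m: "1 \<le> m"
  shows "q (d (psi j * EE m j - EE m (Suc j) * psi j)) = 0"
proof -
  have E: "q (EE m l) = E m l" for l
    using m by (simp add: q_EE)
  have "q (d (psi j) * EE m j) = q (EE m (Suc j) * d (psi j))"
  proof (rule eq_on_e)
    fix i assume i: "i \<in> Seq s n"
    note z = loc_e[OF i]
    have pos: "pos j" "pos (Suc j)"
      using j by auto
    note zE = loc_E[OF z pos(1), of m]
    have l: "loc (DP j * e i) (swap j i)" if "entry i j = Black \<or> entry i (Suc j) = Black"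
      by (rule moves_loc[OF moves_DP[OF j] z that])
    have sw: "entry (swap j i) (Suc j) = entry i j"
      using entry_swap(2)[of j i] j length_Seq[OF i] by simp
    have "DP j * (E m j * e i) = E m (Suc j) * (DP j * e i)"
    proof (cases "entry i j")
      case Black
      then show ?thesis
        using E_black[OF z pos(1) _ m] E_black[OF l pos(2) _ m] sw by simp
    next
      case r: (Red r)
      show ?thesis
        using DP_rr[OF z j r] DP_rr[OF zE j r] DP_rb[OF z j r] DP_rb[OF zE j r] pos
        by (cases "entry i (Suc j)")
          (simp_all add: of_nat_left_commute tails(2)[of "Suc j" "Suc j"] tails(2)[of j "Suc j"] tails(6)[OF j])
    qed
    then show "q (d (psi j) * EE m j) * e i = q (EE m (Suc j) * d (psi j)) * e i"
      by (simp add: q_hom E mult.assoc)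
  qed
  then have "DP j * E m j = E m (Suc j) * DP j"
    by (simp add: q_hom E)
  then show ?thesis
    by (simp add: qd_add qd_mult qd_gen E psi_DE[OF j])
qed

lemma check_psi_E_right:
  assumes j: "crs j" and m: "1 \<le> m"
  shows "q (d (EE m j * psi j - psi j * EE m (Suc j))) = 0"
proof -
  have E: "q (EE m l) = E m l" for l
    using m by (simp add: q_EE)
  have "q (EE m j * d (psi j)) = q (d (psi j) * EE m (Suc j))"
  proof (rule eq_on_e)
    fix i assume i: "i \<in> Seq s n"
    note z = loc_e[OF i]
    have pos: "pos j" "pos (Suc j)"
      using j by auto
    note zE = loc_E[OF z pos(2), of m]
    have l: "loc (DP j * e i) (swap j i)" if "entry i j = Black \<or> entry i (Suc j) = Black"
      by (rule moves_loc[OF moves_DP[OF j] z that])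
    have sw: "entry (swap j i) j = entry i (Suc j)"
      using entry_swap(1)[of j i] j length_Seq[OF i] by simp
    have "E m j * (DP j * e i) = DP j * (E m (Suc j) * e i)"
    proof (cases "entry i (Suc j)")
      case Black
      then show ?thesis
        using E_black[OF z pos(2) _ m] E_black[OF l pos(1) _ m] sw by simp
    next
      case r: (Red r)
      show ?thesis
        using DP_rr[OF z j _ r] DP_rr[OF zE j _ r] DP_br[OF z j _ r] DP_br[OF zE j _ r] pos
        by (cases "entry i j") (simp_all add: tails(3)[of "Suc j" "Suc j" m] tails(7)[OF j])
    qed
    then show "q (EE m j * d (psi j)) * e i = q (d (psi j) * EE m (Suc j)) * e i"
      by (simp add: q_hom E mult.assoc)
  qed
  then have "E m j * DP j = DP j * E m (Suc j)"
    by (simp add: q_hom E)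
  then show ?thesis
    by (simp add: qd_add qd_mult qd_gen E psi_DE[OF j])
qed

lemma check_x_psi_bb:
  assumes i: "i \<in> Seq s n" and j: "crs j" and b: "entry i j = Black" "entry i (Suc j) = Black"
  shows "q (d (xx j * psi j * ee i - psi j * xx (Suc j) * ee i - ee i)) = 0"
    "q (d (psi j * xx j * ee i - xx (Suc j) * psi j * ee i - ee i)) = 0"
proof -
  note z = loc_e[OF i]
  have pos: "pos j" "pos (Suc j)"
    using j by auto
  note rules = qd_add qd_mult qd_gen mult.assoc q_hom(4) DP_bb[OF _ j b] x_psi_bb[OF _ j b]
    psi_x_bb[OF _ j b] z loc_P_same[OF _ j b] tails(1)[OF pos(2,1)] loc_X[OF _ pos(1)] loc_X[OF _ pos(2)]
  show "q (d (xx j * psi j * ee i - psi j * xx (Suc j) * ee i - ee i)) = 0"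
    by (simp add: rules distrib_left right_diff_distrib)
  show "q (d (psi j * xx j * ee i - xx (Suc j) * psi j * ee i - ee i)) = 0"
    by (simp add: rules distrib_left right_diff_distrib)
qed

lemma check_x_psi_rb:
  assumes i: "i \<in> Seq s n" and j: "crs j" and b: "entry i j = Red r" "entry i (Suc j) = Black"
  shows "q (d (xx j * psi j * ee i - psi j * xx (Suc j) * ee i)) = 0"
proof -
  note z = loc_e[OF i]
  have pos: "pos j" "pos (Suc j)"
    using j by auto
  show ?thesis
    by (simp add: qd_add qd_mult qd_gen mult.assoc q_hom(4) DP_rb[OF _ j b] x_psi_rb[OF _ j b] z of_nat_left_commute
        loc_X[OF _ pos(2)])
qed

lemma check_psi_x_br:
  assumes i: "i \<in> Seq s n" and j: "crs j" and b: "entry i j = Black" "entry i (Suc j) = Red r"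
  shows "q (d (psi j * xx j * ee i - xx (Suc j) * psi j * ee i)) = 0"
proof -
  note z = loc_e[OF i]
  have pos: "pos j" "pos (Suc j)"
    using j by auto
  show ?thesis
    using pos
    by (simp add: qd_add qd_mult qd_gen mult.assoc q_hom(4) DP_br[OF _ j b] psi_x_br[OF _ j b] z
        loc_X[OF _ pos(1)] loc_E[OF _ pos(2)] tails(2)[OF pos(2,1)])
qed

section \<open>Squares of crossings\<close>

lemma check_psi_sq_bb:
  assumes i: "i \<in> Seq s n" and j: "crs j" and b: "entry i j = Black" "entry i (Suc j) = Black"
  shows "q (d (psi j ^ 2 * ee i)) = 0"
proof -
  note z = loc_e[OF i]
  have pos: "pos j" "pos (Suc j)"
    using j by auto
  show ?thesis
    by (simp add: power2_eq_square qd_add qd_mult qd_gen mult.assoc q_hom(4) DP_bb[OF _ j b]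
        x_psi_bb[OF _ j b] psi_x_bb[OF _ j b] psi_sq_bb[OF _ j b] z loc_P_same[OF _ j b]
        loc_X[OF _ pos(1)] loc_X[OF _ pos(2)] distrib_left right_diff_distrib)
qed

lemma xq_power_E: "pos j \<Longrightarrow> pos l \<Longrightarrow> xq l ^ k * (E m j * z) = E m j * (xq l ^ k * z)"
  using power_commuting_commutes[OF E_x[of j l m, symmetric], of k] by (simp flip: mult.assoc)

lemma qd_square_term:
  "q (d ((- 1) ^ a * EE m j * xx l ^ k * ee i)) =
    (- 1) ^ a * (DE m j * xq l ^ k + of_nat k * (E m j * xq l ^ (k + 1))) * e i"
proof -
  show ?thesis
    by (simp only: mult.assoc qd_neg_power qd_EE qd_xx_power q_xx_power qd_gen)
      (simp add: distrib_right mult.assoc of_nat_left_commute)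
qed

lemma qd_square_term':
  assumes "pos j" "pos l"
  shows "q (d ((- 1) ^ a * xx l ^ k * EE m j * ee i)) =
    (- 1) ^ a * (DE m j * xq l ^ k + of_nat k * (E m j * xq l ^ (k + 1))) * e i"
proof -
  have "cm (DE m j) (xq l)"
    using assms by (intro cm_DE cm_basic)
  then have DE: "xq l ^ k * (DE m j * z) = DE m j * (xq l ^ k * z)" for z
    using power_commuting_commutes[of "xq l" "DE m j" k] by (simp add: cm_def flip: mult.assoc)
  have E: "xq l * (xq l ^ k * (E m j * z)) = E m j * (xq l * (xq l ^ k * z))" for z
    using xq_power_E[OF assms, of "Suc k"] by (simp add: mult.assoc)
  show ?thesis
    by (simp only: mult.assoc qd_neg_power qd_xx_power q_EE(1) qd_EE qd_gen)
      (simp add: distrib_right mult.assoc of_nat_left_commute DE E add.commute)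
qed

text \<open>The polynomial R of the red strand \<open>j\<close>, evaluated at the dot of the black
  strand \<open>l\<close>.\<close>

definition sq :: "nat \<Rightarrow> nat \<Rightarrow> nat \<Rightarrow> 'k free quots" where
  "sq r j l = (\<Sum>m=0..r. (- 1) ^ m * (E m j * xq l ^ (r - m)))"

lemma P_P_rb: "loc z i \<Longrightarrow> crs j \<Longrightarrow> entry i j = Red r \<Longrightarrow> entry i (Suc j) = Black \<Longrightarrow>
    P j * (P j * z) = sq r j (Suc j) * z"
  by (simp add: psi_sq_rb sq_def sum_distrib_right mult.assoc)

lemma P_P_br: "loc z i \<Longrightarrow> crs j \<Longrightarrow> entry i j = Black \<Longrightarrow> entry i (Suc j) = Red r \<Longrightarrow>
    P j * (P j * z) = sq r (Suc j) j * z"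
  by (simp add: psi_sq_br sq_def sum_distrib_right mult.assoc xq_power_E)

lemma deriv_sq:
  assumes "pos j" "pos l" "loc z i" "entry i j = Red r"
  shows "(\<Sum>m=0..r. (- 1) ^ m * (DE m j * xq l ^ (r - m) + of_nat (r - m) * (E m j * xq l ^ (r - m + 1))) * z) =
    sq r j l * (E 1 j * z + of_nat r * (xq l * z))"
proof -
  have "(\<Sum>m=0..r. (- 1) ^ m * (DE m j * xq l ^ (r - m) + of_nat (r - m) * (E m j * xq l ^ (r - m + 1))) * z) =
    (sq r j l * (E 1 j + of_nat r * xq l) + (- 1) ^ (r + 1) * (of_nat (r + 1) * E (r + 1) j)) * z"
    unfolding sum_distrib_right[symmetric] DE_def sq_def
    by (subst square_identity) (simp_all only: E_x[OF assms(1,2)] E_E[OF assms(1,1), of _ 1])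
  \<comment> \<open>The boundary term of \<open>square_identity\<close> vanishes because a red
    strand labelled r has no E(r + 1).\<close>
  moreover have "E (r + 1) j * z = 0"
    using E_large[OF assms(3,1,4), of "r + 1"] by simp
  ultimately show ?thesis
    by (simp add: distrib_right distrib_left left_diff_distrib mult.assoc)
qed

text \<open>The two crossings have opposite colour patterns: the one applied first contributes r x,
  the other one E(1). Their sum is exactly the factor in d R(x).\<close>

lemma check_psi_sq_rb:
  assumes i: "i \<in> Seq s n" and j: "crs j" and b: "entry i j = Red r" "entry i (Suc j) = Black"
  shows "q (d (psi j ^ 2 * ee i - (\<Sum>m=0..r. (- 1) ^ m * EE m j * xx (Suc j) ^ (r - m) * ee i))) = 0"
proof -
  note z = loc_e[OF i]
  have pos: "pos j" "pos (Suc j)"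
    using j by auto
  have sw: "entry (swap j i) j = Black" "entry (swap j i) (Suc j) = Red r"
    using entry_swap[of j i] j b length_Seq[OF i] by auto
  have l: "loc (P j * e i) (swap j i)"
    using moves_loc[OF moves_P[OF j] z] b by simp
  have "DP j * (P j * e i) + P j * (DP j * e i) = sq r j (Suc j) * (E 1 j * e i + of_nat r * (xq (Suc j) * e i))"
    by (simp add: DP_br[OF l j sw] DP_rb[OF z j b] of_nat_left_commute tails(6)[OF j] P_P_rb[OF _ j b] loc_X[OF z pos(2)]
        loc_E[OF z pos(1)] distrib_left)
  moreover have "q (d (psi j ^ 2 * ee i)) = DP j * (P j * e i) + P j * (DP j * e i)"
    by (simp add: power2_eq_square qd_mult qd_gen q_hom mult.assoc)
  ultimately show ?thesis
    using deriv_sq[OF pos z b(1)] by (simp only: qd_add qd_square_term) simp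
qed

lemma check_psi_sq_br:
  assumes i: "i \<in> Seq s n" and j: "crs j" and b: "entry i j = Black" "entry i (Suc j) = Red r"
  shows "q (d (psi j ^ 2 * ee i - (\<Sum>m=0..r. (- 1) ^ m * xx j ^ (r - m) * EE m (Suc j) * ee i))) = 0"
proof -
  note z = loc_e[OF i]
  have pos: "pos j" "pos (Suc j)"
    using j by auto
  have sw: "entry (swap j i) j = Red r" "entry (swap j i) (Suc j) = Black"
    using entry_swap[of j i] j b length_Seq[OF i] by auto
  have l: "loc (P j * e i) (swap j i)"
    using moves_loc[OF moves_P[OF j] z] b by simp
  have "DP j * (P j * e i) + P j * (DP j * e i) = sq r (Suc j) j * (E 1 (Suc j) * e i + of_nat r * (xq j * e i))"
    by (simp add: DP_rb[OF l j sw] DP_br[OF z j b] of_nat_left_commute psi_x_br[OF z j b] P_P_br[OF _ j b] loc_X[OF z pos(1)]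
        loc_E[OF z pos(2)] distrib_left)
  moreover have "q (d (psi j ^ 2 * ee i)) = DP j * (P j * e i) + P j * (DP j * e i)"
    by (simp add: power2_eq_square qd_mult qd_gen q_hom mult.assoc)
  ultimately show ?thesis
    using deriv_sq[OF pos(2,1) z b(2)] by (simp only: qd_add qd_square_term'[OF pos(2,1)]) simp
qed

section \<open>The braid relations\<close>

definition dbraid :: "nat \<Rightarrow> nat \<Rightarrow> 'k free quots \<Rightarrow> 'k free quots" where
  "dbraid j k z = DP j * (P k * (P j * z)) + P j * (DP k * (P j * z)) + P j * (P k * (DP j * z))"

lemma qd_braid:
  "q (d ((psi j * psi k * psi j - psi k * psi j * psi k) * ee i)) = dbraid j k (e i) - dbraid k j (e i)"
  by (simp add: dbraid_def left_diff_distrib mult.assoc qd_add qd_mult qd_gen q_hom distrib_left)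

text \<open>Write k for \<open>Suc j\<close>. Once the dots are moved to the right, both sides
  become the braid word times -2 x_k - 4 x_(k+1), minus the two products \<open>P j * P k\<close>
  and \<open>P k * P j\<close>; the squares that occur vanish.\<close>

lemma dbraid_bbb:
  assumes z: "loc z i" and j: "crs j" and k: "crs (Suc j)"
    and b: "entry i j = Black" "entry i (Suc j) = Black" "entry i (Suc (Suc j)) = Black"
  shows "dbraid j (Suc j) z = dbraid (Suc j) j z"
proof -
  have pos: "pos j" "pos (Suc j)" "pos (Suc (Suc j))"
    using j k by auto
  have braid: "P j * (P (Suc j) * (P j * w)) = P (Suc j) * (P j * (P (Suc j) * w))" if "loc w i" for w
    using braid[OF that] j k b by simp
  show ?thesis
    unfolding dbraid_def
    by (simp add: DP_bb[OF _ j b(1,2)] DP_bb[OF _ k b(2,3)] x_psi_bb[OF _ j b(1,2)] x_psi_bb[OF _ k b(2,3)]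
        psi_x_bb[OF _ j b(1,2)] psi_x_bb[OF _ k b(2,3)] psi_sq_bb[OF _ j b(1,2)] psi_sq_bb[OF _ k b(2,3)]
        tails(4)[OF j pos(3)] tails(4)[OF k pos(1)] z loc_P_same[OF _ j b(1,2)] loc_P_same[OF _ k b(2,3)]
        loc_X[OF _ pos(1)] loc_X[OF _ pos(2)] loc_X[OF _ pos(3)] braid
        distrib_left right_diff_distrib loc_add)
qed

lemma dbraid_bbr:
  assumes z: "loc z i" and j: "crs j" and k: "crs (Suc j)"
    and b: "entry i j = Black" "entry i (Suc j) = Black" "entry i (Suc (Suc j)) = Red r"
  shows "dbraid j (Suc j) z = dbraid (Suc j) j z"
proof -
  have pos: "pos j" "pos (Suc j)" "pos (Suc (Suc j))"
    using j k by auto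
  \<comment> \<open>The red strand travels left, from \<open>i\<close> through \<open>i1\<close> to
    \<open>i2\<close>. In one braid word the two black strands cross before it passes them, in the
    other one afterwards.\<close>
  define i1 where "i1 = swap (Suc j) i"
  define i2 where "i2 = swap j i1"
  have len: "length i = length s + n"
    using loc_length[OF z] .
  have b1: "entry i1 j = Black" "entry i1 (Suc j) = Red r" "entry i1 (Suc (Suc j)) = Black"
    unfolding i1_def using entry_swap[of "Suc j" i] b j k len by auto
  have b2: "entry i2 j = Red r" "entry i2 (Suc j) = Black" "entry i2 (Suc (Suc j)) = Black"
    unfolding i2_def using entry_swap[of j i1] b1 j k len by (auto simp: i1_def)
  have l1: "loc (P (Suc j) * w) i1" if "loc w i" for w
    unfolding i1_def using moves_loc[OF moves_P[OF k] that] b by simp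
  have l2: "loc (P j * w) i2" if "loc w i1" for w
    unfolding i2_def using moves_loc[OF moves_P[OF j] that] b1 by simp
  have braid: "P j * (P (Suc j) * (P j * w)) = P (Suc j) * (P j * (P (Suc j) * w))" if "loc w i" for w
    using braid[OF that] j k b by simp
  show ?thesis
    unfolding dbraid_def
    by (simp add: DP_bb[OF _ j b(1,2)] DP_br[OF _ k b(2,3)] DP_br[OF _ j b1(1,2)] DP_bb[OF _ k b2(2,3)]
        x_psi_bb[OF _ j b(1,2)] x_psi_bb[OF _ k b2(2,3)] psi_x_bb[OF _ j b(1,2)] psi_x_bb[OF _ k b2(2,3)]
        psi_x_br[OF _ j b1(1,2)] psi_x_br[OF _ k b(2,3)]
        tails(4)[OF j pos(3)] tails(4)[OF k pos(1)] tails(5)[OF j pos(3)] tails(5)[OF k pos(1)]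
        tails(6)[OF j] tails(6)[OF k] tails(7)[OF j] tails(7)[OF k]
        z loc_P_same[OF _ j b(1,2)] loc_P_same[OF _ k b2(2,3)] l1 l2 braid
        loc_X[OF _ pos(1)] loc_X[OF _ pos(2)] loc_X[OF _ pos(3)]
        loc_E[OF _ pos(1)] loc_E[OF _ pos(2)] loc_E[OF _ pos(3)]
        distrib_left right_diff_distrib)
qed

lemma dbraid_rbb:
  assumes z: "loc z i" and j: "crs j" and k: "crs (Suc j)"
    and b: "entry i j = Red r" "entry i (Suc j) = Black" "entry i (Suc (Suc j)) = Black"
  shows "dbraid j (Suc j) z = dbraid (Suc j) j z"
proof -
  have pos: "pos j" "pos (Suc j)" "pos (Suc (Suc j))"
    using j k by auto
  define i1 where "i1 = swap j i"
  define i2 where "i2 = swap (Suc j) i1"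
  have len: "length i = length s + n"
    using loc_length[OF z] .
  have b1: "entry i1 j = Black" "entry i1 (Suc j) = Red r" "entry i1 (Suc (Suc j)) = Black"
    unfolding i1_def using entry_swap[of j i] b j k len by auto
  have b2: "entry i2 j = Black" "entry i2 (Suc j) = Black" "entry i2 (Suc (Suc j)) = Red r"
    unfolding i2_def using entry_swap[of "Suc j" i1] b1 j k len by (auto simp: i1_def)
  have l1: "loc (P j * w) i1" if "loc w i" for w
    unfolding i1_def using moves_loc[OF moves_P[OF j] that] b by simp
  have l2: "loc (P (Suc j) * w) i2" if "loc w i1" for w
    unfolding i2_def using moves_loc[OF moves_P[OF k] that] b1 by simp
  have braid: "P j * (P (Suc j) * (P j * w)) = P (Suc j) * (P j * (P (Suc j) * w))" if "loc w i" for w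
    using braid[OF that] j k b by simp
  show ?thesis
    unfolding dbraid_def
    by (simp add: DP_rb[OF _ j b(1,2)] DP_bb[OF _ k b(2,3)] DP_rb[OF _ k b1(2,3)] DP_bb[OF _ j b2(1,2)]
        x_psi_bb[OF _ k b(2,3)] x_psi_bb[OF _ j b2(1,2)] psi_x_bb[OF _ k b(2,3)] psi_x_bb[OF _ j b2(1,2)]
        x_psi_rb[OF _ j b(1,2)] x_psi_rb[OF _ k b1(2,3)]
        tails(4)[OF j pos(3)] tails(4)[OF k pos(1)] of_nat_left_commute
        z loc_P_same[OF _ k b(2,3)] loc_P_same[OF _ j b2(1,2)] l1 l2 braid
        loc_X[OF _ pos(1)] loc_X[OF _ pos(2)] loc_X[OF _ pos(3)]
        distrib_left right_diff_distrib)
qed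

text \<open>The divided difference of R between the dots of the two black strands, which is the
  right hand side of the braid relation.\<close>

definition bsum :: "nat \<Rightarrow> nat \<Rightarrow> 'k free quots" where
  "bsum r j = (\<Sum>m=0..r. (- 1) ^ m * (E m (Suc j) * hsum (xq j) (xq (Suc (Suc j))) (r - m)))"

lemma braid_brb_bsum:
  assumes z: "loc z i" and j: "crs j" and k: "crs (Suc j)"
    and b: "entry i j = Black" "entry i (Suc j) = Red r" "entry i (Suc (Suc j)) = Black"
  shows "P j * (P (Suc j) * (P j * z)) = P (Suc j) * (P j * (P (Suc j) * z)) + bsum r j * z"
proof -
  have pos: "pos j" "pos (Suc j)" "pos (Suc (Suc j))"
    using j k by auto
  have "P j * (P (Suc j) * (P j * z)) - P (Suc j) * (P j * (P (Suc j) * z)) =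
    (\<Sum>m=0..r. \<Sum>a<r - m. (- 1) ^ m * (xq j ^ a * (E m (Suc j) * (xq (Suc (Suc j)) ^ (r - m - 1 - a) * z))))"
    using braid_brb[OF z _ _ b] j k by (simp only: sum_triples) simp
  also have "\<dots> = bsum r j * z"
    by (simp add: bsum_def hsum_def sum_distrib_right sum_distrib_left mult.assoc xq_power_E[OF pos(2,1)])
  finally show ?thesis
    by (simp add: algebra_simps)
qed

text \<open>In each word the crossing with the red strand on the left yields r x, the one with the
  red strand on the right E(1), and the black-black crossing -2 x. Moving dots past the black-black
  crossing leaves squares of the outer crossings, which are values of R. The coefficients are those
  of \<open>braid_identity\<close>.\<close>

lemma dbraid_brb:
  assumes z: "loc z i" and j: "crs j" and k: "crs (Suc j)"
    and b: "entry i j = Black" "entry i (Suc j) = Red r" "entry i (Suc (Suc j)) = Black"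
  shows "dbraid j (Suc j) z - dbraid (Suc j) j z =
    bsum r j * (E 1 (Suc j) * z + (of_nat r - 2) * (xq (Suc (Suc j)) * z)) +
    sq r (Suc j) (Suc (Suc j)) * z + (of_nat r - 1) * (sq r (Suc j) j * z)"
proof -
  have pos: "pos j" "pos (Suc j)" "pos (Suc (Suc j))"
    using j k by auto
  define i1 where "i1 = swap j i"
  define i2 where "i2 = swap (Suc j) i"
  have len: "length i = length s + n"
    using loc_length[OF z] .
  have b1: "entry i1 j = Red r" "entry i1 (Suc j) = Black" "entry i1 (Suc (Suc j)) = Black"
    unfolding i1_def using entry_swap[of j i] b j k len by auto
  have b2: "entry i2 j = Black" "entry i2 (Suc j) = Black" "entry i2 (Suc (Suc j)) = Red r"
    unfolding i2_def using entry_swap[of "Suc j" i] b j k len by auto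
  have l1: "loc (P j * w) i1" if "loc w i" for w
    unfolding i1_def using moves_loc[OF moves_P[OF j] that] b by simp
  have l2: "loc (P (Suc j) * w) i2" if "loc w i" for w
    unfolding i2_def using moves_loc[OF moves_P[OF k] that] b by simp
  note rules = DP_br[OF _ j b(1,2)] DP_bb[OF _ k b1(2,3)] DP_rb[OF _ j b1(1,2)]
        DP_rb[OF _ k b(2,3)] DP_bb[OF _ j b2(1,2)] DP_br[OF _ k b2(2,3)]
        x_psi_bb[OF _ k b1(2,3)] x_psi_bb[OF _ j b2(1,2)] psi_x_bb[OF _ k b1(2,3)] psi_x_bb[OF _ j b2(1,2)]
        x_psi_rb[OF _ k b(2,3)] x_psi_rb[OF _ j b1(1,2)] psi_x_br[OF _ j b(1,2)] psi_x_br[OF _ k b2(2,3)]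
        tails(4)[OF j pos(3)] tails(4)[OF k pos(1)] tails(5)[OF j pos(3)] tails(5)[OF k pos(1)]
        tails(6)[OF j] tails(6)[OF k] tails(7)[OF j] tails(7)[OF k] of_nat_left_commute
        z loc_P_same[OF _ k b1(2,3)] loc_P_same[OF _ j b2(1,2)] l1 l2
        loc_X[OF _ pos(1)] loc_X[OF _ pos(2)] loc_X[OF _ pos(3)]
        loc_E[OF _ pos(1)] loc_E[OF _ pos(2)] loc_E[OF _ pos(3)]
  have "dbraid j (Suc j) z = (of_nat r - 2) * (P j * (P (Suc j) * (P j * (xq (Suc (Suc j)) * z)))) +
    (of_nat r - 1) * (P j * (P j * z)) + P j * (P (Suc j) * (P j * (E 1 (Suc j) * z)))"
    unfolding dbraid_def by (simp add: rules distrib_left right_diff_distrib left_diff_distrib mult_2)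
  moreover have "dbraid (Suc j) j z = (of_nat r - 2) * (P (Suc j) * (P j * (P (Suc j) * (xq (Suc (Suc j)) * z)))) -
    P (Suc j) * (P (Suc j) * z) + P (Suc j) * (P j * (P (Suc j) * (E 1 (Suc j) * z)))"
    unfolding dbraid_def by (simp add: rules distrib_left right_diff_distrib left_diff_distrib mult_2)
  moreover have two: "a * (2 * b) = 2 * (a * b)" for a b :: "'k free quots"
    by (simp add: mult_2 distrib_left)
  ultimately show ?thesis
    by (simp add: P_P_rb[OF z k b(2,3)] P_P_br[OF z j b(1,2)] braid_brb_bsum[OF _ j k b] z
        loc_X[OF _ pos(3)] loc_E[OF _ pos(2)] distrib_left left_diff_distrib right_diff_distrib of_nat_left_commute two)
qed

lemma qd_triple_term:
  assumes "pos j" "pos k" "pos l"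
  shows "q (d ((- 1) ^ m * xx j ^ a * EE m k * xx l ^ b * ee i)) =
    (- 1) ^ m * (DE m k * (xq j ^ a * xq l ^ b) +
      E m k * (of_nat a * (xq j ^ (a + 1) * xq l ^ b) + of_nat b * (xq j ^ a * xq l ^ (b + 1)))) * e i"
proof -
  have "cm (DE m k) (xq j)"
    using assms by (intro cm_DE cm_basic)
  then have DE: "xq j ^ a * (DE m k * z) = DE m k * (xq j ^ a * z)" for z
    using power_commuting_commutes[of "xq j" "DE m k" a] by (simp add: cm_def flip: mult.assoc)
  have E: "xq j * (xq j ^ a * (E m k * z)) = E m k * (xq j * (xq j ^ a * z))"
    "xq j ^ a * (E m k * z) = E m k * (xq j ^ a * z)" "xq j * (E m k * z) = E m k * (xq j * z)" for z
    using xq_power_E[OF assms(2,1), of "Suc a"] xq_power_E[OF assms(2,1), of a] xq_power_E[OF assms(2,1), of 1]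
    by (simp_all add: mult.assoc)
  show ?thesis
    by (simp only: mult.assoc qd_neg_power qd_xx_power q_xx_power q_EE(1) qd_EE qd_gen)
      (simp add: distrib_right distrib_left mult.assoc of_nat_left_commute DE E add_ac)
qed

lemma check_braid_brb:
  assumes i: "i \<in> Seq s n" and j: "crs j" and k: "crs (Suc j)"
    and b: "entry i j = Black" "entry i (Suc j) = Red r" "entry i (Suc (Suc j)) = Black"
  shows "q (d ((psi j * psi (Suc j) * psi j - psi (Suc j) * psi j * psi (Suc j)) * ee i
     - (\<Sum>(d1, d2, d3)\<in>{(d1, d2, d3). d1 + d2 + d3 + 1 = r}.
          (- 1) ^ d3 * xx j ^ d1 * EE d3 (Suc j) * xx (Suc (Suc j)) ^ d2 * ee i))) = 0"
proof -
  have pos: "pos j" "pos (Suc j)" "pos (Suc (Suc j))"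
    using j k by auto
  let ?x = "xq j" and ?y = "xq (Suc (Suc j))" and ?E = "\<lambda>m. E m (Suc j)"
  let ?t = "\<lambda>d1 d2 d3. (- 1) ^ d3 * xx j ^ d1 * EE d3 (Suc j) * xx (Suc (Suc j)) ^ d2 * ee i :: 'k free"
  have "q (d (\<Sum>(d1, d2, d3)\<in>{(d1, d2, d3). d1 + d2 + d3 + 1 = r}. ?t d1 d2 d3)) =
    (\<Sum>m=0..r. \<Sum>a<r - m. q (d (?t a (r - m - 1 - a) m)))"
    unfolding sum_triples qd_add by (rule refl)
  also have "\<dots> = (\<Sum>m=0..r. (- 1) ^ m * (DE m (Suc j) * hsum ?x ?y (r - m) + ?E m * dhsum ?x ?y (r - m))) * e i"
    unfolding qd_triple_term[OF pos] hsum_def dhsum_def sum_distrib_left sum_distrib_right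
      sum.distrib[symmetric] distrib_left[symmetric] by (rule refl)
  also have "\<dots> = (bsum r j * (?E 1 + (of_nat r - 2) * ?y) + sq r (Suc j) (Suc (Suc j)) +
      (of_nat r - 1) * sq r (Suc j) j) * e i"
    unfolding DE_def bsum_def sq_def
    by (subst braid_identity) (simp_all only: x_x[OF pos(1,3)] E_x[OF pos(2,1)] E_x[OF pos(2,3)] E_E[OF pos(2,2), of _ 1])
  also have "\<dots> = dbraid j (Suc j) (e i) - dbraid (Suc j) j (e i)"
    unfolding dbraid_brb[OF loc_e[OF i] j k b] by (simp add: distrib_right distrib_left mult.assoc)
  finally show ?thesis
    by (simp only: qd_add(2) qd_braid) simp
qed

text \<open>With two red strands among three, some crossing of a braid word involves two red strands.\<close>

lemma red_red_triple:
  assumes z: "loc z i" and j: "crs j" and k: "crs (Suc j)"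
    and m: "moves j a" "moves (Suc j) b" "moves j c" "moves (Suc j) a'" "moves j b'" "moves (Suc j) c'"
    and two: "entry i j \<noteq> Black \<and> entry i (Suc j) \<noteq> Black \<or> entry i j \<noteq> Black \<and> entry i (Suc (Suc j)) \<noteq> Black
      \<or> entry i (Suc j) \<noteq> Black \<and> entry i (Suc (Suc j)) \<noteq> Black"
  shows "a * (b * (c * z)) = 0" "a' * (b' * (c' * z)) = 0"
proof -
  have len: "length w = length s + n" if "w \<in> Seq s n" for w
    using length_Seq[OF that] .
  have sj: "entry (swap j w) j = entry w (Suc j)" "entry (swap j w) (Suc j) = entry w j"
    "entry (swap j w) (Suc (Suc j)) = entry w (Suc (Suc j))" if "w \<in> Seq s n" for w
    using entry_swap[of j w] j len[OF that] by auto
  have sk: "entry (swap (Suc j) w) j = entry w j" "entry (swap (Suc j) w) (Suc j) = entry w (Suc (Suc j))"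
    "entry (swap (Suc j) w) (Suc (Suc j)) = entry w (Suc j)" if "w \<in> Seq s n" for w
    using entry_swap[of "Suc j" w] j k len[OF that] by auto
  show "a * (b * (c * z)) = 0"
  proof (cases "c * z = 0 \<or> b * (c * z) = 0")
    case False
    then have c: "loc (c * z) (swap j i)"
      using moves_loc[OF m(3) z] moves_zero[OF m(3) z] by blast
    then have "loc (b * (c * z)) (swap (Suc j) (swap j i))"
      using False moves_loc[OF m(2) c] moves_zero[OF m(2) c] by blast
    moreover have "entry i j = Black \<or> entry i (Suc j) = Black" "entry i j = Black \<or> entry i (Suc (Suc j)) = Black"
      using False moves_zero[OF m(3) z] moves_zero[OF m(2) c] sj[OF loc_Seq[OF z]] by auto
    ultimately show ?thesis
      using two by (intro moves_zero[OF m(1)]) (auto simp: sj sk loc_Seq[OF z] loc_Seq[OF c])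
  qed auto
  show "a' * (b' * (c' * z)) = 0"
  proof (cases "c' * z = 0 \<or> b' * (c' * z) = 0")
    case False
    then have c: "loc (c' * z) (swap (Suc j) i)"
      using moves_loc[OF m(6) z] moves_zero[OF m(6) z] by blast
    then have "loc (b' * (c' * z)) (swap j (swap (Suc j) i))"
      using False moves_loc[OF m(5) c] moves_zero[OF m(5) c] by blast
    moreover have "entry i (Suc j) = Black \<or> entry i (Suc (Suc j)) = Black" "entry i j = Black \<or> entry i (Suc (Suc j)) = Black"
      using False moves_zero[OF m(6) z] moves_zero[OF m(5) c] sk[OF loc_Seq[OF z]] by auto
    ultimately show ?thesis
      using two by (intro moves_zero[OF m(4)]) (auto simp: sj sk loc_Seq[OF z] loc_Seq[OF c])
  qed auto
qed

lemma check_braid: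
  assumes i: "i \<in> Seq s n" and j: "crs j" and k: "crs (Suc j)"
    and b: "\<not> (entry i j = Black \<and> entry i (Suc j) \<noteq> Black \<and> entry i (Suc (Suc j)) = Black)"
  shows "q (d ((psi j * psi (Suc j) * psi j - psi (Suc j) * psi j * psi (Suc j)) * ee i)) = 0"
proof -
  note z = loc_e[OF i]
  have "dbraid j (Suc j) (e i) = dbraid (Suc j) j (e i)"
  proof (cases "entry i j \<noteq> Black \<and> entry i (Suc j) \<noteq> Black \<or> entry i j \<noteq> Black \<and> entry i (Suc (Suc j)) \<noteq> Black
      \<or> entry i (Suc j) \<noteq> Black \<and> entry i (Suc (Suc j)) \<noteq> Black")
    case True
    note zero = red_red_triple[OF z j k _ _ _ _ _ _ True]
    note m = moves_P[OF j] moves_P[OF k] moves_DP[OF j] moves_DP[OF k]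
    show ?thesis
      unfolding dbraid_def
      using zero[OF m(3,2,1) m(4,1,2)] zero[OF m(1,4,1) m(2,3,2)] zero[OF m(1,2,3) m(2,1,4)] by simp
  next
    case False
    then show ?thesis
      using b dbraid_bbb[OF z j k] dbraid_bbr[OF z j k] dbraid_rbb[OF z j k]
      by (cases "entry i j"; cases "entry i (Suc j)"; cases "entry i (Suc (Suc j))") auto
  qed
  then show ?thesis
    by (simp add: qd_braid)
qed

lemma qd_rel: "\<rho> \<in> webster_rels s n \<Longrightarrow> q (d \<rho>) = 0"
proof (induction rule: webster_rels.induct)
  case unit
  show ?case
    by (simp add: qd_add qd_gen)
next
  case (e_e i i')
  then show ?case
    by (auto simp: qd_add qd_mult qd_gen)
next
  case (E_e i j m)
  then have E: "q (EE m j) = E m j"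
    by (simp add: q_EE)
  have "cm (DE m j) (e i)"
    by (rule cm_DE) (use E_e in \<open>auto simp: cm_def intro: webster.E_e\<close>)
  then show ?case
    by (intro cm_check) (simp_all add: qd_gen cm_def)
next
  case (x_e i j)
  then have "cm (xq j) (e i)"
    by (auto simp: cm_def intro: webster.x_e)
  then show ?case
    by (intro cm_check) (auto simp: qd_gen cm_intros, simp add: cm_def)
next
  case (psi_e i j)
  then show ?case
    by (intro check_psi_e) auto
next
  case (E_black i j m)
  then have "pos j"
    by simp
  then show ?case
    using E_black by (simp add: qd_mult qd_gen DE_def left_diff_distrib mult.assoc webster.E_black[where i = i] loc_e loc_E)
next
  case (E_large i j m r)
  then have "pos j"
    by simp
  then show ?case
    using E_large
    by (simp add: qd_mult qd_gen DE_def left_diff_distrib mult.assoc webster.E_large[where i = i and r = r] loc_e loc_E)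
next
  case (x_red i j r)
  then show ?case
    using webster.x_red[OF loc_e] by (simp add: qd_mult qd_gen mult.assoc)
next
  case (psi_red_red i j r r')
  then show ?case
    using DP_rr[OF loc_e] by (simp add: qd_mult qd_gen)
next
  case (x_x j l)
  then show ?case
    by (intro cm_check) (auto simp: qd_gen intro!: cm_intros(1) cm_sym[OF cm_intros(1)] cm_basic)
next
  case (E_x j l m)
  then show ?case
    by (intro cm_check) (auto simp: qd_gen q_EE intro!: cm_DE cm_sym[OF cm_intros(1)] cm_basic)
next
  case (E_E j l m m')
  then show ?case
    by (intro cm_check) (auto simp: qd_gen q_EE intro!: cm_DE cm_sym[OF cm_DE] cm_basic)
next
  case (psi_x j l)
  then show ?case
    by (intro check_psi_x) auto
next
  case (psi_E j l m)
  then show ?case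
    by (intro check_psi_E) auto
next
  case (psi_E_left j m)
  then show ?case
    using check_psi_E_left by simp
next
  case (psi_E_right j m)
  then show ?case
    using check_psi_E_right by simp
next
  case (psi_psi_far j l)
  then show ?case
    by (intro check_psi_psi_far) auto
next
  case (x_psi_bb i j)
  then show ?case
    using check_x_psi_bb(1) by simp
next
  case (x_psi_rb i j r)
  then show ?case
    using check_x_psi_rb by simp
next
  case (psi_x_bb i j)
  then show ?case
    using check_x_psi_bb(2) by simp
next
  case (psi_x_br i j r)
  then show ?case
    using check_psi_x_br by simp
next
  case (psi_sq_bb i j)
  then show ?case
    using check_psi_sq_bb by simp
next
  case (psi_sq_rb i j r)
  then show ?case
    using check_psi_sq_rb by simp
next
  case (psi_sq_br i j r)
  then show ?case
    using check_psi_sq_br by simp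
next
  case (braid_brb i j r)
  then show ?case
    using check_braid_brb[of i j r] by simp
next
  case (braid i j)
  then show ?case
    using check_braid[of i j] by simp
qed

end

section \<open>The grading\<close>

text \<open>The degree of a crossing. The value for two red strands is a default that makes the
  function total; such a crossing is zero.\<close>

fun wt :: "letter \<Rightarrow> letter \<Rightarrow> int" where
  "wt Black Black = - 2"
| "wt (Red r) Black = int r"
| "wt Black (Red r) = int r"
| "wt (Red r) (Red r') = 0"

context webster
begin

text \<open>Laurent polynomials are the finitely supported functions on the integers. A crossing has
  different degrees at different sequences, so its image has a term for each sequence and is in
  general no monomial.\<close>

primrec graded_val :: "webster_gen \<Rightarrow> int \<Rightarrow>\<^sub>0 'k free quots" where
  "graded_val (Idempotent i) = Poly_Mapping.single 0 (e i)"
| "graded_val (Dot j) = Poly_Mapping.single 2 (xq j)"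
| "graded_val (Elem m j) = Poly_Mapping.single (2 * int m) (q (gen (Elem m j)))"
| "graded_val (Cross j) =
    (\<Sum>i\<in>Seq s n. Poly_Mapping.single (wt (entry i j) (entry i (Suc j))) (q (psi j * ee i)))"

text \<open>The coaction \<open>f \<mapsto> f t\<^sup>k\<close> on elements of degree \<open>k\<close>. It sends 1 to the idempotent \<open>q 1\<close>,
  which is not the unit of the target.\<close>

definition graded :: "'k free \<Rightarrow> int \<Rightarrow>\<^sub>0 'k free quots" where
  "graded = lin (\<lambda>c. Poly_Mapping.single 0 (q (scalar c))) (\<lambda>w. prod_list (map graded_val (letters w)))"

lemma graded_add: "graded (f + g) = graded f + graded g"
  by (simp add: graded_def lin_add scalar_hom q_hom single_add)

lemma graded_0: "graded 0 = 0"
  by (simp add: graded_def lin_0)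

lemma graded_minus: "graded (- f) = - graded f"
  using graded_add[of f "- f"] by (simp add: graded_0 eq_neg_iff_add_eq_0 add.commute)

lemma graded_diff: "graded (f - g) = graded f - graded g"
  using graded_add[of f "- g"] by (simp add: graded_minus)

lemma graded_sum: "graded (sum F S) = (\<Sum>a\<in>S. graded (F a))"
  by (induction S rule: infinite_finite_induct) (simp_all add: graded_0 graded_add)

lemma graded_mult: "graded (f * g) = graded f * graded g"
  unfolding graded_def
proof (rule lin_mult)
  fix c :: 'k and w :: "webster_gen word"
  let ?c = "Poly_Mapping.single (0::int) (q (scalar c))"
  have g: "?c * graded_val g = graded_val g * ?c" for g
    by (cases g) (simp_all add: mult_single sum_distrib_left sum_distrib_right q_scalar_commute)
  have "?c * prod_list (map graded_val ws) = prod_list (map graded_val ws) * ?c" for ws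
  proof (induction ws)
    case (Cons x ws)
    have "?c * (graded_val x * prod_list (map graded_val ws)) = graded_val x * (?c * prod_list (map graded_val ws))"
      by (simp only: g flip: mult.assoc)
    then show ?case
      by (simp only: Cons list.map prod_list.Cons mult.assoc)
  qed simp
  then show "?c * prod_list (map graded_val (letters w)) = prod_list (map graded_val (letters w)) * ?c" .
qed (simp_all add: scalar_hom q_hom single_add mult_single plus_word_def)

lemma graded_scalar: "graded (scalar c) = Poly_Mapping.single 0 (q (scalar c))"
  by (simp add: graded_def scalar_def lin_single scalar_hom q_hom zero_word_def)

lemma graded_1: "graded 1 = Poly_Mapping.single 0 (q 1)"
  using graded_scalar[of 1] by (simp add: scalar_hom)

lemma graded_gen: "graded (gen g) = graded_val g"
proof -
  have "graded (gen g) = Poly_Mapping.single 0 (q 1) * graded_val g"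
    by (simp add: graded_def gen_def lin_single scalar_hom q_hom)
  also have "\<dots> = graded_val g"
    by (cases g) (simp_all add: mult_single sum_distrib_left q_1)
  finally show ?thesis .
qed

definition homog :: "'k free \<Rightarrow> int \<Rightarrow> bool" where
  "homog f k \<longleftrightarrow> graded f = Poly_Mapping.single k (q f)"

lemma homog_intros:
  "homog f k \<Longrightarrow> homog g l \<Longrightarrow> homog (f * g) (k + l)" "homog f k \<Longrightarrow> homog g k \<Longrightarrow> homog (f + g) k"
  "homog f k \<Longrightarrow> homog g k \<Longrightarrow> homog (f - g) k" "homog 0 k" "homog (scalar c) 0" "homog 1 0"
  "(\<And>a. a \<in> S \<Longrightarrow> homog (F a) k) \<Longrightarrow> homog (sum F S) k"
proof -
  have "(\<Sum>a\<in>S. Poly_Mapping.single k (q (F a))) = Poly_Mapping.single k (\<Sum>a\<in>S. q (F a))"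
    by (induction S rule: infinite_finite_induct) (simp_all add: single_add)
  then show "(\<And>a. a \<in> S \<Longrightarrow> homog (F a) k) \<Longrightarrow> homog (sum F S) k"
    by (simp add: homog_def graded_sum q_hom)
qed (simp_all add: homog_def graded_mult graded_add graded_diff graded_0 graded_scalar graded_1 q_hom
    mult_single single_add single_diff)

lemma homog_minus: "homog f k \<Longrightarrow> homog (- f) k"
  by (simp add: homog_def graded_minus q_hom single_uminus)

lemma homog_comm: "homog f k \<Longrightarrow> homog g l \<Longrightarrow> homog (f * g - g * f) (k + l)"
  using homog_intros(1)[of g l f k] by (simp add: homog_intros add.commute)

text \<open>A product may vanish in the algebra, for instance at a crossing of two red strands. Its
  formal sequence is tracked nevertheless, since the degree attached to the next crossing is
  computed from it.\<close>

definition hloc :: "'k free \<Rightarrow> int \<Rightarrow> letter list \<Rightarrow> bool" where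
  "hloc f k i \<longleftrightarrow> homog f k \<and> length i = length s + n \<and> (q f = 0 \<or> loc (q f) i)"

lemma hloc_homog: "hloc f k i \<Longrightarrow> homog f k"
  by (simp add: hloc_def)

lemma homog_gens: "homog (ee i) 0" "homog (xx j) 2" "homog (EE m j) (2 * int m)"
  by (simp_all add: homog_def graded_gen EE_def graded_1)

lemma hloc_ee: "i \<in> Seq s n \<Longrightarrow> hloc (ee i) 0 i"
  by (simp add: hloc_def homog_gens loc_e length_Seq)

lemma hloc_ee_ee: "i \<in> Seq s n \<Longrightarrow> i' \<in> Seq s n \<Longrightarrow> hloc (ee i * ee i') 0 i'"
  using homog_intros(1)[OF homog_gens(1,1), of i i']
  by (auto simp: hloc_def q_hom e_e loc_e length_Seq)

lemma hloc_ee0: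
  assumes g: "hloc g k i"
  shows "hloc (ee0 s n i' * g) k i"
proof -
  have "homog (ee0 s n i') 0"
    by (simp add: ee0_def homog_gens homog_intros)
  then have "homog (ee0 s n i' * g) k"
    using homog_intros(1)[of _ 0 g k] g by (simp add: hloc_def)
  moreover have "q (ee0 s n i' * g) \<in> {0, q g}"
    using g e_loc[of "q g" i i'] by (auto simp: hloc_def ee0_def q_hom)
  ultimately show ?thesis
    using g by (auto simp: hloc_def)
qed

lemma hloc_xx: "hloc g k i \<Longrightarrow> pos j \<Longrightarrow> k' = k + 2 \<Longrightarrow> hloc (xx j * g) k' i"
  using homog_intros(1)[OF homog_gens(2)] by (auto simp: hloc_def q_hom loc_X add.commute)

lemma hloc_xx_power: "hloc g k i \<Longrightarrow> pos j \<Longrightarrow> k' = k + 2 * int a \<Longrightarrow> hloc (xx j ^ a * g) k' i"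
  by (induction a arbitrary: k') (simp_all add: mult.assoc hloc_xx)

lemma hloc_EE: "hloc g k i \<Longrightarrow> pos j \<Longrightarrow> k' = k + 2 * int m \<Longrightarrow> hloc (EE m j * g) k' i"
  using homog_intros(1)[OF homog_gens(3)] by (auto simp: hloc_def q_EE loc_E add.commute)

lemma hloc_neg: "hloc g k i \<Longrightarrow> hloc ((- 1) ^ a * g) k i"
  by (induction a) (auto simp: hloc_def q_hom loc_add homog_minus)

lemma hloc_psi:
  assumes g: "hloc g k i" and j: "crs j" and k': "k' = wt (entry i j) (entry i (Suc j)) + k"
  shows "hloc (psi j * g) k' (swap j i)"
proof -
  have "graded (psi j * g) =
    (\<Sum>i'\<in>Seq s n. Poly_Mapping.single (wt (entry i' j) (entry i' (Suc j)) + k) (P j * (e i' * q g)))"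
    using g by (simp add: hloc_def homog_def graded_mult graded_gen sum_distrib_right mult_single q_hom mult.assoc)
  also have "\<dots> = Poly_Mapping.single k' (P j * q g)"
  proof (cases "q g = 0")
    case False
    then have l: "loc (q g) i"
      using g by (simp add: hloc_def)
    have "(\<Sum>i'\<in>Seq s n. Poly_Mapping.single (wt (entry i' j) (entry i' (Suc j)) + k) (P j * (e i' * q g))) =
      (\<Sum>i'\<in>Seq s n. if i' = i then Poly_Mapping.single k' (P j * q g) else 0)"
      by (intro sum.cong refl) (auto simp: e_loc[OF l] k')
    then show ?thesis
      using loc_Seq[OF l] by (simp add: finite_Seq)
  qed simp
  finally have "homog (psi j * g) k'"
    by (simp add: homog_def q_hom)
  moreover have "P j * q g = 0 \<or> loc (P j * q g) (swap j i)"
    using g moves_loc[OF moves_P[OF j]] moves_zero[OF moves_P[OF j]] by (auto simp: hloc_def)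
  ultimately show ?thesis
    using g by (simp add: hloc_def q_hom)
qed

section \<open>Homogeneity of the relations\<close>

lemma homog_hloc: "hloc f k' i \<Longrightarrow> k = k' \<Longrightarrow> homog f k"
  by (simp add: hloc_def)

lemmas hloc_intros = homog_hloc hloc_xx[OF _ _ refl] hloc_xx_power[OF _ _ refl] hloc_EE[OF _ _ refl]
  hloc_neg hloc_psi[OF _ _ refl] hloc_ee

text \<open>For relations such as \<open>psi_x\<close>, whose crossings carry no idempotent and
  which are therefore not homogeneous. On each sequence both sides are homogeneous of one degree and
  equal under \<open>q\<close>, hence equal under \<open>graded\<close>; the sum of the idempotents
  has the same coaction as 1.\<close>

lemma graded_rel_on_e:
  assumes "f - g \<in> webster_rels s n" and "\<And>i. i \<in> Seq s n \<Longrightarrow> \<exists>k i1 i2. hloc (f * ee i) k i1 \<and> hloc (g * ee i) k i2"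
  shows "graded (f - g) = 0"
proof -
  have "q f = q g"
    using q_rel[OF assms(1)] by (simp add: q_hom)
  then have "graded f * graded (ee i) = graded g * graded (ee i)" if "i \<in> Seq s n" for i
    using assms(2)[OF that] by (auto simp: hloc_def homog_def q_hom simp flip: graded_mult)
  then have "graded f * graded (\<Sum>i\<in>Seq s n. ee i) = graded g * graded (\<Sum>i\<in>Seq s n. ee i)"
    by (simp add: graded_sum sum_distrib_left)
  moreover have "graded (\<Sum>i\<in>Seq s n. ee i) = graded 1"
  proof -
    have "homog (\<Sum>i\<in>Seq s n. ee i) 0"
      by (intro homog_intros(7) homog_gens)
    then show ?thesis
      by (simp add: homog_def graded_1 unit_sum q_hom)
  qed
  ultimately show ?thesis
    by (simp add: graded_diff flip: graded_mult)
qed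

text \<open>The coaction of a homogeneous relation is a monomial whose coefficient is
  \<open>q \<rho> = 0\<close>; it is enough that some degree exists.\<close>

lemma graded_rel_homog: "\<rho> \<in> webster_rels s n \<Longrightarrow> homog \<rho> k \<Longrightarrow> graded \<rho> = 0"
  by (simp add: homog_def q_rel)

text \<open>In either braid word each of the three pairs of strands crosses exactly once, in its
  original order from left to right.\<close>

lemma braid_degree:
  assumes "length i = length s + n" "crs j" "crs (Suc j)"
  shows "wt (entry (swap (Suc j) (swap j i)) j) (entry (swap (Suc j) (swap j i)) (Suc j)) +
      (wt (entry (swap j i) (Suc j)) (entry (swap j i) (Suc (Suc j))) + (wt (entry i j) (entry i (Suc j)) + 0)) =
      wt (entry i j) (entry i (Suc j)) + wt (entry i j) (entry i (Suc (Suc j))) + wt (entry i (Suc j)) (entry i (Suc (Suc j)))"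
    "wt (entry (swap j (swap (Suc j) i)) (Suc j)) (entry (swap j (swap (Suc j) i)) (Suc (Suc j))) +
      (wt (entry (swap (Suc j) i) j) (entry (swap (Suc j) i) (Suc j)) + (wt (entry i (Suc j)) (entry i (Suc (Suc j))) + 0)) =
      wt (entry i j) (entry i (Suc j)) + wt (entry i j) (entry i (Suc (Suc j))) + wt (entry i (Suc j)) (entry i (Suc (Suc j)))"
  using assms by (simp_all add: entry_swap)

lemma homog_braid:
  assumes i: "i \<in> Seq s n" and j: "crs j" and k: "crs (Suc j)"
  shows "homog ((psi j * psi (Suc j) * psi j - psi (Suc j) * psi j * psi (Suc j)) * ee i)
    (wt (entry i j) (entry i (Suc j)) + wt (entry i j) (entry i (Suc (Suc j))) + wt (entry i (Suc j)) (entry i (Suc (Suc j))))"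
  unfolding left_diff_distrib mult.assoc
  using hloc_psi[OF hloc_psi[OF hloc_psi[OF hloc_ee[OF i] j refl] k refl] j refl]
    hloc_psi[OF hloc_psi[OF hloc_psi[OF hloc_ee[OF i] k refl] j refl] k refl]
  unfolding braid_degree[OF length_Seq[OF i] j k]
  by (intro homog_intros(3) hloc_homog)

lemma graded_rel: "\<rho> \<in> webster_rels s n \<Longrightarrow> graded \<rho> = 0"
proof -
  assume "\<rho> \<in> webster_rels s n"
  then show "graded \<rho> = 0"
  proof (induction rule: webster_rels.induct)
    case unit
    then show ?case
      by (intro graded_rel_homog[where k = 0] homog_intros homog_gens) (auto intro: webster_rels.unit)
  next
    case (e_e i i')
    have "homog (ee i * ee i' - (if i = i' then ee i else 0)) 0"
      using homog_intros(1)[OF homog_gens(1,1), of i i'] by (auto intro!: homog_intros homog_gens)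
    then show ?case
      using graded_rel_homog[OF webster_rels.e_e[OF e_e]] by blast
  next
    case (E_e i j m)
    then show ?case
      using graded_rel_homog[OF webster_rels.E_e homog_comm[OF homog_gens(3,1)]] by blast
  next
    case (x_e i j)
    then show ?case
      using graded_rel_homog[OF webster_rels.x_e homog_comm[OF homog_gens(2,1)]] by blast
  next
    case (psi_e i j)
    then have j: "crs j" by simp
    show ?case
    proof (rule graded_rel_on_e)
      show "psi j * ee i - ee0 s n (swap j i) * psi j \<in> webster_rels s n"
        using psi_e by (rule webster_rels.psi_e)
      fix i' assume i': "i' \<in> Seq s n"
      show "\<exists>k i1 i2. hloc (psi j * ee i * ee i') k i1 \<and> hloc (ee0 s n (swap j i) * psi j * ee i') k i2"
        unfolding mult.assoc
        using hloc_psi[OF hloc_ee_ee[OF psi_e(1) i'] j refl] hloc_ee0[OF hloc_psi[OF hloc_ee[OF i'] j refl]] by blast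
    qed
  next
    case (E_black i j m)
    then show ?case
      using graded_rel_homog[OF webster_rels.E_black homog_intros(1)[OF homog_gens(3,1)]] by blast
  next
    case (E_large i j m r)
    then show ?case
      using graded_rel_homog[OF webster_rels.E_large homog_intros(1)[OF homog_gens(3,1)]] by blast
  next
    case (x_red i j r)
    then show ?case
      using graded_rel_homog[OF webster_rels.x_red homog_intros(1)[OF homog_gens(2,1)]] by blast
  next
    case (psi_red_red i j r r')
    have "homog (psi j * ee i) (wt (entry i j) (entry i (Suc j)) + 0)"
      by ((rule hloc_intros)+) (use psi_red_red in auto)
    then show ?case
      using graded_rel_homog[OF webster_rels.psi_red_red[OF psi_red_red]] by blast
  next
    case (x_x j l)
    then show ?case
      using graded_rel_homog[OF webster_rels.x_x homog_comm[OF homog_gens(2,2)]] by blast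
  next
    case (E_x j l m)
    then show ?case
      using graded_rel_homog[OF webster_rels.E_x homog_comm[OF homog_gens(3,2)]] by blast
  next
    case (E_E j l m m')
    then show ?case
      using graded_rel_homog[OF webster_rels.E_E homog_comm[OF homog_gens(3,3)]] by blast
  next
    case (psi_x j l)
    then have j: "crs j" "pos l"
      by auto
    have "\<exists>k i1 i2. hloc (psi j * xx l * ee i) k i1 \<and> hloc (xx l * psi j * ee i) k i2" if "i \<in> Seq s n" for i
      using hloc_psi[OF hloc_xx[OF hloc_ee[OF that] j(2) refl] j(1) refl]
        hloc_xx[OF hloc_psi[OF hloc_ee[OF that] j(1) refl] j(2) refl]
      by (auto simp: mult.assoc)
    then show ?case
      using webster_rels.psi_x[OF psi_x(1-4)] by (intro graded_rel_on_e) auto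
  next
    case (psi_E j l m)
    then have j: "crs j" "pos l"
      by auto
    have "\<exists>k i1 i2. hloc (psi j * EE m l * ee i) k i1 \<and> hloc (EE m l * psi j * ee i) k i2" if "i \<in> Seq s n" for i
      using hloc_psi[OF hloc_EE[OF hloc_ee[OF that] j(2) refl, of m] j(1) refl]
        hloc_EE[OF hloc_psi[OF hloc_ee[OF that] j(1) refl] j(2) refl, of m]
      by (auto simp: mult.assoc)
    then show ?case
      using webster_rels.psi_E[OF psi_E(1-5)] by (intro graded_rel_on_e) auto
  next
    case (psi_E_left j m)
    then have j: "crs j" "pos j" "pos (Suc j)"
      by auto
    have "\<exists>k i1 i2. hloc (psi j * EE m j * ee i) k i1 \<and> hloc (EE m (j + 1) * psi j * ee i) k i2" if "i \<in> Seq s n" for i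
      using hloc_psi[OF hloc_EE[OF hloc_ee[OF that] j(2) refl, of m] j(1) refl]
        hloc_EE[OF hloc_psi[OF hloc_ee[OF that] j(1) refl] j(3) refl, of m]
      by (auto simp: mult.assoc)
    then show ?case
      using webster_rels.psi_E_left[OF psi_E_left(1-2)] by (intro graded_rel_on_e) auto
  next
    case (psi_E_right j m)
    then have j: "crs j" "pos j" "pos (Suc j)"
      by auto
    have "\<exists>k i1 i2. hloc (EE m j * psi j * ee i) k i1 \<and> hloc (psi j * EE m (j + 1) * ee i) k i2" if "i \<in> Seq s n" for i
      using hloc_psi[OF hloc_EE[OF hloc_ee[OF that] j(3) refl, of m] j(1) refl]
        hloc_EE[OF hloc_psi[OF hloc_ee[OF that] j(1) refl] j(2) refl, of m]
      by (auto simp: mult.assoc)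
    then show ?case
      using webster_rels.psi_E_right[OF psi_E_right(1-2)] by (intro graded_rel_on_e) auto
  next
    case (psi_psi_far j l)
    then have j: "crs j" "crs l"
      by auto
    have "\<exists>k i1 i2. hloc (psi j * psi l * ee i) k i1 \<and> hloc (psi l * psi j * ee i) k i2" if i: "i \<in> Seq s n" for i
    proof -
      have "entry (swap l i) j = entry i j" "entry (swap l i) (Suc j) = entry i (Suc j)"
        "entry (swap j i) l = entry i l" "entry (swap j i) (Suc l) = entry i (Suc l)"
        using psi_psi_far j length_Seq[OF i] by (auto intro!: entry_swap)
      then show ?thesis
        using hloc_psi[OF hloc_psi[OF hloc_ee[OF i] j(2) refl] j(1) refl]
          hloc_psi[OF hloc_psi[OF hloc_ee[OF i] j(1) refl] j(2) refl]
        by (auto simp: mult.assoc add.commute)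
    qed
    then show ?case
      using webster_rels.psi_psi_far[OF psi_psi_far(1-3)] by (intro graded_rel_on_e) auto
  next
    case (x_psi_bb i j)
    have "homog (xx j * psi j * ee i - psi j * xx (j + 1) * ee i - ee i) 0"
      unfolding mult.assoc by (intro homog_intros(3); (rule hloc_intros)+) (use x_psi_bb in auto)
    then show ?case
      using webster_rels.x_psi_bb[OF x_psi_bb(1-4)] by (intro graded_rel_homog)
  next
    case (x_psi_rb i j r)
    have "homog (xx j * psi j * ee i - psi j * xx (j + 1) * ee i) (int r + 2)"
      unfolding mult.assoc by (intro homog_intros(3); (rule hloc_intros)+) (use x_psi_rb in auto)
    then show ?case
      using webster_rels.x_psi_rb[OF x_psi_rb(1-4)] by (intro graded_rel_homog)
  next
    case (psi_x_bb i j)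
    have "homog (psi j * xx j * ee i - xx (j + 1) * psi j * ee i - ee i) 0"
      unfolding mult.assoc by (intro homog_intros(3); (rule hloc_intros)+) (use psi_x_bb in auto)
    then show ?case
      using webster_rels.psi_x_bb[OF psi_x_bb(1-4)] by (intro graded_rel_homog)
  next
    case (psi_x_br i j r)
    have "homog (psi j * xx j * ee i - xx (j + 1) * psi j * ee i) (int r + 2)"
      unfolding mult.assoc by (intro homog_intros(3); (rule hloc_intros)+) (use psi_x_br in auto)
    then show ?case
      using webster_rels.psi_x_br[OF psi_x_br(1-4)] by (intro graded_rel_homog)
  next
    case (psi_sq_bb i j)
    have "homog (psi j ^ 2 * ee i) (- 4)"
      unfolding mult.assoc power2_eq_square
      by ((rule hloc_intros)+) (use psi_sq_bb in \<open>auto simp: swap_same\<close>)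
    then show ?case
      using webster_rels.psi_sq_bb[OF psi_sq_bb(1-4)] by (intro graded_rel_homog)
  next
    case (psi_sq_rb i j r)
    then have sw: "entry (swap j i) j = Black" "entry (swap j i) (Suc j) = Red r"
      using entry_swap[of j i] length_Seq[of i] by auto
    have "homog (psi j ^ 2 * ee i) (2 * int r)"
      unfolding mult.assoc power2_eq_square
      by ((rule hloc_intros)+) (use psi_sq_rb sw in auto)
    moreover have "homog ((- 1) ^ m * EE m j * xx (j + 1) ^ (r - m) * ee i) (2 * int r)" if "m \<in> {0..r}" for m
      unfolding mult.assoc
      by ((rule hloc_intros)+) (use psi_sq_rb that in auto)
    ultimately show ?case
      using webster_rels.psi_sq_rb[OF psi_sq_rb(1-4)]
      by (intro graded_rel_homog homog_intros(3) homog_intros(7))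
  next
    case (psi_sq_br i j r)
    then have sw: "entry (swap j i) (Suc j) = Black" "entry (swap j i) j = Red r"
      using entry_swap[of j i] length_Seq[of i] by auto
    have "homog (psi j ^ 2 * ee i) (2 * int r)"
      unfolding mult.assoc power2_eq_square
      by ((rule hloc_intros)+) (use psi_sq_br sw in auto)
    moreover have "homog ((- 1) ^ m * xx j ^ (r - m) * EE m (j + 1) * ee i) (2 * int r)" if "m \<in> {0..r}" for m
      unfolding mult.assoc
      by ((rule hloc_intros)+) (use psi_sq_br that in auto)
    ultimately show ?case
      using webster_rels.psi_sq_br[OF psi_sq_br(1-4)]
      by (intro graded_rel_homog homog_intros(3) homog_intros(7))
  next
    case (braid_brb i j r)
    then have "homog ((psi j * psi (j + 1) * psi j - psi (j + 1) * psi j * psi (j + 1)) * ee i) (2 * int r - 2)"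
      using homog_braid[of i j] by simp
    moreover have "homog ((- 1) ^ d3 * xx j ^ d1 * EE d3 (j + 1) * xx (j + 2) ^ d2 * ee i) (2 * int r - 2)"
      if "d1 + d2 + d3 + 1 = r" for d1 d2 d3
      unfolding mult.assoc
      by ((rule hloc_intros)+) (use braid_brb that in auto)
    ultimately show ?case
      using webster_rels.braid_brb[OF braid_brb(1-6)]
      by (intro graded_rel_homog homog_intros(3) homog_intros(7)) auto
  next
    case (braid i j)
    then show ?case
      using homog_braid[of i j] webster_rels.braid[OF braid(1-4)]
      by (intro graded_rel_homog) auto
  qed
qed

lemma graded_cong:
  assumes "f \<in> C" "g \<in> C" "q f = q g"
  shows "graded f = graded g"
proof -
  have "f - g \<in> I"
    using q_eq_iff assms by simp
  then have "graded (f - g) = 0"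
    using hom_kills_I[where h = graded, OF graded_add graded_mult graded_rel] by blast
  then show ?thesis
    by (simp add: graded_diff)
qed

end

section \<open>Nilpotency of the differential\<close>

lemma funpow_additive:
  fixes \<delta> :: "'a::ab_group_add \<Rightarrow> 'a"
  assumes "\<And>a b. \<delta> (a + b) = \<delta> a + \<delta> b"
  shows "(\<delta> ^^ k) (a + b) = (\<delta> ^^ k) a + (\<delta> ^^ k) b" "(\<delta> ^^ k) 0 = 0"
    "(\<delta> ^^ k) (sum F S) = (\<Sum>x\<in>S. (\<delta> ^^ k) (F x))"
proof -
  have 0: "\<delta> 0 = 0"
    using assms[of 0 0] by simp
  show add: "(\<delta> ^^ k) (a + b) = (\<delta> ^^ k) a + (\<delta> ^^ k) b" for a b
    by (induction k) (simp_all add: assms)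
  show zero: "(\<delta> ^^ k) 0 = 0"
    by (induction k) (simp_all add: 0)
  show "(\<delta> ^^ k) (sum F S) = (\<Sum>x\<in>S. (\<delta> ^^ k) (F x))"
    by (induction S rule: infinite_finite_induct) (simp_all add: add zero)
qed

text \<open>\<open>T k j\<close> is the term reached after k steps, j of which took the second
  summand, so it is counted by a binomial coefficient. The Leibniz rule for d^p and the formula for
  d^p E(c) are both instances of the prime case.\<close>

lemma iterate_pascal:
  fixes \<delta> :: "'a::ring_1 \<Rightarrow> 'a" and T :: "nat \<Rightarrow> nat \<Rightarrow> 'a"
  assumes add: "\<And>a b. \<delta> (a + b) = \<delta> a + \<delta> b"
    and T: "\<And>k j. j \<le> k \<Longrightarrow> \<delta> (T k j) = T (Suc k) j + T (Suc k) (Suc j)"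
  shows "(\<delta> ^^ k) (T 0 0) = (\<Sum>j\<le>k. of_nat (k choose j) * T k j)"
proof (induction k)
  case (Suc k)
  have of_nat: "\<delta> (of_nat m * a) = of_nat m * \<delta> a" for m a
    using funpow_additive(2)[of \<delta> 1, OF add] by (induction m) (simp_all add: add distrib_right)
  have "(\<delta> ^^ Suc k) (T 0 0) = (\<Sum>j\<le>k. \<delta> (of_nat (k choose j) * T k j))"
    using funpow_additive(3)[of \<delta> 1, OF add] by (simp add: Suc)
  also have "\<dots> = (\<Sum>j\<le>k. of_nat (k choose j) * T (Suc k) j) + (\<Sum>j\<le>k. of_nat (k choose j) * T (Suc k) (Suc j))"
    by (simp add: of_nat T distrib_left sum.distrib)
  also have "(\<Sum>j\<le>k. of_nat (k choose j) * T (Suc k) j) =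
      T (Suc k) 0 + (\<Sum>j\<le>k. of_nat (k choose Suc j) * T (Suc k) (Suc j))"
    using sum.atMost_Suc_shift[of "\<lambda>j. of_nat (k choose j) * T (Suc k) j" k] by (simp add: binomial_eq_0)
  finally show ?case
    by (simp add: sum.atMost_Suc_shift distrib_right sum.distrib del: sum.atMost_Suc)
qed simp

lemma iterate_pascal_prime:
  fixes \<delta> :: "'a::ring_1 \<Rightarrow> 'a" and T :: "nat \<Rightarrow> nat \<Rightarrow> 'a"
  assumes add: "\<And>a b. \<delta> (a + b) = \<delta> a + \<delta> b"
    and T: "\<And>k j. j \<le> k \<Longrightarrow> \<delta> (T k j) = T (Suc k) j + T (Suc k) (Suc j)"
    and p: "prime p" "of_nat p = (0 :: 'a)"
  shows "(\<delta> ^^ p) (T 0 0) = T p 0 + T p p"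
proof -
  have "of_nat (p choose j) = (0 :: 'a)" if "j \<noteq> 0" "j < p" for j
  proof -
    have "p dvd p choose j"
      using that p by (intro dvd_choose_prime) auto
    then show ?thesis
      using p(2) by (auto simp: dvd_def)
  qed
  then have "(\<Sum>j\<le>p. of_nat (p choose j) * T p j) = (\<Sum>j\<in>{0, p}. of_nat (p choose j) * T p j)"
    by (intro sum.mono_neutral_right) auto
  then show ?thesis
    using iterate_pascal[of \<delta> T p, OF add T] prime_gt_0_nat[OF p(1)] by simp
qed

text \<open>One of p consecutive numbers is divisible by p.\<close>

lemma prime_dvd_pochhammer: "0 < p \<Longrightarrow> p dvd pochhammer a (p :: nat)"
proof -
  assume p: "0 < p"
  \<comment> \<open>The offset to the next multiple of p. The outer \<open>mod p\<close> covers the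
    case that p divides a, where the inner difference is p itself.\<close>
  define i where "i = (p - a mod p) mod p"
  have "i < p"
    using p by (simp add: i_def)
  moreover have "(a + i) mod p = 0"
  proof -
    have "(a + i) mod p = (a mod p + (p - a mod p)) mod p"
      by (simp add: i_def mod_simps)
    then show ?thesis
      using p by simp
  qed
  ultimately show ?thesis
    unfolding pochhammer_prod
    by (intro dvd_trans[OF _ dvd_prodI[of "{0..<p}" i]]) (auto simp: dvd_eq_mod_eq_0)
qed

lemma deriv_Leibniz_prime:
  assumes "prime p" "of_nat p = (0 :: 'g word \<Rightarrow>\<^sub>0 'k::field)"
  shows "(deriv D ^^ p) (f * g) = (deriv D ^^ p) f * g + f * (deriv D ^^ p) (g :: 'g word \<Rightarrow>\<^sub>0 'k)"
proof -
  let ?T = "\<lambda>k j. (deriv D ^^ j) f * (deriv D ^^ (k - j)) g"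
  have "(deriv D ^^ p) (?T 0 0) = ?T p 0 + ?T p p"
    by (rule iterate_pascal_prime[OF deriv_add _ assms]) (simp add: deriv_mult Suc_diff_le)
  then show ?thesis
    by simp
qed

text \<open>With \<open>a\<close> the iterates of \<open>\<delta> + E 1\<close> on 1, the \<open>p\<close>-th power of \<open>\<delta>\<close> multiplies every \<open>E m\<close> by
  \<open>a p\<close>; since \<open>E 0 = 1\<close> is constant, \<open>a p = 0\<close>.\<close>

primrec elem_iter :: "('a \<Rightarrow> 'a) \<Rightarrow> 'a \<Rightarrow> nat \<Rightarrow> 'a::ring_1" where
  "elem_iter \<delta> E1 0 = 1"
| "elem_iter \<delta> E1 (Suc k) = \<delta> (elem_iter \<delta> E1 k) + E1 * elem_iter \<delta> E1 k"

lemma elem_iter_prime: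
  fixes \<delta> :: "'a::ring_1 \<Rightarrow> 'a" and E :: "nat \<Rightarrow> 'a"
  assumes add: "\<And>a b. \<delta> (a + b) = \<delta> a + \<delta> b" and mult: "\<And>a b. \<delta> (a * b) = \<delta> a * b + a * \<delta> b"
    and E: "E 0 = 1" "\<And>m. \<delta> (E m) = E m * E 1 - of_nat (m + 1) * E (m + 1)"
    and p: "prime p" "of_nat p = (0 :: 'a)"
  shows "elem_iter \<delta> (E 1) p = 0" "(\<delta> ^^ p) (E c) = 0"
proof -
  let ?a = "elem_iter \<delta> (E 1)"
  have zero: "\<delta> 0 = 0"
    using add[of 0 0] by simp
  have one: "\<delta> 1 = 0"
    using mult[of 1 1] by simp
  have minus: "\<delta> (- a) = - \<delta> a" for a
    using add[of a "- a"] zero by (simp add: eq_neg_iff_add_eq_0 add.commute)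
  have of_nat: "\<delta> (of_nat m * a) = of_nat m * \<delta> a" for m a
    by (induction m) (simp_all add: zero add distrib_right)
  have sgn: "\<delta> ((- 1) ^ j * a) = (- 1) ^ j * \<delta> a" for j a
    by (induction j) (simp_all add: minus)
  have key: "(\<delta> ^^ p) (E c) = E c * ?a p" for c
  proof -
    \<comment> \<open>On \<open>E (c + j) * ?a (k - j)\<close> the derivation either extends the
      iterate or raises the index of \<open>E\<close> with the factor -(c + j + 1). After j raises
      these factors form a signed rising factorial; after p raises it is divisible by p, which
      leaves only \<open>E c * ?a p\<close>.\<close>
    let ?T = "\<lambda>k j. (- 1) ^ j * (of_nat (pochhammer (Suc c) j) * (E (c + j) * ?a (k - j)))"
    have "(\<delta> ^^ p) (?T 0 0) = ?T p 0 + ?T p p"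
    proof (rule iterate_pascal_prime[OF add _ p])
      fix k j :: nat assume j: "j \<le> k"
      have "\<delta> (E (c + j) * ?a (k - j)) =
          E (c + j) * ?a (Suc k - j) - of_nat (Suc c + j) * (E (c + Suc j) * ?a (Suc k - Suc j))"
        using j by (simp add: mult E(2) Suc_diff_le algebra_simps)
      then have "\<delta> (?T k j) = (- 1) ^ j * (of_nat (pochhammer (Suc c) j) * (E (c + j) * ?a (Suc k - j) -
          of_nat (Suc c + j) * (E (c + Suc j) * ?a (Suc k - Suc j))))"
        by (simp only: sgn of_nat)
      also have "\<dots> = ?T (Suc k) j - (- 1) ^ j * (of_nat (pochhammer (Suc c) j * (Suc c + j)) *
          (E (c + Suc j) * ?a (Suc k - Suc j)))"
        by (simp only: right_diff_distrib of_nat_mult mult.assoc)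
      also have "\<dots> = ?T (Suc k) j + ?T (Suc k) (Suc j)"
        by (simp add: pochhammer_Suc algebra_simps)
      finally show "\<delta> (?T k j) = ?T (Suc k) j + ?T (Suc k) (Suc j)" .
    qed
    moreover have "of_nat (pochhammer (Suc c) p) = (0 :: 'a)"
      using prime_dvd_pochhammer[OF prime_gt_0_nat[OF p(1)], of "Suc c"] p(2) by (auto simp: dvd_def)
    ultimately show ?thesis
      by simp
  qed
  have "(\<delta> ^^ p) (E 0) = 0"
  proof -
    obtain m where "p = Suc m"
      using prime_gt_0_nat[OF p(1)] gr0_conv_Suc by blast
    then show ?thesis
      using funpow_additive(2)[of \<delta> m, OF add] by (simp add: funpow_Suc_right E(1) one del: funpow.simps)
  qed
  then show "?a p = 0"
    using key[of 0] E(1) by simp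
  then show "(\<delta> ^^ p) (E c) = 0"
    using key by simp
qed

context webster
begin

lemma gens_C:
  "i \<in> Seq s n \<Longrightarrow> ee i \<in> C" "ee0 s n i \<in> C" "pos j \<Longrightarrow> xx j \<in> C" "pos j \<Longrightarrow> EE m j \<in> C" "crs j \<Longrightarrow> psi j \<in> C"
  using webster_gen_carrier by auto

lemma of_nat_scalar: "of_nat m = (scalar (of_nat m) :: 'k free)"
  by (simp add: scalar_def)

lemma of_nat_C: "of_nat m \<in> C"
  unfolding of_nat_scalar by (rule scalar_C)

lemma cross_val_C: "crs j \<Longrightarrow> cross_val a b j \<in> C"
  by (cases "(a, b, j)" rule: cross_val.cases)
    (auto simp: cross_val.simps intro!: C_closed(1-4) C_closed(5) free_carrier_closed' gens_C of_nat_C)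

lemma gen_val_C: "g \<in> webster_gens s n \<Longrightarrow> gen_val g \<in> C"
proof -
  have *: "gen_val (Elem m j) \<in> C" if "pos j" for m j
    unfolding gen_val.simps using that
    by (intro free_carrier_closed'(1) free_carrier_closed(6) gens_C of_nat_C)
  have **: "gen_val (Cross j) \<in> C" if "crs j" for j
    unfolding gen_val.simps using that
    by (intro free_carrier_closed'(3) free_carrier_closed(6) gens_C cross_val_C) auto
  assume "g \<in> webster_gens s n"
  then consider i where "g = Idempotent i" | j where "g = Dot j" "pos j" | m j where "g = Elem m j" "pos j"
    | j where "g = Cross j" "crs j"
    by (auto simp: webster_gens_def)
  then show ?thesis
  proof cases
    case 2
    then show ?thesis
      by (simp add: C_closed gens_C)
  qed (use * ** in \<open>simp_all add: C_closed del: gen_val.simps(3,4)\<close>)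
qed

lemma d_C: "f \<in> C \<Longrightarrow> d f \<in> C"
  by (rule deriv_C[OF gen_val_C])

lemma d_power_C: "f \<in> C \<Longrightarrow> (d ^^ k) f \<in> C"
  by (induction k) (simp_all add: d_C)

lemma d_cong:
  assumes "f \<in> C" "g \<in> C" "q f = q g"
  shows "q (d f) = q (d g)"
proof -
  have "d (f - g) \<in> I"
    using deriv_I[OF gen_val_C qd_rel, of "f - g"] q_eq_iff[OF assms(1,2)] assms(3) by simp
  then show ?thesis
    using q_eq_iff[OF d_C d_C] assms by (simp add: deriv_diff)
qed

lemma d_power_cong: "f \<in> C \<Longrightarrow> g \<in> C \<Longrightarrow> q f = q g \<Longrightarrow> q ((d ^^ k) f) = q ((d ^^ k) g)"
  by (induction k) (simp_all add: d_cong d_power_C)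

lemmas d_power_additive = funpow_additive[of d, OF deriv_add]

section \<open>Nilpotency on the generators\<close>

lemma cross_nilpotent_bb:
  assumes i: "i \<in> Seq s n" and j: "crs j" and b: "entry i j = Black" "entry i (Suc j) = Black"
    and p: "prime p" "of_nat p = (0 :: 'k free)"
  shows "q ((d ^^ p) (psi j * ee i)) = 0"
proof -
  note z = loc_e[OF i]
  have pos: "pos j" "pos (Suc j)"
    using j by auto
  let ?f1 = "- (xx j * (psi j * ee i)) - psi j * (xx (Suc j) * ee i) :: 'k free"
  let ?f2 = "of_nat 2 * (xx j * (psi j * (xx (Suc j) * ee i))) :: 'k free"
  have C: "psi j * ee i \<in> C" "?f1 \<in> C" "?f2 \<in> C"
    using i j pos by (intro C_closed(4) C_closed(3) free_carrier_closed'(1) free_carrier_closed(6) gens_C of_nat_C; simp)+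
  note rules = qd_add qd_mult qd_gen mult.assoc DP_bb[OF _ j b] z loc_X[OF _ pos(2)] distrib_left right_diff_distrib
  have 1: "q (d (psi j * ee i)) = q ?f1"
    by (simp add: rules q_hom)
  have 2: "q (d ?f1) = q ?f2"
    by (simp add: q_of_nat del: of_nat_numeral) (simp add: rules q_hom mult_2)
  \<comment> \<open>The product x_j psi_j x_(j+1) is a constant of the derivation: the squares from
    its two dots cancel the two terms of \<open>DP_bb\<close>.\<close>
  have "q (d ?f2) = of_nat 2 * q (d (xx j * (psi j * (xx (Suc j) * ee i))))"
    by (simp add: deriv_mult of_nat_scalar deriv_scalar del: of_nat_numeral flip: q_of_nat)
  also have "\<dots> = 0"
    by (simp add: rules q_hom(4))
  finally have 3: "q (d ?f2) = 0" .
  have q2: "q ((d ^^ 2) (psi j * ee i)) = q ?f2"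
    using d_cong[OF d_C[OF C(1)] C(2) 1] 2 by (simp add: numeral_2_eq_2)
  have q3: "q ((d ^^ 3) (psi j * ee i)) = 0"
    using d_cong[OF d_power_C[OF C(1)] C(3) q2] 3 by (simp add: numeral_3_eq_3 numeral_2_eq_2)
  show ?thesis
  proof (cases "p = 2")
    case True
    then show ?thesis
      using q2 p(2) by (simp add: q_hom)
  next
    case False
    then have "p = (p - 3) + 3"
      using prime_ge_2_nat[OF p(1)] by simp
    then have "(d ^^ p) (psi j * ee i) = (d ^^ (p - 3)) ((d ^^ 3) (psi j * ee i))"
      by (metis comp_apply funpow_add)
    then show ?thesis
      using d_power_cong[OF d_power_C[OF C(1)] C_closed(1), of 3 "p - 3"] q3
      by (simp add: d_power_additive q_hom)
  qed
qed

lemma cross_nilpotent_rb: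
  assumes i: "i \<in> Seq s n" and j: "crs j" and b: "entry i j = Red r" "entry i (Suc j) = Black"
    and p: "prime p" "of_nat p = (0 :: 'k free)"
  shows "q ((d ^^ p) (psi j * ee i)) = 0"
proof -
  note z = loc_e[OF i]
  have pos: "pos j" "pos (Suc j)"
    using j by auto
  let ?f = "\<lambda>k. of_nat (pochhammer r k) * (psi j * (xx (Suc j) ^ k * ee i)) :: 'k free"
  have C: "?f k \<in> C" for k
    using i j pos by (intro free_carrier_closed'(2) free_carrier_closed(6) gens_C of_nat_C)
  have C0: "psi j * ee i \<in> C"
    using i j by (intro free_carrier_closed(6) gens_C)
  have step: "q (d (?f k)) = q (?f (Suc k))" for k
  proof -
    have "q (d (?f k)) = of_nat (pochhammer r k) * q (d (psi j * (xx (Suc j) ^ k * ee i)))"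
      by (simp add: deriv_mult of_nat_scalar deriv_scalar flip: q_of_nat)
    also have "q (d (psi j * (xx (Suc j) ^ k * ee i))) =
      DP j * (xq (Suc j) ^ k * e i) + P j * (of_nat k * (xq (Suc j) ^ (k + 1) * e i))"
      unfolding qd_mult[of "psi j"] qd_xx_power q_xx_power by (simp add: qd_gen)
    also have "\<dots> = of_nat (r + k) * (P j * (xq (Suc j) ^ Suc k * e i))"
      using DP_rb[OF loc_X_power[OF z pos(2)] j b, of k] by (simp add: of_nat_left_commute distrib_right mult.assoc)
    also have "P j * (xq (Suc j) ^ Suc k * e i) = q (psi j * (xx (Suc j) ^ Suc k * ee i))"
      by (simp only: q_hom(4)[of "psi j"] q_xx_power)
    finally show ?thesis
      by (simp only: q_of_nat pochhammer_Suc of_nat_mult of_nat_id mult.assoc)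
  qed
  have "q ((d ^^ k) (psi j * ee i)) = q (?f k)" for k
  proof (induction k)
    case (Suc k)
    then show ?case
      using d_cong[OF d_power_C[OF C0] C Suc] step by simp
  qed simp
  moreover have "of_nat (pochhammer r p) = (0 :: 'k free)"
    using prime_dvd_pochhammer[OF prime_gt_0_nat[OF p(1)], of r] p(2) by (auto simp: dvd_def)
  ultimately show ?thesis
    by (simp add: q_hom)
qed

lemma cross_nilpotent_br:
  assumes i: "i \<in> Seq s n" and j: "crs j" and b: "entry i j = Black" "entry i (Suc j) = Red r"
    and p: "prime p" "of_nat p = (0 :: 'k free)"
  shows "q ((d ^^ p) (psi j * ee i)) = 0"
proof -
  note z = loc_e[OF i]
  have pos: "pos j" "pos (Suc j)"
    using j by auto
  let ?a = "elem_iter d (EE 1 (Suc j))"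
  let ?f = "\<lambda>k. psi j * (?a k * ee i)"
  have aC: "?a k \<in> C" for k
    by (induction k) (use pos in \<open>simp_all add: C_closed d_C gens_C\<close>)
  have C: "?f k \<in> C" for k
    using i j aC by (intro free_carrier_closed(6) gens_C)
  have C0: "psi j * ee i \<in> C"
    using i j by (intro free_carrier_closed(6) gens_C)
  have E1: "q (EE 1 (Suc j)) = E 1 (Suc j)"
    by (simp add: q_EE)
  \<comment> \<open>\<open>DP_br\<close> applies only to elements that start at \<open>i\<close>, so
    the iterates must commute with the idempotent. This property survives the differential because
    \<open>ee i\<close> has derivative 0.\<close>
  have a: "q (ee i * ?a k) = q (?a k * ee i)" for k
  proof (induction k)
    case (Suc k)
    have "q (d (ee i * ?a k)) = q (d (?a k * ee i))"
      by (rule d_cong[OF _ _ Suc]) (use i aC in \<open>auto intro!: free_carrier_closed(6) gens_C\<close>)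
    then have "e i * q (d (?a k)) = q (d (?a k)) * e i"
      by (simp add: qd_mult qd_gen)
    moreover have "e i * (E 1 (Suc j) * q (?a k)) = E 1 (Suc j) * (q (?a k) * e i)"
    proof -
      have "e i * (E 1 (Suc j) * q (?a k)) = E 1 (Suc j) * (e i * q (?a k))"
        by (simp only: E_e[OF i pos(2), of 1] flip: mult.assoc)
      then show ?thesis
        using Suc by (simp only: q_hom(4))
    qed
    ultimately show ?case
      using E1 by (simp add: q_hom distrib_left distrib_right mult.assoc)
  qed simp
  have loc: "loc (q (?a k) * e i) i" for k
    using i a[of k] e_e[OF i i] by (simp add: loc_def q_hom(4) flip: mult.assoc) (simp add: mult.assoc)
  have step: "q (d (?f k)) = q (?f (Suc k))" for k
  proof -
    have "q (d (?f k)) = DP j * (q (?a k) * e i) + P j * (q (d (?a k)) * e i)"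
      by (simp add: qd_mult qd_gen q_hom(4))
    also have "\<dots> = P j * (E 1 (Suc j) * (q (?a k) * e i)) + P j * (q (d (?a k)) * e i)"
      using DP_br[OF loc j b] by simp
    also have "\<dots> = q (?f (Suc k))"
      using E1 by (simp add: q_hom distrib_left distrib_right mult.assoc add.commute)
    finally show ?thesis .
  qed
  have "q ((d ^^ k) (psi j * ee i)) = q (?f k)" for k
  proof (induction k)
    case (Suc k)
    then show ?case
      using d_cong[OF d_power_C[OF C0] C Suc] step by simp
  qed simp
  moreover have "?a p = 0"
    using elem_iter_prime(1)[of d "\<lambda>m. EE m (Suc j)" p, OF deriv_add deriv_mult _ d_EE p] by (simp add: EE_def)
  ultimately show ?thesis
    by (simp add: q_hom)
qed

lemma nilpotent:
  assumes p: "prime p" "of_nat p = (0 :: 'k free)" and f: "f \<in> C"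
  shows "q ((d ^^ p) f) = 0"
proof -
  have const: "(d ^^ p) a = 0" if "d a = 0" for a
    using that d_power_additive(2)[of "p - 1"] prime_gt_0_nat[OF p(1)]
    by (metis Suc_diff_1 comp_apply funpow_Suc_right)
  show ?thesis
    using f
  proof (induction rule: free_algebra_induct)
    case (scalar c)
    then show ?case
      using const[OF deriv_scalar] by (simp add: q_hom)
  next
    case (gen g)
    then consider i where "g = Idempotent i" | j where "g = Dot j" | m j where "g = Elem m j" "1 \<le> m"
      | j where "g = Cross j" "crs j"
      by (auto simp: webster_gens_def)
    then show ?case
    proof cases
      case 1
      then show ?thesis
        using const[of "gen g"] by (simp add: deriv_gen q_hom)
    next
      case (2 j)
      have "(d ^^ k) (xx j) = of_nat (pochhammer 1 k) * xx j ^ Suc k" for k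
      proof (induction k)
        case (Suc k)
        have pow: "d (xx j ^ Suc m) = of_nat (Suc m) * xx j ^ Suc (Suc m)" for m
        proof (induction m)
          case (Suc m)
          have "d (xx j ^ Suc (Suc m)) = xx j * xx j * xx j ^ Suc m + xx j * (of_nat (Suc m) * xx j ^ Suc (Suc m))"
            unfolding power_Suc[of "xx j" "Suc m"] deriv_mult Suc by (simp add: deriv_gen)
          also have "xx j * (of_nat (Suc m) * xx j ^ Suc (Suc m)) = of_nat (Suc m) * (xx j * xx j ^ Suc (Suc m))"
            by (metis mult.assoc mult_of_nat_commute)
          finally show ?case
            by (simp add: algebra_simps)
        qed (simp add: deriv_gen)
        have "(d ^^ Suc k) (xx j) = of_nat (pochhammer 1 k) * d (xx j ^ Suc k)"
          by (simp only: funpow.simps comp_apply Suc deriv_mult) (simp add: of_nat_scalar deriv_scalar)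
        then show ?case
          unfolding pow by (simp only: pochhammer_Suc of_nat_mult mult.assoc) simp
      qed simp
      moreover have "of_nat (pochhammer 1 p) = (0 :: 'k free)"
        using prime_dvd_pochhammer[OF prime_gt_0_nat[OF p(1)], of 1] p(2) by (auto simp: dvd_def)
      ultimately show ?thesis
        using 2 by (simp add: q_hom)
    next
      case (3 m j)
      then have g: "gen g = EE m j"
        by (simp add: EE_def)
      have "EE 0 j = (1 :: 'k free)"
        by (simp add: EE_def)
      then show ?thesis
        using elem_iter_prime(2)[of d "\<lambda>m. EE m j" p m, OF deriv_add deriv_mult _ d_EE p]
        by (simp add: g q_hom)
    next
      case (4 j)
      have zero: "q ((d ^^ p) (psi j * ee i)) = 0" if i: "i \<in> Seq s n" for i
      proof (cases "entry i j"; cases "entry i (Suc j)")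
        fix r r' assume "entry i j = Red r" "entry i (Suc j) = Red r'"
        then have "q (psi j * ee i) = q 0"
          using psi_red_red[OF loc_e[OF i] 4(2)] by (simp add: q_hom)
        then show ?thesis
          using d_power_cong[of "psi j * ee i" 0 p] i 4(2)
          by (simp add: d_power_additive q_hom C_closed gens_C)
      qed (use cross_nilpotent_bb cross_nilpotent_rb cross_nilpotent_br i 4(2) p in blast)+
      have C: "psi j \<in> C" "(\<Sum>i\<in>Seq s n. psi j * ee i) \<in> C"
        using 4(2) by (auto intro!: free_carrier_closed'(3) free_carrier_closed(6) gens_C)
      have "q (psi j) = q (\<Sum>i\<in>Seq s n. psi j * ee i)"
        using q_1(2)[of "psi j"] by (simp add: q_hom unit_sum sum_distrib_left)
      then have "q ((d ^^ p) (psi j)) = q ((d ^^ p) (\<Sum>i\<in>Seq s n. psi j * ee i))"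
        by (rule d_power_cong[OF C])
      then show ?thesis
        using zero 4(1) by (simp add: d_power_additive q_hom)
    qed
  next
    case (add f g)
    then show ?case
      by (simp add: d_power_additive q_hom)
  next
    case (mult f g)
    then show ?case
      by (simp add: deriv_Leibniz_prime[OF p] q_hom)
  qed
qed

end

section \<open>The graded pieces\<close>

context presentation
begin

lemma submoduleI:
  assumes "H \<subseteq> carrier A" "cl 0 \<in> H"
    and "\<And>f g. f \<in> C \<Longrightarrow> g \<in> C \<Longrightarrow> cl f \<in> H \<Longrightarrow> cl g \<in> H \<Longrightarrow> cl (f + g) \<in> H"
    and scal: "\<And>a f. f \<in> C \<Longrightarrow> cl f \<in> H \<Longrightarrow> cl (scalar a * f) \<in> H"
  shows "submodule H K A"
proof (rule module.submoduleI[OF module_A])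
  have rep: "\<exists>f\<in>C. x = cl f" if "x \<in> H" for x
    using that assms(1) by (auto simp: carrier_A)
  show "\<ominus>\<^bsub>A\<^esub> x \<in> H" if x: "x \<in> H" for x
  proof -
    obtain f where f: "f \<in> C" "x = cl f"
      using rep[OF x] by blast
    have "\<ominus>\<^bsub>A\<^esub> cl f = cl (- f)"
      using f by (intro abelian_group.minus_equality[OF abelian_group_A]) (auto simp: carrier_A A_ops C_closed)
    moreover have "- f = scalar (- 1) * f"
      by (simp add: scalar_def single_uminus)
    ultimately show ?thesis
      using scal[of f "- 1"] x f by simp
  qed
  show "x \<oplus>\<^bsub>A\<^esub> y \<in> H" if "x \<in> H" "y \<in> H" for x y
    using rep[OF that(1)] rep[OF that(2)] that assms(3) by (auto simp: A_ops)
  show "a \<odot>\<^bsub>A\<^esub> x \<in> H" if "x \<in> H" for a x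
    using rep[OF that] that scal by (auto simp: A_ops)
qed (use assms A_ops in auto)

lemma submoduleE:
  assumes "submodule H K A"
  shows "H \<subseteq> carrier A" "cl 0 \<in> H"
    "f \<in> C \<Longrightarrow> g \<in> C \<Longrightarrow> cl f \<in> H \<Longrightarrow> cl g \<in> H \<Longrightarrow> cl (f + g) \<in> H"
    "f \<in> C \<Longrightarrow> cl f \<in> H \<Longrightarrow> cl (scalar a * f) \<in> H"
proof -
  note H = module.submoduleE[OF module_A assms]
  show "H \<subseteq> carrier A"
    by (rule H(1))
  show "cl 0 \<in> H"
    using subgroup.one_closed[OF submodule.axioms(1)[OF assms]] by (simp add: A_ops)
  show "f \<in> C \<Longrightarrow> g \<in> C \<Longrightarrow> cl f \<in> H \<Longrightarrow> cl g \<in> H \<Longrightarrow> cl (f + g) \<in> H"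
    using H(5)[of "cl f" "cl g"] by (simp add: A_ops)
  show "f \<in> C \<Longrightarrow> cl f \<in> H \<Longrightarrow> cl (scalar a * f) \<in> H"
    using H(4)[of a "cl f"] by (simp add: A_ops ring_of_type_algebra_def)
qed

lemma submodule_hull:
  assumes "S \<subseteq> carrier A"
  shows "submodule ((\<lambda>H. submodule H K A) hull S) K A"
proof (rule submoduleI)
  show "(\<lambda>H. submodule H K A) hull S \<subseteq> carrier A"
    by (rule hull_minimal) (use assms module.carrier_is_submodule[OF module_A] in auto)
qed (auto simp: hull_def dest: submoduleE)

end

context webster
begin

abbreviation G :: "int \<Rightarrow> 'k free set set" where "G \<equiv> webster_grading s n"

lemma webster_eq: "webster_algebra s n = A" "wcls s n f = cl f"
  by (simp_all add: webster_algebra_def wcls_def)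

lemma homgen_C: "(k, f) \<in> webster_hom_gens s n \<Longrightarrow> f \<in> C"
  by (induction k f rule: webster_hom_gens.induct)
    (auto intro!: gens_C free_carrier_closed(6))

lemma homgen_homog: "(k, f) \<in> webster_hom_gens s n \<Longrightarrow> homog f k"
proof (induction k f rule: webster_hom_gens.induct)
  case (4 i j)
  then show ?case
    using homog_hloc[OF hloc_psi[OF hloc_ee _ refl], of i j "- 2"] by simp
next
  case (5 i j r)
  then show ?case
    using homog_hloc[OF hloc_psi[OF hloc_ee _ refl], of i j "int r"] by simp
next
  case (6 i j r)
  then show ?case
    using homog_hloc[OF hloc_psi[OF hloc_ee _ refl], of i j "int r"] by simp
qed (simp_all add: homog_gens)

lemma prod_homgens:
  assumes "set hs \<subseteq> webster_hom_gens s n"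
  shows "prod_list (map snd hs) \<in> C" "homog (prod_list (map snd hs)) (sum_list (map fst hs))"
  using assms
  by (induction hs) (auto simp: C_closed homog_intros dest: homgen_C homgen_homog)

lemma G_prod: "set hs \<subseteq> webster_hom_gens s n \<Longrightarrow> sum_list (map fst hs) = k \<Longrightarrow> cl (prod_list (map snd hs)) \<in> G k"
  unfolding webster_grading_def webster_eq by (rule hull_inc) blast

lemma G_submodule: "submodule (G k) K A"
  unfolding webster_grading_def webster_eq
  by (rule submodule_hull) (use prod_homgens(1) in \<open>auto simp: carrier_A\<close>)

lemmas G_closed = submoduleE(2-)[OF G_submodule]

lemma G_carrier: "x \<in> G k \<Longrightarrow> x \<in> carrier A"
  using submoduleE(1)[OF G_submodule] by blast

lemma G_induct [consumes 1, case_names prod zero add scalar]: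
  assumes "x \<in> G k"
    and "\<And>hs. set hs \<subseteq> webster_hom_gens s n \<Longrightarrow> sum_list (map fst hs) = k \<Longrightarrow> Q (cl (prod_list (map snd hs)))"
    and "Q (cl 0)" "\<And>f g. f \<in> C \<Longrightarrow> g \<in> C \<Longrightarrow> Q (cl f) \<Longrightarrow> Q (cl g) \<Longrightarrow> Q (cl (f + g))"
    and "\<And>a f. f \<in> C \<Longrightarrow> Q (cl f) \<Longrightarrow> Q (cl (scalar a * f))"
  shows "Q x"
proof -
  have "x \<in> carrier A \<and> Q x"
    using assms(1) unfolding webster_grading_def webster_eq
  proof (rule hull_induct)
    show "submodule {x. x \<in> carrier A \<and> Q x} K A"
      by (rule submoduleI) (use assms(3-) in \<open>auto simp: carrier_A C_closed\<close>)
  qed (use assms(2) prod_homgens(1) in \<open>auto simp: carrier_A\<close>)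
  then show ?thesis
    by simp
qed

text \<open>Connects the spans that define the components with homogeneity as seen by the
  coaction.\<close>

lemma G_rep: "x \<in> G k \<Longrightarrow> \<exists>f\<in>C. x = cl f \<and> homog f k"
proof (induction rule: G_induct)
  case (prod hs)
  then show ?case
    using prod_homgens by blast
next
  case zero
  show ?case
    using C_closed(1) homog_intros(4) by blast
next
  case (add f g)
  then obtain f' g' where *: "f' \<in> C" "cl f = cl f'" "homog f' k" "g' \<in> C" "cl g = cl g'" "homog g' k"
    by blast
  then have "cl (f + g) = cl (f' + g')"
    using add by (metis A_ops(3))
  then show ?case
    using * by (intro bexI[of _ "f' + g'"]) (auto simp: C_closed(4) homog_intros(2))
next
  case (scalar a f)
  then obtain f' where *: "f' \<in> C" "cl f = cl f'" "homog f' k"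
    by blast
  then have "cl (scalar a * f) = cl (scalar a * f')"
    using scalar by (metis A_ops(5))
  moreover have "homog (scalar a * f') k"
    using homog_intros(1)[OF homog_intros(5) *(3), of a] by simp
  ultimately show ?case
    using *(1) by (intro bexI[of _ "scalar a * f'"]) (auto simp: C_closed(5,9))
qed

lemma G_cong: "f \<in> C \<Longrightarrow> g \<in> C \<Longrightarrow> q f = q g \<Longrightarrow> cl f \<in> G k \<Longrightarrow> cl g \<in> G k"
  by (metis cls_eq_iff)

lemma G_gens:
  "i \<in> Seq s n \<Longrightarrow> cl (ee i) \<in> G 0" "pos j \<Longrightarrow> cl (xx j) \<in> G 2"
  "pos j \<Longrightarrow> cl (EE m j) \<in> G (2 * int m)" "cl 1 \<in> G 0"
  "i \<in> Seq s n \<Longrightarrow> crs j \<Longrightarrow> entry i j = Black \<Longrightarrow> entry i (Suc j) = Black \<Longrightarrow> cl (psi j * ee i) \<in> G (- 2)"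
  "i \<in> Seq s n \<Longrightarrow> crs j \<Longrightarrow> entry i j = Red r \<Longrightarrow> entry i (Suc j) = Black \<Longrightarrow> cl (psi j * ee i) \<in> G (int r)"
  "i \<in> Seq s n \<Longrightarrow> crs j \<Longrightarrow> entry i j = Black \<Longrightarrow> entry i (Suc j) = Red r \<Longrightarrow> cl (psi j * ee i) \<in> G (int r)"
proof -
  have single: "cl f \<in> G k" if "(k, f) \<in> webster_hom_gens s n" for f k
    using G_prod[of "[(k, f)]" k] that by simp
  show one: "cl 1 \<in> G 0"
    using G_prod[of "[]" 0] by simp
  show "pos j \<Longrightarrow> cl (EE m j) \<in> G (2 * int m)"
    using single[OF webster_hom_gens.intros(3)[of j s n m]] one by (cases "m = 0") (simp_all add: EE_def)
  show "i \<in> Seq s n \<Longrightarrow> cl (ee i) \<in> G 0"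
    by (rule single[OF webster_hom_gens.intros(1)])
  show "pos j \<Longrightarrow> cl (xx j) \<in> G 2"
    by (rule single[OF webster_hom_gens.intros(2)]) simp
  show "i \<in> Seq s n \<Longrightarrow> crs j \<Longrightarrow> entry i j = Black \<Longrightarrow> entry i (Suc j) = Black \<Longrightarrow> cl (psi j * ee i) \<in> G (- 2)"
    by (rule single[OF webster_hom_gens.intros(4)]) simp_all
  show "i \<in> Seq s n \<Longrightarrow> crs j \<Longrightarrow> entry i j = Red r \<Longrightarrow> entry i (Suc j) = Black \<Longrightarrow> cl (psi j * ee i) \<in> G (int r)"
    by (rule single[OF webster_hom_gens.intros(5)]) simp_all
  show "i \<in> Seq s n \<Longrightarrow> crs j \<Longrightarrow> entry i j = Black \<Longrightarrow> entry i (Suc j) = Red r \<Longrightarrow> cl (psi j * ee i) \<in> G (int r)"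
    by (rule single[OF webster_hom_gens.intros(6)]) simp_all
qed

text \<open>Products of spanning elements are spanning elements by concatenation of their lists;
  linearity in each factor takes one induction each.\<close>

lemma G_mult: "f \<in> C \<Longrightarrow> g \<in> C \<Longrightarrow> cl f \<in> G k \<Longrightarrow> cl g \<in> G l \<Longrightarrow> cl (f * g) \<in> G (k + l)"
proof -
  have "\<forall>g\<in>C. cl g \<in> G l \<longrightarrow> x \<otimes>\<^bsub>A\<^esub> cl g \<in> G (k + l)" if "x \<in> G k" for x
    using that
  proof (induction rule: G_induct)
    case (prod hs)
    let ?f = "prod_list (map snd hs)"
    note f = prod_homgens(1)[OF prod(1)]
    have "cl ?f \<otimes>\<^bsub>A\<^esub> y \<in> G (k + l)" if "y \<in> G l" for y
      using that
    proof (induction rule: G_induct)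
      case (prod hs')
      then show ?case
        using G_prod[of "hs @ hs'" "k + l"] prod_homgens(1)[of hs'] \<open>set hs \<subseteq> _\<close> \<open>sum_list (map fst hs) = k\<close> f
        by (simp add: A_ops)
    next
      case zero
      then show ?case
        using f G_closed(1) by (simp add: A_ops C_closed)
    next
      case (add g g')
      then show ?case
        using f G_closed(2)[of "?f * g" "?f * g'"] by (simp add: A_ops C_closed distrib_left)
    next
      case (scalar a g)
      have "?f * (scalar a * g) = scalar a * (?f * g)"
        by (metis mult.assoc scalar_commute)
      then show ?case
        using scalar f G_closed(3)[of "?f * g"] by (simp add: A_ops C_closed)
    qed
    then show ?case
      by blast
  next
    case zero
    show ?case
      using G_closed(1) by (simp add: A_ops C_closed)
  next
    case (add f f')
    then show ?case
      using G_closed(2)[of "f * _" "f' * _"] by (auto simp: A_ops C_closed distrib_right)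
  next
    case (scalar a f)
    then show ?case
      using G_closed(3)[of "f * _"] by (auto simp: A_ops C_closed mult.assoc)
  qed
  then show "f \<in> C \<Longrightarrow> g \<in> C \<Longrightarrow> cl f \<in> G k \<Longrightarrow> cl g \<in> G l \<Longrightarrow> cl (f * g) \<in> G (k + l)"
    by (metis A_ops(4))
qed

text \<open>The existence half of the direct sum decomposition, expressed with \<open>q\<close> so
  that it passes between congruent representatives.\<close>

definition decomp :: "'k free \<Rightarrow> bool" where
  "decomp f \<longleftrightarrow> (\<exists>S F. finite S \<and> (\<forall>k. F k \<in> C \<and> cl (F k) \<in> G k) \<and> q f = (\<Sum>k\<in>S. q (F k)))"

lemma decomp_homog: "f \<in> C \<Longrightarrow> cl f \<in> G k \<Longrightarrow> decomp f"
  unfolding decomp_def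
  by (intro exI[of _ "{k}"] exI[of _ "\<lambda>l. if l = k then f else 0"]) (simp add: C_closed G_closed(1))

lemma decomp_cong: "q f = q g \<Longrightarrow> decomp g \<Longrightarrow> decomp f"
  by (simp add: decomp_def)

lemma decomp_add:
  assumes "decomp f" "decomp g"
  shows "decomp (f + g)"
proof -
  obtain S F where F: "finite S" "\<And>k. F k \<in> C \<and> cl (F k) \<in> G k" "q f = (\<Sum>k\<in>S. q (F k))"
    using assms(1) unfolding decomp_def by blast
  obtain S' F' where F': "finite S'" "\<And>k. F' k \<in> C \<and> cl (F' k) \<in> G k" "q g = (\<Sum>k\<in>S'. q (F' k))"
    using assms(2) unfolding decomp_def by blast
  let ?H = "\<lambda>k. (if k \<in> S then F k else 0) + (if k \<in> S' then F' k else 0)"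
  have "?H k \<in> C \<and> cl (?H k) \<in> G k" for k
    using F(2) F'(2) by (auto simp: C_closed intro!: G_closed)
  moreover have "q (f + g) = (\<Sum>k\<in>S \<union> S'. q (?H k))"
  proof -
    have "q f = (\<Sum>k\<in>S \<union> S'. if k \<in> S then q (F k) else 0)" "q g = (\<Sum>k\<in>S \<union> S'. if k \<in> S' then q (F' k) else 0)"
      unfolding F(3) F'(3) using F(1) F'(1) by (intro sum.mono_neutral_cong_left; auto)+
    then show ?thesis
      by (simp add: q_hom sum.distrib[symmetric] if_distrib[of q] cong: if_cong)
  qed
  ultimately show ?thesis
    unfolding decomp_def using F(1) F'(1) by (intro exI[of _ "S \<union> S'"] exI[of _ ?H]) simp
qed

lemma decomp_sum: "(\<And>a. a \<in> S \<Longrightarrow> decomp (F a)) \<Longrightarrow> decomp (sum F S)"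
  by (induction S rule: infinite_finite_induct)
    (auto intro: decomp_add decomp_homog[OF C_closed(1) G_closed(1)])

lemma decomp_C: "f \<in> C \<Longrightarrow> decomp f"
proof (induction rule: free_algebra_induct)
  case (scalar c)
  then show ?case
    using G_closed(3)[OF C_closed(2) G_gens(4), of c] by (intro decomp_homog[where k = 0]) (simp_all add: C_closed)
next
  case (gen g)
  then consider i where "g = Idempotent i" "i \<in> Seq s n" | j where "g = Dot j" "pos j"
    | m j where "g = Elem m j" "1 \<le> m" "pos j" | j where "g = Cross j" "crs j"
    by (auto simp: webster_gens_def)
  then show ?case
  proof cases
    case 1
    then show ?thesis
      using decomp_homog G_gens(1) gens_C(1) by blast
  next
    case 2
    then show ?thesis
      using decomp_homog G_gens(2) gens_C(3) by blast
  next
    case (3 m j)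
    then have "gen g = EE m j"
      by (simp add: EE_def)
    then show ?thesis
      using decomp_homog G_gens(3) gens_C(4) 3 by metis
  next
    case (4 j)
    have "q (psi j) = q (\<Sum>i\<in>Seq s n. psi j * ee i)"
      using q_1(2)[of "psi j"] by (simp add: q_hom unit_sum sum_distrib_left)
    moreover have "decomp (psi j * ee i)" if i: "i \<in> Seq s n" for i
    proof (cases "entry i j"; cases "entry i (Suc j)")
      fix r r' assume "entry i j = Red r" "entry i (Suc j) = Red r'"
      then have "q (psi j * ee i) = q 0"
        using psi_red_red[OF loc_e[OF i] 4(2)] by (simp add: q_hom)
      then show ?thesis
        using decomp_cong decomp_homog[OF C_closed(1) G_closed(1)] by blast
    qed (use decomp_homog[OF free_carrier_closed(6)[OF gens_C(5) gens_C(1)]] G_gens(5-7) i 4(2) in blast)+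
    ultimately show ?thesis
      using decomp_cong[OF _ decomp_sum] 4(1) by blast
  qed
next
  case (add f g)
  then show ?case
    by (simp add: decomp_add)
next
  case (mult f g)
  obtain S F where F: "finite S" "\<And>k. F k \<in> C \<and> cl (F k) \<in> G k" "q f = (\<Sum>k\<in>S. q (F k))"
    using mult(3) unfolding decomp_def by blast
  obtain S' F' where F': "finite S'" "\<And>k. F' k \<in> C \<and> cl (F' k) \<in> G k" "q g = (\<Sum>k\<in>S'. q (F' k))"
    using mult(4) unfolding decomp_def by blast
  have eq: "q (f * g) = q (\<Sum>k\<in>S. \<Sum>l\<in>S'. F k * F' l)"
    by (simp add: q_hom F(3) F'(3) sum_product)
  have dec: "decomp (F k * F' l)" for k l
    by (rule decomp_homog[OF _ G_mult[of "F k" "F' l" k l]]) (use F(2) F'(2) in \<open>simp_all add: C_closed(5)\<close>)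
  show ?case
    by (rule decomp_cong[OF eq decomp_sum[OF decomp_sum[OF dec]]])
qed

text \<open>\<open>graded_algebra\<close> sums over the exact support of a family of classes; any
  finite index set containing the support gives the same sum.\<close>

lemma finsum_support:
  assumes "finite S" "\<And>k. F k \<in> C" "\<And>k. k \<notin> S \<Longrightarrow> q (F k) = 0"
  shows "finite {k. cl (F k) \<noteq> \<zero>\<^bsub>A\<^esub>}"
    "finsum A (\<lambda>k. cl (F k)) {k. cl (F k) \<noteq> \<zero>\<^bsub>A\<^esub>} = cl (sum F S)"
proof -
  have zero: "cl (F k) = \<zero>\<^bsub>A\<^esub> \<longleftrightarrow> q (F k) = 0" for k
    using cls_eq_iff[OF assms(2) C_closed(1)] by (simp add: A_ops q_hom)
  have sub: "{k. cl (F k) \<noteq> \<zero>\<^bsub>A\<^esub>} \<subseteq> S"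
    using zero assms(3) by auto
  show fin: "finite {k. cl (F k) \<noteq> \<zero>\<^bsub>A\<^esub>}"
    using sub assms(1) by (rule finite_subset)
  have "q (sum F {k. cl (F k) \<noteq> \<zero>\<^bsub>A\<^esub>}) = q (sum F S)"
    unfolding q_hom by (rule sum.mono_neutral_left[OF assms(1) sub]) (simp add: zero)
  moreover have "sum F T \<in> C" for T
    by (rule C_closed(8)) (rule assms(2))
  ultimately have "cl (sum F {k. cl (F k) \<noteq> \<zero>\<^bsub>A\<^esub>}) = cl (sum F S)"
    by (simp add: cls_eq_iff)
  then show "finsum A (\<lambda>k. cl (F k)) {k. cl (F k) \<noteq> \<zero>\<^bsub>A\<^esub>} = cl (sum F S)"
    using finsum_A[OF fin, of F] assms(2) by simp
qed

text \<open>The uniqueness half of the direct sum decomposition: the coefficient of the coaction of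
  \<open>f\<close> that determines \<open>c k\<close> does not depend on the choice of
  \<open>c\<close>.\<close>

lemma component:
  assumes c: "\<And>k. c k \<in> G k" and fin: "finite {k. c k \<noteq> \<zero>\<^bsub>A\<^esub>}"
    and a: "cl f = finsum A c {k. c k \<noteq> \<zero>\<^bsub>A\<^esub>}" and f: "f \<in> C"
  shows "\<exists>g\<in>C. c k = cl g \<and> q g = Poly_Mapping.lookup (graded f) k"
proof -
  have "\<forall>k. \<exists>g. g \<in> C \<and> c k = cl g \<and> homog g k"
    using G_rep[OF c] by blast
  then obtain F where F: "\<And>k. F k \<in> C" "\<And>k. c k = cl (F k)" "\<And>k. homog (F k) k"
    by metis
  let ?S = "{k. c k \<noteq> \<zero>\<^bsub>A\<^esub>}"
  have zero: "q (F k) = 0" if "k \<notin> ?S" for k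
    using that cls_eq_iff[OF F(1) C_closed(1)] F(2) by (simp add: A_ops q_hom)
  have "c = (\<lambda>k. cl (F k))"
    using F(2) by blast
  then have "cl f = cl (sum F ?S)"
    using a finsum_support(2)[OF fin F(1) zero] by simp
  moreover have C: "sum F ?S \<in> C"
    by (rule C_closed(8)) (rule F(1))
  ultimately have "graded f = graded (sum F ?S)"
    by (intro graded_cong f C) (simp add: cls_eq_iff[OF f C])
  also have "\<dots> = (\<Sum>l\<in>?S. Poly_Mapping.single l (q (F l)))"
    using F(3) by (simp add: graded_sum homog_def)
  finally have "Poly_Mapping.lookup (graded f) k = (\<Sum>l\<in>?S. if l = k then q (F k) else 0)"
    by (simp add: lookup_sum lookup_single when_def) (intro sum.cong, auto)
  also have "\<dots> = q (F k)"
    using zero[of k] fin by (simp add: sum.delta)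
  finally show ?thesis
    using F by metis
qed

lemma graded_algebra_A: "graded_algebra K A G"
  unfolding graded_algebra_def
proof (intro conjI allI ballI)
  show "assoc_algebra K A"
    by (rule assoc_algebra_A)
  show "submodule (G k) K A" for k
    by (rule G_submodule)
  show "\<one>\<^bsub>A\<^esub> \<in> G 0"
    using G_gens(4) by (simp add: A_ops)
  show "x \<otimes>\<^bsub>A\<^esub> y \<in> G (k + l)" if x: "x \<in> G k" and y: "y \<in> G l" for k l x y
  proof -
    obtain f g where "f \<in> C" "x = cl f" "g \<in> C" "y = cl g"
      using G_carrier[OF x] G_carrier[OF y] by (auto simp: carrier_A)
    then show ?thesis
      using G_mult x y by (simp add: A_ops)
  qed
  fix x assume "x \<in> carrier A"
  then obtain f where f: "f \<in> C" "x = cl f"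
    by (auto simp: carrier_A)
  show "\<exists>!c. (\<forall>k. c k \<in> G k) \<and> finite {k. c k \<noteq> \<zero>\<^bsub>A\<^esub>} \<and> x = finsum A c {k. c k \<noteq> \<zero>\<^bsub>A\<^esub>}"
  proof (rule ex_ex1I)
    obtain S F where F: "finite S" "\<And>k. F k \<in> C \<and> cl (F k) \<in> G k" "q f = (\<Sum>k\<in>S. q (F k))"
      using decomp_C[OF f(1)] unfolding decomp_def by blast
    let ?F = "\<lambda>k. if k \<in> S then F k else 0"
    have C: "?F k \<in> C" for k
      using F(2) by (simp add: C_closed(1))
    have "cl (?F k) \<in> G k" for k
      using F(2) G_closed(1) by simp
    moreover have "finite {k. cl (?F k) \<noteq> \<zero>\<^bsub>A\<^esub>}"
      "finsum A (\<lambda>k. cl (?F k)) {k. cl (?F k) \<noteq> \<zero>\<^bsub>A\<^esub>} = cl (sum ?F S)"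
      using finsum_support[OF F(1), of ?F] C by (simp_all add: q_hom)
    moreover have "cl (sum ?F S) = x"
      using cls_eq_iff[OF C_closed(8)[of S ?F, OF C] f(1)] F(3) f(2) by (simp add: q_hom)
    ultimately show "\<exists>c. (\<forall>k. c k \<in> G k) \<and> finite {k. c k \<noteq> \<zero>\<^bsub>A\<^esub>} \<and> x = finsum A c {k. c k \<noteq> \<zero>\<^bsub>A\<^esub>}"
      by (intro exI[of _ "\<lambda>k. cl (?F k)"]) auto
  next
    fix c c' assume *: "(\<forall>k. c k \<in> G k) \<and> finite {k. c k \<noteq> \<zero>\<^bsub>A\<^esub>} \<and> x = finsum A c {k. c k \<noteq> \<zero>\<^bsub>A\<^esub>}"
      "(\<forall>k. c' k \<in> G k) \<and> finite {k. c' k \<noteq> \<zero>\<^bsub>A\<^esub>} \<and> x = finsum A c' {k. c' k \<noteq> \<zero>\<^bsub>A\<^esub>}"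
    show "c = c'"
    proof
      fix k
      have "\<exists>g\<in>C. c k = cl g \<and> q g = Poly_Mapping.lookup (graded f) k"
        "\<exists>g\<in>C. c' k = cl g \<and> q g = Poly_Mapping.lookup (graded f) k"
        using * f by (intro component; blast)+
      then show "c k = c' k"
        by (metis cls_eq_iff)
    qed
  qed
qed

section \<open>The degree of the differential\<close>

lemma homgen_deriv:
  assumes "(k, f) \<in> webster_hom_gens s n"
  shows "cl (d f) \<in> G (k + 2)"
  using assms
proof (induction k f rule: webster_hom_gens.induct)
  case (1 i)
  then show ?case
    using G_closed(1) by (simp add: deriv_gen)
next
  case (2 j)
  then show ?case
    using G_mult[OF gens_C(3) gens_C(3) G_gens(2) G_gens(2), of j j] by (simp add: deriv_gen)
next
  case (3 j m)
  then have j: "pos j"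
    by simp
  have "cl (EE m j * EE 1 j + scalar (- of_nat (m + 1)) * EE (m + 1) j) \<in> G (2 * int m + 2)"
    using G_mult[OF gens_C(4)[OF j] gens_C(4)[OF j] G_gens(3)[OF j] G_gens(3)[OF j], of m 1] G_gens(3)[OF j, of "m + 1"]
    by (intro G_closed free_carrier_closed(6) gens_C scalar_C j) (simp_all add: algebra_simps)
  moreover have "scalar (- of_nat (m + 1)) = - (of_nat (m + 1) :: 'k free)"
    by (simp only: of_nat_scalar scalar_def single_uminus)
  ultimately show ?case
    by (simp only: d_EE mult_minus_left add_uminus_conv_diff)
next
  case (4 i j)
  then have j: "crs j" "pos j" "pos (Suc j)" and z: "loc (e i) i" and b: "entry i j = Black" "entry i (Suc j) = Black"
    by (auto intro: loc_e)
  note c = gens_C(1)[OF 4(1)] gens_C(5)[OF j(1)] gens_C(3)[OF j(2)] gens_C(3)[OF j(3)]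
  \<comment> \<open>The dot is written to the right of the idempotent, since only the product
    \<open>psi j * ee i\<close>, and not \<open>psi j\<close>, is a homogeneous generator.\<close>
  let ?g = "scalar (- 1) * (xx j * (psi j * ee i)) + scalar (- 1) * ((psi j * ee i) * xx (Suc j))"
  have "cl ?g \<in> G 0"
    using G_mult[OF _ _ G_gens(2)[OF j(2)] G_gens(5)[OF 4(1) j(1) b]] G_mult[OF _ _ G_gens(5)[OF 4(1) j(1) b] G_gens(2)[OF j(3)]]
    by (intro G_closed C_closed(5) scalar_C c) (simp_all add: C_closed c)
  moreover have "scalar (- 1) = (- 1 :: 'k free)"
    by (simp add: scalar_def single_uminus)
  then have "q ?g = q (d (psi j * ee i))"
    using DP_bb[OF z j(1) b] x_e[OF 4(1) j(3)] by (simp add: q_hom qd_mult qd_gen mult.assoc)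
  ultimately show ?case
    using G_cong[of ?g "d (psi j * ee i)" 0] by (simp add: C_closed c d_C)
next
  case (5 i j r)
  then have j: "crs j" "pos j" "pos (Suc j)" and z: "loc (e i) i" and b: "entry i j = Red r" "entry i (Suc j) = Black"
    by (auto intro: loc_e)
  note c = gens_C(1)[OF 5(1)] gens_C(5)[OF j(1)] gens_C(3)[OF j(3)]
  let ?g = "of_nat r * ((psi j * ee i) * xx (Suc j))"
  have "cl ?g \<in> G (int r + 2)"
    unfolding of_nat_scalar using G_mult[OF _ _ G_gens(6)[OF 5(1) j(1) b] G_gens(2)[OF j(3)]]
    by (intro G_closed C_closed(5) scalar_C c) (simp_all add: C_closed c)
  moreover have "q ?g = q (d (psi j * ee i))"
    unfolding q_of_nat using DP_rb[OF z j(1) b] x_e[OF 5(1) j(3)] by (simp add: q_hom qd_mult qd_gen mult.assoc)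
  ultimately show ?case
    using G_cong[of ?g "d (psi j * ee i)" "int r + 2"] by (simp add: C_closed c d_C of_nat_C)
next
  case (6 i j r)
  then have j: "crs j" "pos j" "pos (Suc j)" and z: "loc (e i) i" and b: "entry i j = Black" "entry i (Suc j) = Red r"
    by (auto intro: loc_e)
  note c = gens_C(1)[OF 6(1)] gens_C(5)[OF j(1)] gens_C(4)[OF j(3)]
  let ?g = "(psi j * ee i) * EE 1 (Suc j)"
  have "cl ?g \<in> G (int r + 2)"
    using G_mult[OF _ _ G_gens(7)[OF 6(1) j(1) b] G_gens(3)[OF j(3), of 1]] by (simp add: C_closed c)
  moreover have "q ?g = q (d (psi j * ee i))"
    using DP_br[OF z j(1) b] E_e[OF 6(1) j(3), of 1] by (simp add: q_hom q_EE qd_mult qd_gen mult.assoc)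
  ultimately show ?case
    using G_cong[of ?g "d (psi j * ee i)" "int r + 2"] by (simp add: C_closed c d_C)
qed

lemma prod_deriv:
  "set hs \<subseteq> webster_hom_gens s n \<Longrightarrow> cl (d (prod_list (map snd hs))) \<in> G (sum_list (map fst hs) + 2)"
proof (induction hs)
  case Nil
  show ?case
    by (simp only: list.map prod_list.Nil deriv_1 G_closed(1))
next
  case (Cons h hs)
  obtain k f where h: "h = (k, f)"
    by (cases h)
  let ?g = "prod_list (map snd hs)" and ?l = "sum_list (map fst hs)"
  have kf: "(k, f) \<in> webster_hom_gens s n" "set hs \<subseteq> webster_hom_gens s n"
    using Cons(2) h by auto
  note f = homgen_C[OF kf(1)] and g = prod_homgens(1)[OF kf(2)]
  have "cl f \<in> G k"
    using G_prod[of "[(k, f)]" k] kf(1) by simp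
  then have "cl (f * d ?g) \<in> G (k + (?l + 2))"
    by (rule G_mult[OF f d_C[OF g] _ Cons(1)[OF kf(2)]])
  moreover have "cl (d f * ?g) \<in> G (k + 2 + ?l)"
    by (rule G_mult[OF d_C[OF f] g homgen_deriv[OF kf(1)] G_prod[OF kf(2) refl]])
  moreover have "k + 2 + ?l = k + ?l + 2" "k + (?l + 2) = k + ?l + 2"
    by simp_all
  ultimately have "cl (d f * ?g + f * d ?g) \<in> G (k + ?l + 2)"
    by (simp only: G_closed(2) C_closed(5) f g d_C)
  then show ?case
    by (simp only: h list.map prod_list.Cons sum_list.Cons fst_conv snd_conv deriv_mult)
qed

lemma cl_d_cong:
  assumes "f \<in> C" "g \<in> C" "cl f = cl g"
  shows "cl (d f) = cl (d g)"
proof -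
  have "q f = q g"
    using assms by (simp only: cls_eq_iff)
  then have "q (d f) = q (d g)"
    by (rule d_cong[OF assms(1,2)])
  then show ?thesis
    by (simp only: cls_eq_iff[OF d_C[OF assms(1)] d_C[OF assms(2)]])
qed

text \<open>\<open>G_induct\<close> is about classes, while \<open>d\<close> acts on
  representatives. The induction therefore speaks of all representatives of a class; their
  derivatives agree by \<open>cl_d_cong\<close>.\<close>

lemma deriv_degree:
  assumes "f \<in> C" "cl f \<in> G k"
  shows "cl (d f) \<in> G (k + 2)"
proof -
  have rep: "\<forall>g\<in>C. cl f = cl g \<longrightarrow> cl (d g) \<in> G (k + 2)" if "f \<in> C" "cl (d f) \<in> G (k + 2)" for f
    using cl_d_cong[OF that(1)] that(2) by force
  have "\<forall>g\<in>C. x = cl g \<longrightarrow> cl (d g) \<in> G (k + 2)" if "x \<in> G k" for x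
    using that
  proof (induction rule: G_induct)
    case (prod hs)
    then show ?case
      using rep[OF prod_homgens(1)] prod_deriv[of hs] by blast
  next
    case zero
    show ?case
      by (rule rep[OF C_closed(1)]) (simp only: deriv_0 G_closed(1))
  next
    case (add f g)
    then have "cl (d f) \<in> G (k + 2)" "cl (d g) \<in> G (k + 2)"
      by blast+
    then show ?case
      by (intro rep C_closed(4) add) (simp only: deriv_add G_closed(2) d_C add)
  next
    case (scalar a f)
    then have "cl (d f) \<in> G (k + 2)"
      by blast
    then show ?case
      by (intro rep C_closed(5,9) scalar) (simp only: deriv_scalar_mult G_closed(3) d_C scalar)
  qed
  then show ?thesis
    using assms by blast
qed

section \<open>The p-DG structure\<close>

lemma psi_sum: "q (psi j) = q (\<Sum>i\<in>Seq s n. psi j * ee i)" "q (EE m j) = q (\<Sum>i\<in>Seq s n. EE m j * ee i)"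
  using q_1(2)[of "psi j"] q_1(2)[of "EE m j"] by (simp_all add: q_hom unit_sum sum_distrib_left)

lemma d_values:
  assumes i: "i \<in> Seq s n"
  shows "pos j \<Longrightarrow> entry i j = Red m \<Longrightarrow> q (d (EE m j * ee i)) = q (EE m j * EE 1 j * ee i)"
    "crs j \<Longrightarrow> entry i j = Black \<Longrightarrow> entry i (Suc j) = Black \<Longrightarrow>
      q (d (psi j * ee i)) = q (- (xx j * psi j * ee i) - psi j * xx (Suc j) * ee i)"
    "crs j \<Longrightarrow> entry i j = Red r \<Longrightarrow> entry i (Suc j) = Black \<Longrightarrow>
      q (d (psi j * ee i)) = q (of_nat r * psi j * xx (Suc j) * ee i)"
    "crs j \<Longrightarrow> entry i j = Black \<Longrightarrow> entry i (Suc j) = Red r \<Longrightarrow>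
      q (d (psi j * ee i)) = q (psi j * EE 1 (Suc j) * ee i)"
proof -
  note z = loc_e[OF i]
  show "q (d (EE m j * ee i)) = q (EE m j * EE 1 j * ee i)" if "pos j" "entry i j = Red m"
    using E_large[OF z that, of "m + 1"]
    by (simp add: qd_mult qd_gen DE_def left_diff_distrib mult.assoc q_EE)
  show "crs j \<Longrightarrow> entry i j = Black \<Longrightarrow> entry i (Suc j) = Black \<Longrightarrow>
      q (d (psi j * ee i)) = q (- (xx j * psi j * ee i) - psi j * xx (Suc j) * ee i)"
    using DP_bb[OF z] by (simp add: qd_mult qd_gen q_hom mult.assoc)
  show "crs j \<Longrightarrow> entry i j = Red r \<Longrightarrow> entry i (Suc j) = Black \<Longrightarrow>
      q (d (psi j * ee i)) = q (of_nat r * psi j * xx (Suc j) * ee i)"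
    using DP_rb[OF z] by (simp add: mult.assoc q_of_nat) (simp add: qd_mult qd_gen q_hom(4))
  show "crs j \<Longrightarrow> entry i j = Black \<Longrightarrow> entry i (Suc j) = Red r \<Longrightarrow>
      q (d (psi j * ee i)) = q (psi j * EE 1 (Suc j) * ee i)"
    using DP_br[OF z] by (simp add: qd_mult qd_gen q_hom(4) q_EE mult.assoc)
qed

lemma d_E_value: "d (EE m j * ee i) = (EE m j * EE 1 j - of_nat (m + 1) * EE (m + 1) j) * ee i"
  by (simp only: deriv_mult d_EE) (simp add: deriv_gen)

text \<open>A linear derivation is determined by its values on generators. For E(m) and the
  crossings these are given only after multiplication by idempotents, so each generator is first
  recovered as the sum of its pieces. Pieces without a prescribed value are zero in the
  algebra.\<close>

lemma differential_eq:
  assumes \<delta>: "webster_differential s n \<delta>" and f: "f \<in> C"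
  shows "\<delta> (cl f) = cl (d f)"
proof -
  note D = \<delta>[unfolded webster_differential_def webster_eq derivation_def]
  have carr: "\<delta> (cl f) \<in> carrier A" if "f \<in> C" for f
    using D that by (auto simp: carrier_A)
  have cl_add: "\<delta> (cl (f + g)) = \<delta> (cl f) \<oplus>\<^bsub>A\<^esub> \<delta> (cl g)" if "f \<in> C" "g \<in> C" for f g
    using D that by (auto simp: carrier_A simp flip: A_ops(3))
  have cl_mult: "\<delta> (cl (f * g)) = \<delta> (cl f) \<otimes>\<^bsub>A\<^esub> cl g \<oplus>\<^bsub>A\<^esub> cl f \<otimes>\<^bsub>A\<^esub> \<delta> (cl g)" if "f \<in> C" "g \<in> C" for f g
    using D that by (auto simp: carrier_A simp flip: A_ops(4))
  have cl_scalar: "\<delta> (cl (scalar a * f)) = a \<odot>\<^bsub>A\<^esub> \<delta> (cl f)" if "f \<in> C" for a f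
    using D that by (auto simp: carrier_A ring_of_type_algebra_def simp flip: A_ops(5))
  define Q where "Q f \<longleftrightarrow> \<delta> (cl f) = cl (d f)" for f
  have Q_add: "Q (f + g)" if "f \<in> C" "g \<in> C" "Q f" "Q g" for f g
    using that by (simp add: Q_def cl_add A_ops d_C deriv_add)
  have Q_mult: "Q (f * g)" if "f \<in> C" "g \<in> C" "Q f" "Q g" for f g
    using that by (simp add: Q_def cl_mult A_ops d_C deriv_mult C_closed(5))
  have Q_scalar: "Q (scalar a * f)" if "f \<in> C" "Q f" for a f
    using that by (simp add: Q_def cl_scalar A_ops d_C deriv_scalar_mult)
  have Q_cong: "Q f" if "f \<in> C" "g \<in> C" "q f = q g" "Q g" for f g
  proof -
    have eq: "cl f = cl g"
      using that(3) by (simp only: cls_eq_iff[OF that(1,2)])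
    show ?thesis
      using that(4) cl_d_cong[OF that(1,2) eq] by (simp only: Q_def eq)
  qed
  have Q_1: "Q 1"
  proof -
    obtain g where g: "g \<in> C" "\<delta> (cl 1) = cl g"
      using carr[OF C_closed(2)] by (auto simp: carrier_A)
    \<comment> \<open>The Leibniz rule for 1 = 1 * 1 doubles the value at 1, which is therefore
      zero; by linearity so are the values at all scalars.\<close>
    then have "cl g = cl (g + g)"
      using cl_mult[OF C_closed(2) C_closed(2)] by (simp add: A_ops C_closed)
    then have "q g = q 0"
      using g(1) by (simp add: cls_eq_iff C_closed q_hom)
    then have "cl g = cl 0"
      using g(1) by (simp add: cls_eq_iff C_closed)
    then show ?thesis
      using g(2) by (simp add: Q_def deriv_1)
  qed
  have Q_0: "Q 0"
    using Q_scalar[OF C_closed(2) Q_1, of 0] by (simp add: scalar_hom)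
  have Q_sum: "Q (sum F S)" if "\<And>a. a \<in> S \<Longrightarrow> F a \<in> C \<and> Q (F a)" for F and S :: "letter list set"
    using that
    by (induction S rule: infinite_finite_induct) (simp_all add: Q_0 Q_add C_closed(8))
  have Q_value: "Q f" if "f \<in> C" "g \<in> C" "\<delta> (cl f) = cl g" "q (d f) = q g" for f g
    using that(3,4) by (simp only: Q_def cls_eq_iff[OF that(2) d_C[OF that(1)]])
  have Q_E: "Q (EE m j * ee i)" if i: "i \<in> Seq s n" and j: "pos j" and m: "1 \<le> m" for m j i
  proof -
    note z = loc_e[OF i]
    note C = gens_C(1)[OF i] gens_C(4)[OF j] free_carrier_closed(6)[OF gens_C(4)[OF j] gens_C(1)[OF i]]
    show ?thesis
    proof (cases "entry i j")
      case Black
      then show ?thesis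
        using E_black[OF z j Black m] by (intro Q_cong[OF C(3) C_closed(1) _ Q_0]) (simp only: q_EE(1) q_hom(5))
    next
      case (Red r)
      consider "m < r" | "m = r" | "r < m"
        by linarith
      then show ?thesis
      proof cases
        case 1
        then show ?thesis
          using D i j m Red unfolding Q_def d_E_value by simp
      next
        case 2
        have "\<delta> (cl (EE m j * ee i)) = cl (EE m j * EE 1 j * ee i)"
          using D i j m Red 2 by simp
        then show ?thesis
          using d_values(1)[OF i j] Red 2 by (intro Q_value) (simp_all add: C C_closed(5))
      next
        case 3
        then show ?thesis
          using E_large[OF z j Red] by (intro Q_cong[OF C(3) C_closed(1) _ Q_0]) (simp only: q_EE(1) q_hom(5))
      qed
    qed
  qed
  have Q_psi: "Q (psi j * ee i)" if i: "i \<in> Seq s n" and j: "crs j" for j i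
  proof -
    have j': "j \<in> {1..<length s + n}" "pos j" "pos (Suc j)"
      using j by auto
    note C = gens_C(1)[OF i] gens_C(5)[OF j] gens_C(3)[OF j'(2)] gens_C(3)[OF j'(3)] gens_C(4)[OF j'(3)] of_nat_C
      free_carrier_closed(6)[OF gens_C(5)[OF j] gens_C(1)[OF i]]
    show ?thesis
    proof (cases "entry i j"; cases "entry i (Suc j)")
      assume b: "entry i j = Black" "entry i (Suc j) = Black"
      have "\<delta> (cl (psi j * ee i)) = cl (- (xx j * psi j * ee i) - psi j * xx (Suc j) * ee i)"
        using D i j'(1) b by simp
      then show ?thesis
        using d_values(2)[OF i j b] by (intro Q_value) (simp_all add: C C_closed(3,5,6))
    next
      fix r assume b: "entry i j = Red r" "entry i (Suc j) = Black"
      have "\<delta> (cl (psi j * ee i)) = cl (of_nat r * psi j * xx (Suc j) * ee i)"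
        using D i j'(1) b by simp
      then show ?thesis
        using d_values(3)[OF i j b] by (intro Q_value) (simp_all add: C C_closed(5))
    next
      fix r assume b: "entry i j = Black" "entry i (Suc j) = Red r"
      have "\<delta> (cl (psi j * ee i)) = cl (psi j * EE 1 (Suc j) * ee i)"
        using D i j'(1) b by simp
      then show ?thesis
        using d_values(4)[OF i j b] by (intro Q_value) (simp_all add: C C_closed(5))
    next
      fix r r' assume b: "entry i j = Red r" "entry i (Suc j) = Red r'"
      show ?thesis
        using psi_red_red[OF loc_e[OF i] j b] by (intro Q_cong[OF C(7) C_closed(1) _ Q_0]) (simp add: q_hom)
    qed
  qed
  have "Q f"
    using f
  proof (induction rule: free_algebra_induct)
    case (scalar a)
    then show ?case
      using Q_scalar[OF C_closed(2) Q_1, of a] by simp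
  next
    case (gen g)
    then consider i where "g = Idempotent i" "i \<in> Seq s n" | j where "g = Dot j" "pos j"
      | m j where "g = Elem m j" "1 \<le> m" "pos j" | j where "g = Cross j" "crs j"
      by (auto simp: webster_gens_def)
    then show ?case
    proof cases
      case (1 i)
      then show ?thesis
        using D by (simp add: Q_def deriv_gen)
    next
      case (2 j)
      then show ?thesis
        using D by (simp add: Q_def deriv_gen power2_eq_square)
    next
      case (3 m j)
      then have "gen g = (EE m j :: 'k free)"
        by (simp add: EE_def)
      moreover have "Q (EE m j)"
        by (rule Q_cong[OF _ _ psi_sum(2) Q_sum])
          (use 3 Q_E in \<open>auto intro!: C_closed(5,8) gens_C\<close>)
      ultimately show ?thesis
        by simp
    next
      case (4 j)
      have "Q (psi j)"
        by (rule Q_cong[OF _ _ psi_sum(1) Q_sum])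
          (use 4 Q_psi in \<open>auto intro!: C_closed(5,8) gens_C\<close>)
      then show ?thesis
        using 4 by simp
    qed
  qed (simp_all add: Q_add Q_mult)
  then show ?thesis
    by (simp add: Q_def)
qed

text \<open>Representatives are chosen arbitrarily, since \<open>cl_d_cong\<close> makes the result
  independent of them. The restriction to the carrier makes the function extensional, as uniqueness
  is claimed among extensional functions.\<close>

definition differential :: "'k free set \<Rightarrow> 'k free set" where
  "differential = (\<lambda>x\<in>carrier A. cl (d (SOME f. f \<in> C \<and> cl f = x)))"

lemma differential_cl:
  assumes f: "f \<in> C"
  shows "differential (cl f) = cl (d f)"
proof -
  let ?g = "SOME g. g \<in> C \<and> cl g = cl f"
  have g: "?g \<in> C \<and> cl ?g = cl f"
    by (rule someI[of _ f]) (simp add: f)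
  then have "cl (d ?g) = cl (d f)"
    using cl_d_cong f by blast
  then show ?thesis
    using f by (simp add: differential_def carrier_A)
qed

lemma differential_value: "f \<in> C \<Longrightarrow> g \<in> C \<Longrightarrow> q (d f) = q g \<Longrightarrow> differential (cl f) = cl g"
  by (simp add: differential_cl cls_eq_iff d_C)

lemma webster_differential_differential: "webster_differential s n differential"
  unfolding webster_differential_def webster_eq
proof (intro conjI ballI allI impI)
  show "derivation K A differential"
    unfolding derivation_def
    by (auto simp: carrier_A differential_cl A_ops d_C C_closed deriv_add deriv_mult deriv_scalar)
next
  fix i assume "i \<in> Seq s n"
  then show "differential (cl (ee i)) = cl 0"
    by (simp add: differential_cl gens_C deriv_gen)
next
  fix j assume "j \<in> {1..length s + n}"
  then show "differential (cl (xx j)) = cl (xx j ^ 2)"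
    by (simp add: differential_cl gens_C deriv_gen power2_eq_square)
next
  fix i :: "letter list" and j m r :: nat
  assume i: "i \<in> Seq s n" and j: "j \<in> {1..length s + n}" and m: "1 \<le> m" and r: "entry i j = Red r"
  have j': "pos j"
    using j by simp
  show "differential (cl (EE m j * ee i)) = cl ((EE m j * EE 1 j - of_nat (m + 1) * EE (m + 1) j) * ee i)"
    unfolding d_E_value[symmetric] by (rule differential_cl) (intro C_closed(5) gens_C i j')
  show "differential (cl (EE m j * ee i)) = cl (EE m j * EE 1 j * ee i)" if "m = r"
    using d_values(1)[OF i j'] r that by (intro differential_value) (auto intro!: C_closed(5) gens_C i j')
next
  fix i j assume i: "i \<in> Seq s n" and j: "j \<in> {1..<length s + n}"
  then have j': "crs j" "pos j" "pos (j + 1)"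
    by auto
  note C = gens_C(1)[OF i] gens_C(5)[OF j'(1)] gens_C(3)[OF j'(2)] gens_C(3)[OF j'(3)] gens_C(4)[OF j'(3)] of_nat_C
  show "differential (cl (psi j * ee i)) = cl (- (xx j * psi j * ee i) - psi j * xx (j + 1) * ee i)"
    if "entry i j = Black \<and> entry i (j + 1) = Black"
    using d_values(2)[OF i j'(1)] that by (intro differential_value C_closed(3,5,6) C) simp
  show "differential (cl (psi j * ee i)) = cl (of_nat r * psi j * xx (j + 1) * ee i)"
    if "entry i j = Red r \<and> entry i (j + 1) = Black" for r
    using d_values(3)[OF i j'(1)] that by (intro differential_value C_closed(5) C) simp
  show "differential (cl (psi j * ee i)) = cl (psi j * EE 1 (j + 1) * ee i)"
    if "entry i j = Black \<and> entry i (j + 1) = Red r" for r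
    using d_values(4)[OF i j'(1)] that by (intro differential_value C_closed(5) C) simp
qed

lemma p_dg_algebra_differential:
  assumes p: "prime p" "of_nat p = (0 :: 'k)" and \<delta>: "webster_differential s n \<delta>"
  shows "p_dg_algebra p K A G \<delta>"
  unfolding p_dg_algebra_def
proof (intro conjI allI ballI)
  note eq = differential_eq[OF \<delta>]
  show "graded_algebra K A G"
    by (rule graded_algebra_A)
  show "derivation K A \<delta>"
    using \<delta> by (simp add: webster_differential_def webster_eq)
  show "\<delta> x \<in> G (k + 2)" if "x \<in> G k" for k x
    using that G_carrier[OF that] deriv_degree eq by (auto simp: carrier_A)
  fix x assume "x \<in> carrier A"
  then obtain f where f: "f \<in> C" "x = cl f"
    by (auto simp: carrier_A)
  have "(\<delta> ^^ k) (cl f) = cl ((d ^^ k) f)" for k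
    by (induction k) (simp_all add: eq d_power_C f)
  moreover have "of_nat p = (0 :: 'k free)"
    using p(2) by (simp add: of_nat_scalar scalar_hom)
  then have "q ((d ^^ p) f) = q 0"
    using nilpotent[OF p(1) _ f(1)] by (simp add: q_hom)
  ultimately show "(\<delta> ^^ p) x = \<zero>\<^bsub>A\<^esub>"
    using f by (simp add: cls_eq_iff d_power_C C_closed A_ops)
qed

end

theorem theorem4p1:
  fixes s :: "nat list" and n p :: nat
  assumes "p = CHAR('k::field)" and "p > 0"
  shows "(\<exists>!\<delta> :: 'k free set \<Rightarrow> 'k free set.
            \<delta> \<in> extensional (carrier (webster_algebra s n)) \<and> webster_differential s n \<delta>) \<and>
    (\<forall>\<delta> :: 'k free set \<Rightarrow> 'k free set. webster_differential s n \<delta> \<longrightarrow>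
       p_dg_algebra p ring_of_type_algebra (webster_algebra s n) (webster_grading s n) \<delta>)"
proof -
  interpret webster s n "TYPE('k)" .
  have p: "prime p" "of_nat p = (0 :: 'k)"
    using assms prime_CHAR_semidom[where 'a = 'k] by auto
  have "\<delta> = differential" if "\<delta> \<in> extensional (carrier A)" "webster_differential s n \<delta>" for \<delta>
  proof (rule extensionalityI[OF that(1)])
    show "differential \<in> extensional (carrier A)"
      by (simp add: differential_def)
    show "\<delta> x = differential x" if "x \<in> carrier A" for x
      using that differential_eq[OF \<open>webster_differential s n \<delta>\<close>] differential_cl by (auto simp: carrier_A)
  qed
  moreover have "differential \<in> extensional (carrier A)"
    by (simp add: differential_def)
  ultimately show ?thesis
    using webster_differential_differential p_dg_algebra_differential[OF p] unfolding webster_eq by blast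
qed

end
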